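(* Assume $k(c):=\lambda+\theta+\lambda\Phi'(c)<0$ for all $c\in[0,1]$. Let $c\in[0,1)$ be fixed, let $$x^0_1(c):=\frac{P_0}{\Phi(c)},\qquad x^0_2(c):=\frac{\theta\mu(1-c)+\lambda P_0}{(\lambda+\theta)(1-c)},$$ $$V(x,c):=\inf_\tau\mathsf E\big[e^{-\lambda\tau}\big(U(X^x_\tau,c)-P_0\big)\big],\qquad \mathcal D^c_V:=\{x\in\mathbb R:V(x,c)=U(x,c)-P_0\}.$$ Then: i) if $\gamma_*(c)\ge x^0_2(c)$, there exists $\ell_*(c)\in(-\infty,x^0_1(c))$ such that $\mathcal D^c_V=(-\infty,\ell_*(c)]$ and $\tau_*=\inf\{t\ge0:X^x_t\le\ell_*(c)\}$ is optimal for $V(x,c)$; ii) if $\gamma_*(c)\le x^0_1(c)$, there exists $\ell_*(c)\in(-\infty,x^0_2(c))$ such that $\mathcal D^c_V=(-\infty,\ell_*(c)]$ and $\tau_*=\inf\{t\ge0:X^x_t\le\ell_*(c)\}$ is optimal for $V(x,c)$; iii) if $x^0_1(c)<\gamma_*(c)<x^0_2(c)$, there exists $\ell^{(1)}_*(c)\in(-\infty,x^0_1(c))$ such that $\mathcal D^c_V\cap(-\infty,\gamma_*(c)]=(-\infty,\ell^{(1)}_*(c)]$. Moreover, either (a) $\mathcal D^c_V\cap[\gamma_*(c),\infty)=\emptyset$ and $\tau_*=\inf\{t\ge0:X^x_t\le\ell^{(1)}_*(c)\}$ is optimal for $V(x,c)$, or (b) there exist $\ell^{(2)}_*(c)\le\ell^{(3)}_*(c)\le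 x^0_2(c)$ such that $\mathcal D^c_V\cap[\gamma_*(c),\infty)=[\ell^{(2)}_*(c),\ell^{(3)}_*(c)]$ (a single point if $\ell^{(2)}_*(c)=\ell^{(3)}_*(c)$), and the stopping time $$\tau^{(II)}_*:=\inf\{t\ge0:X^x_t\le\ell^{(1)}_*(c)\ \text{or}\ X^x_t\in[\ell^{(2)}_*(c),\ell^{(3)}_*(c)]\}$$ is optimal for $V(x,c)$.
   Context: Let $(\Omega,\mathcal A,\mathsf P)$ be a complete probability space carrying a one-dimensional standard Brownian motion $B$, with $(\mathcal F_t)_{t\ge0}$ the filtration generated by $B$ augmented by $\mathsf P$-null sets. Infima over $\tau$ are over all $(\mathcal F_t)$-stopping times valued in $[0,\infty]$, and $e^{-\lambda\tau}(U(X^x_\tau,c)-P_0):=0$ on $\{\tau=\infty\}$. Let $\theta,\mu,\sigma,\lambda,P_0>0$ be constants. For $x\in\mathbb R$, $X^x$ is the unique strong solution of $dX^x_t=\theta(\mu-X^x_t)dt+\sigma dB_t$, $X^x_0=x$, and $\mathbb L_Xf(x):=\tfrac12\sigma^2f''(x)+\theta(\mu-x)f'(x)$. Optimality of a stopping time for $V(x,c)$ is for every $x\in\mathbb R$ (initial state of $X^x$). $\Phi:\mathbb R\to\mathbb R$ is $C^2$, and on $[0,1]$ it is decreasing and strictly convex, with $\Phi(1)=0$. For $c\in[0,1]$, $\mathcal S^c_0$ is the set of processes $\nu:\Omega\times[0,\infty)\to[0,\infty)$ that are nondecreasing, left-continuous, $(\mathcal F_t)$-adapted, with $c+\nu_t\le1$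 for all $t\ge0$ and $\nu_0=0$, $\mathsf P$-a.s., and $$U(x,c):=\inf_{\nu\in\mathcal S^c_0}\mathsf E\Big[\int_{[0,\infty)}e^{-\lambda t}X^x_t\,d\nu_t+\int_0^\infty e^{-\lambda t}\lambda X^x_t\Phi(c+\nu_t)\,dt\Big].$$ Known background when $k<0$ on $[0,1]$ (defining $\gamma_*$): there is a decreasing function $\gamma_*\in C^1([0,1])$ such that $\{(x,c)\in\mathbb R\times[0,1]:U_c(x,c)>-x\}=\{(x,c)\in\mathbb R\times[0,1]:x<\gamma_*(c)\}$; it is bounded from below by $\tilde x(c)\vee\overline x_0(c)$ with $\tilde x(c):=\theta\mu(1-c)/\zeta(c)$, $\overline x_0(c):=\theta\mu\Phi(c)/\zeta(c)$, $\zeta(c):=(\lambda+\theta)(1-c)-\lambda\Phi(c)$; $U(\cdot,c)\in W^{2,\infty}_{loc}(\mathbb R)$; and $$U(x,c)=\begin{cases}\dfrac{\psi_\lambda(x)}{\psi_\lambda(\gamma_*(c))}\Big[\gamma_*(c)(1-c)-\lambda\Phi(c)\Big(\dfrac{\gamma_*(c)-\mu}{\lambda+\theta}+\dfrac{\mu}{\lambda}\Big)\Big]+\lambda\Phi(c)\Big[\dfrac{x-\mu}{\lambda+\theta}+\dfrac\mu\lambda\Big], & x<\gamma_*(c),\\[6pt] x(1-c), & x\ge\gamma_*(c),\end{cases}$$ where $\psi_\lambda:\mathbb R\to(0,\infty)$ is the (unique up to a positive factor) strictly increasing fundamental solution of $\mathbb L_Xf=\lambda f$ on $\mathbb R$.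 *)

theory Defs
  imports "HOL-Probability.Probability"
begin

text \<open>Time-indexed real processes have type \<^typ>\<open>real \<Rightarrow> 'a \<Rightarrow> real\<close> with the time argument first;
  only times \<open>t \<ge> 0\<close> matter. Path properties (continuity, initial values, the state equation,
  monotonicity of controls) are required almost surely.\<close>

definition standard_brownian_motion :: "'a measure \<Rightarrow> (real \<Rightarrow> 'a \<Rightarrow> real) \<Rightarrow> bool" where
  "standard_brownian_motion M B \<longleftrightarrow>
     (\<forall>t\<ge>0. B t \<in> borel_measurable M) \<and>
     (AE \<omega> in M. B 0 \<omega> = 0) \<and>
     (AE \<omega> in M. continuous_on {0..} (\<lambda>t. B t \<omega>)) \<and>
     (\<forall>s t. 0 \<le> s \<and> s < t \<longrightarrow>
        distributed M lborel (\<lambda>\<omega>. B t \<omega> - B s \<omega>) (normal_density 0 (sqrt (t - s)))) \<and>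
     (\<forall>(n::nat) (t::nat \<Rightarrow> real). 0 \<le> t 0 \<and> mono t \<longrightarrow>
        prob_space.indep_vars M (\<lambda>_. borel) (\<lambda>i \<omega>. B (t (Suc i)) \<omega> - B (t i) \<omega>) {..<n})"

text \<open>The index type is \<^typ>\<open>ennreal\<close> so that \<^const>\<open>stopping_time\<close> yields stopping times with
  values in \<open>[0, \<infinity>]\<close>. The \<open>\<sigma>\<close>-algebra at index \<open>\<infinity>\<close> is the one generated by all of them; it imposes
  nothing on stopping times since \<open>{\<tau> \<le> \<infinity>}\<close> is the whole space.\<close>

definition aug_filtration :: "'a measure \<Rightarrow> (real \<Rightarrow> 'a \<Rightarrow> real) \<Rightarrow> ennreal \<Rightarrow> 'a measure" where
  "aug_filtration M B t = sigma (space M)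
     ({B s -` A \<inter> space M | s A. 0 \<le> s \<and> ennreal s \<le> t \<and> A \<in> sets borel} \<union> null_sets M)"

text \<open>The noise is additive, so the Ito integral \<open>\<integral>\<^sub>0\<^sup>t \<sigma> dB\<close> is \<open>\<sigma> B\<^sub>t\<close> (\<open>B\<^sub>0 = 0\<close> almost surely).\<close>

definition OU_strong_solution ::
  "'a measure \<Rightarrow> (real \<Rightarrow> 'a \<Rightarrow> real) \<Rightarrow> real \<Rightarrow> real \<Rightarrow> real \<Rightarrow> real \<Rightarrow> (real \<Rightarrow> 'a \<Rightarrow> real) \<Rightarrow> bool" where
  "OU_strong_solution M B \<theta> \<mu> \<sigma> x X \<longleftrightarrow>
     (\<forall>t\<ge>0. X t \<in> borel_measurable (aug_filtration M B (ennreal t))) \<and>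
     (AE \<omega> in M. continuous_on {0..} (\<lambda>t. X t \<omega>)) \<and>
     (AE \<omega> in M. \<forall>t\<ge>0. X t \<omega> = x + (LBINT s:{0..t}. \<theta> * (\<mu> - X s \<omega>)) + \<sigma> * B t \<omega>)"

definition OU_generator :: "real \<Rightarrow> real \<Rightarrow> real \<Rightarrow> (real \<Rightarrow> real) \<Rightarrow> real \<Rightarrow> real" where
  "OU_generator \<theta> \<mu> \<sigma> f x = 1/2 * \<sigma>\<^sup>2 * deriv (deriv f) x + \<theta> * (\<mu> - x) * deriv f x"

definition increasing_fundamental_solution ::
  "real \<Rightarrow> real \<Rightarrow> real \<Rightarrow> real \<Rightarrow> (real \<Rightarrow> real) \<Rightarrow> bool" where
  "increasing_fundamental_solution \<theta> \<mu> \<sigma> lam \<psi> \<longleftrightarrow>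
     (\<forall>x. \<psi> x > 0) \<and> strict_mono \<psi> \<and>
     (\<forall>x. \<psi> field_differentiable at x \<and> deriv \<psi> field_differentiable at x) \<and>
     (\<forall>x. OU_generator \<theta> \<mu> \<sigma> \<psi> x = lam * \<psi> x)"

definition strictly_convex_on :: "real set \<Rightarrow> (real \<Rightarrow> real) \<Rightarrow> bool" where
  "strictly_convex_on S f \<longleftrightarrow> convex S \<and>
     (\<forall>x\<in>S. \<forall>y\<in>S. \<forall>t\<in>{0<..<1}. x \<noteq> y \<longrightarrow>
        f ((1 - t) * x + t * y) < (1 - t) * f x + t * f y)"

definition C2_function :: "(real \<Rightarrow> real) \<Rightarrow> bool" where
  "C2_function f \<longleftrightarrow>
     (\<forall>x. f field_differentiable at x \<and> deriv f field_differentiable at x) \<and>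
     continuous_on UNIV (deriv (deriv f))"

definition C1_on :: "real set \<Rightarrow> (real \<Rightarrow> real) \<Rightarrow> bool" where
  "C1_on S f \<longleftrightarrow>
     (\<exists>f'. continuous_on S f' \<and> (\<forall>x\<in>S. (f has_real_derivative f' x) (at x within S)))"

definition test_function :: "(real \<Rightarrow> real) \<Rightarrow> bool" where
  "test_function \<phi> \<longleftrightarrow>
     (\<forall>n x. (deriv ^^ n) \<phi> field_differentiable at x) \<and> (\<exists>R. \<forall>x. \<bar>x\<bar> > R \<longrightarrow> \<phi> x = 0)"

definition loc_bounded :: "(real \<Rightarrow> real) \<Rightarrow> bool" where
  "loc_bounded f \<longleftrightarrow> f \<in> borel_measurable lebesgue \<and>
     (\<forall>R. \<exists>C. AE x in lebesgue. \<bar>x\<bar> \<le> R \<longrightarrow> \<bar>f x\<bar> \<le> C)"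

definition weak_derivative :: "(real \<Rightarrow> real) \<Rightarrow> (real \<Rightarrow> real) \<Rightarrow> bool" where
  "weak_derivative f g \<longleftrightarrow>
     (\<forall>\<phi>. test_function \<phi> \<longrightarrow>
        (LINT x|lebesgue. f x * deriv \<phi> x) = - (LINT x|lebesgue. g x * \<phi> x))"

text \<open>The local Sobolev space \<open>W\<^sup>2\<^sup>,\<^sup>\<infinity>\<close> on the real line.\<close>

definition W2inf_loc :: "(real \<Rightarrow> real) \<Rightarrow> bool" where
  "W2inf_loc f \<longleftrightarrow>
     (\<exists>g h. loc_bounded f \<and> loc_bounded g \<and> loc_bounded h \<and>
        weak_derivative f g \<and> weak_derivative g h)"

definition admissible_controls ::
  "'a measure \<Rightarrow> (real \<Rightarrow> 'a \<Rightarrow> real) \<Rightarrow> real \<Rightarrow> (real \<Rightarrow> 'a \<Rightarrow> real) set" where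
  "admissible_controls M B c = {\<nu>.
     (\<forall>t\<ge>0. \<nu> t \<in> borel_measurable (aug_filtration M B (ennreal t))) \<and>
     (\<forall>t\<ge>0. \<forall>\<omega>\<in>space M. 0 \<le> \<nu> t \<omega>) \<and>
     (AE \<omega> in M.
        mono_on {0..} (\<lambda>t. \<nu> t \<omega>) \<and>
        (\<forall>t>0. continuous (at_left t) (\<lambda>s. \<nu> s \<omega>)) \<and>
        (\<forall>t\<ge>0. c + \<nu> t \<omega> \<le> 1) \<and>
        \<nu> 0 \<omega> = 0)}"

text \<open>The Lebesgue-Stieltjes measure of a nondecreasing left-continuous \<open>v\<close> on \<open>[0, \<infinity>)\<close> gives
  \<open>[a, b)\<close> the mass \<open>v b - v a\<close>; in particular it has an atom of mass \<open>v(0+) - v 0\<close> at \<open>0\<close>.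
  Since \<^const>\<open>interval_measure\<close> expects a right-continuous distribution function, the right limits
  of \<open>v\<close> are used, with the value \<open>v 0\<close> on the negative half-line.\<close>

definition stieltjes_measure :: "(real \<Rightarrow> real) \<Rightarrow> real measure" where
  "stieltjes_measure v = interval_measure (\<lambda>t. if t < 0 then v 0 else Lim (at_right t) v)"

definition control_cost ::
  "'a measure \<Rightarrow> real \<Rightarrow> (real \<Rightarrow> real) \<Rightarrow> (real \<Rightarrow> 'a \<Rightarrow> real) \<Rightarrow> real \<Rightarrow> (real \<Rightarrow> 'a \<Rightarrow> real) \<Rightarrow> real" where
  "control_cost M lam \<Phi> X c \<nu> =
     (LINT \<omega>|M. (LINT t:{0..}|stieltjes_measure (\<lambda>t. \<nu> t \<omega>). exp (- lam * t) * X t \<omega>)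
              + (LBINT t:{0..}. exp (- lam * t) * lam * X t \<omega> * \<Phi> (c + \<nu> t \<omega>)))"

text \<open>For a strong solution \<open>X\<close> and \<open>c \<in> [0, 1]\<close> the costs form a nonempty set bounded below
  (\<open>e\<^sup>-\<^sup>\<lambda>\<^sup>t \<bar>X\<^sub>t\<bar>\<close> has an integrable supremum), so the real-valued infimum is the intended one;
  likewise for \<open>stopping_value\<close> below with a gain of linear growth.\<close>

definition control_value ::
  "'a measure \<Rightarrow> (real \<Rightarrow> 'a \<Rightarrow> real) \<Rightarrow> real \<Rightarrow> (real \<Rightarrow> real) \<Rightarrow> (real \<Rightarrow> 'a \<Rightarrow> real) \<Rightarrow> real \<Rightarrow> real" where
  "control_value M B lam \<Phi> X c = (INF \<nu>\<in>admissible_controls M B c. control_cost M lam \<Phi> X c \<nu>)"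

definition stopping_cost ::
  "'a measure \<Rightarrow> real \<Rightarrow> (real \<Rightarrow> real) \<Rightarrow> (real \<Rightarrow> 'a \<Rightarrow> real) \<Rightarrow> ('a \<Rightarrow> ennreal) \<Rightarrow> real" where
  "stopping_cost M lam g X \<tau> =
     (LINT \<omega>|M. (if \<tau> \<omega> = \<infinity> then 0
                 else exp (- lam * enn2real (\<tau> \<omega>)) * g (X (enn2real (\<tau> \<omega>)) \<omega>)))"

definition stopping_value ::
  "'a measure \<Rightarrow> (real \<Rightarrow> 'a \<Rightarrow> real) \<Rightarrow> real \<Rightarrow> (real \<Rightarrow> real) \<Rightarrow> (real \<Rightarrow> 'a \<Rightarrow> real) \<Rightarrow> real" where
  "stopping_value M B lam g X =
     (INF \<tau>\<in>{\<tau>. stopping_time (aug_filtration M B) \<tau>}. stopping_cost M lam g X \<tau>)"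

definition optimal_stopping_time ::
  "'a measure \<Rightarrow> (real \<Rightarrow> 'a \<Rightarrow> real) \<Rightarrow> real \<Rightarrow> (real \<Rightarrow> real) \<Rightarrow> (real \<Rightarrow> 'a \<Rightarrow> real) \<Rightarrow> ('a \<Rightarrow> ennreal) \<Rightarrow> bool" where
  "optimal_stopping_time M B lam g X \<tau> \<longleftrightarrow>
     stopping_time (aug_filtration M B) \<tau> \<and>
     stopping_cost M lam g X \<tau> = stopping_value M B lam g X"

text \<open>The infimum over the empty set is \<open>\<infinity>\<close> in \<^typ>\<open>ennreal\<close>.\<close>

definition entry_time :: "(real \<Rightarrow> 'a \<Rightarrow> real) \<Rightarrow> real set \<Rightarrow> 'a \<Rightarrow> ennreal" where
  "entry_time X A \<omega> = (INF t\<in>{t. 0 \<le> t \<and> X t \<omega> \<in> A}. ennreal t)"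

definition zeta :: "real \<Rightarrow> real \<Rightarrow> (real \<Rightarrow> real) \<Rightarrow> real \<Rightarrow> real" where
  "zeta \<theta> lam \<Phi> c = (lam + \<theta>) * (1 - c) - lam * \<Phi> c"

definition x1_0 :: "real \<Rightarrow> (real \<Rightarrow> real) \<Rightarrow> real \<Rightarrow> real" where
  "x1_0 P0 \<Phi> c = P0 / \<Phi> c"

definition x2_0 :: "real \<Rightarrow> real \<Rightarrow> real \<Rightarrow> real \<Rightarrow> real \<Rightarrow> real" where
  "x2_0 \<theta> \<mu> lam P0 c = (\<theta> * \<mu> * (1 - c) + lam * P0) / ((lam + \<theta>) * (1 - c))"

text \<open>The properties determining the free boundary \<open>\<gamma>\<close> of the control problem with value
  function \<open>U\<close>. The partial derivative of \<open>U\<close> in \<open>c\<close> is taken within \<open>[0, 1]\<close>, hence one-sided at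
  the end points. The lower bound on \<open>\<gamma>\<close> is stated for \<open>c < 1\<close> only, because both quotients have
  the form \<open>0/0\<close> at \<open>c = 1\<close>.\<close>

definition control_boundary ::
  "real \<Rightarrow> real \<Rightarrow> real \<Rightarrow> (real \<Rightarrow> real) \<Rightarrow> (real \<Rightarrow> real) \<Rightarrow> (real \<Rightarrow> real \<Rightarrow> real) \<Rightarrow> (real \<Rightarrow> real) \<Rightarrow> bool" where
  "control_boundary \<theta> \<mu> lam \<Phi> \<psi> U \<gamma> \<longleftrightarrow>
     antimono_on {0..1} \<gamma> \<and> C1_on {0..1} \<gamma> \<and>
     (\<forall>x. \<forall>c\<in>{0..1}. (\<lambda>y. U x y) differentiable (at c within {0..1})) \<and>
     {(x, c). c \<in> {0..1} \<and> vector_derivative (\<lambda>y. U x y) (at c within {0..1}) > - x}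
       = {(x, c). c \<in> {0..1} \<and> x < \<gamma> c} \<and>
     (\<forall>c\<in>{0..<1}. max (\<theta> * \<mu> * (1 - c) / zeta \<theta> lam \<Phi> c) (\<theta> * \<mu> * \<Phi> c / zeta \<theta> lam \<Phi> c) \<le> \<gamma> c) \<and>
     (\<forall>c\<in>{0..1}. W2inf_loc (\<lambda>x. U x c)) \<and>
     (\<forall>c\<in>{0..1}. \<forall>x. U x c =
        (if x < \<gamma> c
         then \<psi> x / \<psi> (\<gamma> c) *
                (\<gamma> c * (1 - c) - lam * \<Phi> c * ((\<gamma> c - \<mu>) / (lam + \<theta>) + \<mu> / lam))
              + lam * \<Phi> c * ((x - \<mu>) / (lam + \<theta>) + \<mu> / lam)
         else x * (1 - c)))"

end

theory Submission
  imports Defs "HOL-Real_Asymp.Real_Asymp" "HOL-Computational_Algebra.Polynomial"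
begin

text \<open>Write \<open>G = U(\<cdot>, c) - P\<^sub>0\<close>. Away from \<open>\<gamma>\<^sub>*(c)\<close> the function \<open>h = (\<bbbL>\<^sub>X - \<lambda>) G\<close> is affine, with
  sign change at \<open>x\<^sup>0\<^sub>1(c)\<close> on the left branch and at \<open>x\<^sup>0\<^sub>2(c)\<close> on the right one; local
  \<open>W\<^sup>2\<^sup>,\<^sup>\<infinity>\<close>-regularity excludes a kink at \<open>\<gamma>\<^sub>*(c)\<close>. With \<open>\<phi>(x) = \<psi>(2 \<mu> - x)\<close>, the decreasing
  fundamental solution, \<open>G / \<phi>\<close> as a function of \<open>\<psi> / \<phi>\<close> is convex where \<open>h > 0\<close> and concave where
  \<open>h < 0\<close>, and the value function divided by \<open>\<phi>\<close> is its largest nonincreasing convex minorant: it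
  leaves \<open>G / \<phi>\<close> along a horizontal line and, when there are two convex pieces, possibly along one
  common tangent between them.

  Optimality is verified without stochastic integration. A candidate \<open>V\<close> with
  \<open>h\<^sub>V = (\<bbbL>\<^sub>X - \<lambda>) V \<ge> 0\<close> is \<open>- R h\<^sub>V\<close>, where \<open>R\<close> is the \<open>\<lambda>\<close>-resolvent of the explicit Gaussian
  semigroup. The Markov property along grid times decreasing to a stopping time \<open>\<tau>\<close> gives
  \<open>E e\<^sup>-\<^sup>\<lambda>\<^sup>\<tau> (- V)(X\<^sub>\<tau>) \<le> - V(x)\<close>, with equality if \<open>h\<^sub>V(X)\<close> vanishes before \<open>\<tau>\<close>.\<close>


section \<open>The Ornstein-Uhlenbeck semigroup and its resolvent\<close>

text \<open>Monotonicity in the scale stems from the option never to stop: it keeps the value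
  nonpositive, and a convex function on (0, \<infinity>) that is bounded above is nonincreasing. The
  contact lines are therefore negative multiples of \<open>\<phi>\<close>, or combinations of
  \<open>\<phi>\<close> and \<open>\<psi>\<close> with a negative factor at \<open>\<psi>\<close>.
  From k < 0 and \<Phi>(1) = 0 follows x1 < x2; this order leaves h one sign change in the first two
  cases and three in the third. A candidate is only of class C1, with jumps in its second
  derivative, and entry times are unbounded. The signs V \<le> 0 and (L - \<lambda>) V \<ge> 0 make
  nearly every quantity an integral of nonnegative functions, so that Tonelli and Fatou apply
  freely. Only the equality at the entry time runs against Fatou; uniform integrability then comes
  from the resolvent itself, used to represent a quadratic function. The transition law rests on the
  additive noise: the state is an almost sure limit of weighted Brownian increments, hence Gaussian
  given the past.\<close>

lemma std_normal_density_DERIV: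
  "(std_normal_density has_real_derivative (- z * std_normal_density z)) (at z)"
  unfolding std_normal_density_def
  by (auto intro!: derivative_eq_intros simp: field_simps power2_eq_square)

lemma std_normal_integral_density:
  fixes f :: "real \<Rightarrow> real"
  assumes "f \<in> borel_measurable borel"
  shows "(LINT z|std_normal_distribution. f z) = (LINT z|lborel. std_normal_density z * f z)"
    and "integrable std_normal_distribution f \<longleftrightarrow> integrable lborel (\<lambda>z. std_normal_density z * f z)"
  using assms by (auto simp: integral_density integrable_density)

interpretation std_normal: prob_space std_normal_distribution
  by (rule prob_space_normal_density) simp

text \<open>Cubic growth is what occurs: functions of at most quadratic growth, times one factor
  \<open>z\<close> from the derivative of the standard deviation.\<close>

lemma std_normal_integrable_cubic:
  fixes f :: "real \<Rightarrow> real"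
  assumes "f \<in> borel_measurable borel" and "\<And>z. \<bar>f z\<bar> \<le> C * (1 + \<bar>z\<bar>^3)"
  shows "integrable std_normal_distribution f"
proof (rule Bochner_Integration.integrable_bound)
  have "integrable std_normal_distribution (\<lambda>z. \<bar>z^3\<bar>)"
    by (rule integrable_abs, rule integrable_std_normal_distribution_moment)
  then show "integrable std_normal_distribution (\<lambda>z. C * (1 + \<bar>z\<bar>^3))"
    by (simp add: power_abs)
  show "AE x in std_normal_distribution. norm (f x) \<le> norm (C * (1 + \<bar>x\<bar> ^ 3))"
    using assms(2) by (auto intro: order_trans[OF _ abs_ge_self])
qed (use assms in simp)

lemma quadratic_le_cubic: "1 + (x::real)\<^sup>2 \<le> 2 * (1 + \<bar>x\<bar>^3)"
proof (cases "\<bar>x\<bar> \<le> 1")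
  case True
  then have "x\<^sup>2 \<le> 1" by (simp add: abs_square_le_1)
  then show ?thesis by (smt (verit) zero_le_power abs_ge_zero)
next
  case False
  then have "\<bar>x\<bar>^2 \<le> \<bar>x\<bar>^3" by (intro power_increasing) auto
  moreover have "0 \<le> \<bar>x\<bar>^3" by simp
  moreover have "1 + a \<le> 2 * (1 + b)" if "a \<le> b" "0 \<le> b" for a b :: real using that by simp
  ultimately show ?thesis unfolding power2_abs by blast
qed

lemma cubic_bound:
  fixes z :: real
  shows "(1 + z\<^sup>2) * (1 + \<bar>z\<bar>) \<le> 4 * (1 + \<bar>z\<bar>^3)"
proof -
  have "(1 + z\<^sup>2) * (1 + \<bar>z\<bar>) = 1 + z\<^sup>2 + \<bar>z\<bar> + \<bar>z\<bar>^3"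
    by (simp add: power2_eq_square power3_eq_cube algebra_simps abs_mult)
  moreover have "\<bar>z\<bar> \<le> 1 + \<bar>z\<bar>^3"
  proof (cases "\<bar>z\<bar> \<le> 1")
    case True then show ?thesis by (smt (verit) zero_le_power abs_ge_zero)
  next
    case False
    then have "\<bar>z\<bar>^1 \<le> \<bar>z\<bar>^3" by (intro power_increasing) auto
    then show ?thesis by simp
  qed
  ultimately show ?thesis using quadratic_le_cubic[of z] by (smt (verit))
qed

text \<open>Stein's identity: \<open>- z\<close> times the normal density is its derivative, so the
  product rule gives the claim up to boundary terms killed by Gaussian decay. Finitely many points
  without a derivative are allowed because the second derivative of a candidate value function
  jumps.\<close>

lemma gaussian_integration_by_parts:
  fixes f f' :: "real \<Rightarrow> real"
  assumes S: "finite S" and f: "continuous_on UNIV f"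
    and f': "\<And>z. z \<notin> S \<Longrightarrow> (f has_real_derivative f' z) (at z)"
    and [measurable]: "f' \<in> borel_measurable borel"
    and bf: "\<And>z. \<bar>f z\<bar> \<le> C * (1 + z\<^sup>2)" and bf': "\<And>z. \<bar>f' z\<bar> \<le> C * (1 + z\<^sup>2)"
  shows "(LINT z|std_normal_distribution. z * f z) = (LINT z|std_normal_distribution. f' z)"
proof -
  let ?n = std_normal_density
  have [measurable]: "f \<in> borel_measurable borel"
    using f by (rule borel_measurable_continuous_onI)
  have C: "C \<ge> 0" using bf[of 0] by simp
  have i1: "integrable std_normal_distribution (\<lambda>z. z * f z)"
  proof (rule std_normal_integrable_cubic)
    fix z
    have "\<bar>z * f z\<bar> \<le> (1 + \<bar>z\<bar>) * (C * (1 + z\<^sup>2))"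
      unfolding abs_mult using bf[of z] C by (intro mult_mono) auto
    also have "\<dots> = C * ((1 + z\<^sup>2) * (1 + \<bar>z\<bar>))" by (simp add: algebra_simps)
    also have "\<dots> \<le> C * (4 * (1 + \<bar>z\<bar>^3))"
      using cubic_bound C by (intro mult_left_mono) auto
    finally show "\<bar>z * f z\<bar> \<le> (4*C) * (1 + \<bar>z\<bar>^3)" by (simp add: algebra_simps)
  qed simp
  have i2: "integrable std_normal_distribution f'"
  proof (rule std_normal_integrable_cubic)
    fix z
    have "\<bar>f' z\<bar> \<le> C * (1 + z\<^sup>2)" by (rule bf')
    also have "\<dots> \<le> C * (2 * (1 + \<bar>z\<bar>^3))"
      using quadratic_le_cubic C by (intro mult_left_mono) auto
    finally show "\<bar>f' z\<bar> \<le> (2*C) * (1 + \<bar>z\<bar>^3)" by (simp add: algebra_simps)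
  qed simp
  define k where "k z = ?n z * f' z - ?n z * (z * f z)" for z
  have [measurable]: "k \<in> borel_measurable borel" unfolding k_def by measurable
  have ik: "integrable lborel k"
    unfolding k_def using i1 i2 by (intro Bochner_Integration.integrable_diff) (simp_all add: std_normal_integral_density)
  have eq: "(LBINT z:{-real m..real m}. k z) = ?n (real m) * f (real m) - ?n (- real m) * f (- real m)" for m
  proof -
    have "(k has_integral (?n (real m) * f (real m) - ?n (- real m) * f (- real m))) {- real m..real m}"
    proof (rule fundamental_theorem_of_calculus_interior_strong[OF S])
      fix x assume "x \<in> {- real m<..<real m} - S"
      then have "((\<lambda>x. ?n x * f x) has_real_derivative k x) (at x)"
        by (auto intro!: derivative_eq_intros std_normal_density_DERIV f' simp: k_def algebra_simps)
      then show "((\<lambda>x. ?n x * f x) has_vector_derivative k x) (at x)"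
        by (simp add: has_real_derivative_iff_has_vector_derivative)
    next
      show "continuous_on {- real m..real m} (\<lambda>x. ?n x * f x)"
        using DERIV_continuous_on[OF has_field_derivative_at_within[OF std_normal_density_DERIV]]
          continuous_on_subset[OF f]
        by (intro continuous_on_mult) auto
    qed auto
    moreover have "set_integrable lborel {-real m..real m} k"
      using ik unfolding set_integrable_def
      by (intro integrable_mult_indicator) auto
    ultimately show ?thesis
      by (metis set_borel_integral_eq_integral(2) integral_unique)
  qed
  have "(\<lambda>m. LBINT z:{-real m..real m}. k z) \<longlonglongrightarrow> (LINT z|lborel. k z)"
    unfolding set_lebesgue_integral_def
  proof (rule integral_dominated_convergence)
    show "integrable lborel (\<lambda>z. norm (k z))" using ik by simp
    show "AE x in lborel. (\<lambda>m. indicat_real {- real m..real m} x *\<^sub>R k x) \<longlonglongrightarrow> k x"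
    proof (intro AE_I2)
      fix x :: real
      obtain m0 where m0: "\<bar>x\<bar> < real m0" using reals_Archimedean2 by blast
      show "(\<lambda>m. indicat_real {- real m..real m} x *\<^sub>R k x) \<longlonglongrightarrow> k x"
        by (rule tendsto_eventually, rule eventually_sequentiallyI[of m0]) (use m0 in \<open>auto simp: indicator_def\<close>)
    qed
  qed (auto simp: indicator_def)
  moreover have "(\<lambda>m. ?n (real m) * f (real m) - ?n (- real m) * f (- real m)) \<longlonglongrightarrow> 0"
  proof (rule Lim_null_comparison)
    show "(\<lambda>m. 2 * C * (exp (- (real m)\<^sup>2 / 2) * (1 + (real m)\<^sup>2))) \<longlonglongrightarrow> 0"
      by real_asymp
    have n1: "?n x \<le> exp (- x\<^sup>2/2)" for x
    proof -
      have "1 / sqrt (2*pi) \<le> 1" using pi_gt3 by (simp add: real_le_rsqrt)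
      then have "(1 / sqrt (2*pi)) * exp (- x\<^sup>2/2) \<le> 1 * exp (- x\<^sup>2/2)" by (intro mult_right_mono) auto
      then show ?thesis by (simp add: std_normal_density_def)
    qed
    have n2: "\<bar>?n x * f x\<bar> \<le> exp (- x\<^sup>2/2) * (C * (1 + x\<^sup>2))" for x
      unfolding abs_mult using n1[of x] bf[of x] by (intro mult_mono) auto
    show "\<forall>\<^sub>F m in sequentially. norm (?n (real m) * f (real m) - ?n (- real m) * f (- real m))
        \<le> 2 * C * (exp (- (real m)\<^sup>2 / 2) * (1 + (real m)\<^sup>2))"
    proof (intro always_eventually allI)
      fix m
      show "norm (?n (real m) * f (real m) - ?n (- real m) * f (- real m))
          \<le> 2 * C * (exp (- (real m)\<^sup>2 / 2) * (1 + (real m)\<^sup>2))"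
        using n2[of "real m"] n2[of "- real m"] by (simp add: algebra_simps)
    qed
  qed
  ultimately have "(LINT z|lborel. k z) = 0"
    unfolding eq using LIMSEQ_unique by blast
  moreover have "(LINT z|lborel. k z) = (LINT z|std_normal_distribution. f' z) - (LINT z|std_normal_distribution. z * f z)"
    using i1 i2 unfolding k_def
    by (subst Bochner_Integration.integral_diff) (simp_all add: std_normal_integral_density)
  ultimately show ?thesis by simp
qed


locale ou_parameters =
  fixes \<theta> \<mu> \<sigma> lam :: real
  assumes pos: "\<theta> > 0" "\<sigma> > 0" "lam > 0"
begin

definition ou_mean :: "real \<Rightarrow> real \<Rightarrow> real" where
  "ou_mean t x = \<mu> + (x - \<mu>) * exp (- \<theta> * t)"

definition ou_sd :: "real \<Rightarrow> real" where
  "ou_sd t = \<sigma> * sqrt ((1 - exp (- 2 * \<theta> * t)) / (2 * \<theta>))"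

lemma ou_sd_nonneg: "t \<ge> 0 \<Longrightarrow> ou_sd t \<ge> 0"
  using pos by (simp add: ou_sd_def)

lemma ou_sd_pos: "t > 0 \<Longrightarrow> ou_sd t > 0"
  using pos by (simp add: ou_sd_def)

lemma ou_sd_0 [simp]: "ou_sd 0 = 0" and ou_mean_0 [simp]: "ou_mean 0 x = x"
  by (simp_all add: ou_sd_def ou_mean_def)

lemma ou_sd_power2: "t \<ge> 0 \<Longrightarrow> (ou_sd t)\<^sup>2 = \<sigma>\<^sup>2 * (1 - exp (- 2 * \<theta> * t)) / (2 * \<theta>)"
  using pos by (simp add: ou_sd_def power_mult_distrib)

lemma ou_sd_mono: "0 \<le> s \<Longrightarrow> s \<le> t \<Longrightarrow> ou_sd s \<le> ou_sd t"
  using pos unfolding ou_sd_def by (intro mult_left_mono real_sqrt_le_mono divide_right_mono) auto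

lemma ou_sd_le: "t \<ge> 0 \<Longrightarrow> ou_sd t \<le> \<sigma> * sqrt (1 / (2 * \<theta>))"
  using pos unfolding ou_sd_def by (intro mult_left_mono real_sqrt_le_mono divide_right_mono) auto

lemma continuous_ou_mean: "continuous_on A (\<lambda>t. ou_mean t x)"
  unfolding ou_mean_def by (intro continuous_intros)

lemma continuous_ou_sd: "continuous_on A ou_sd"
  unfolding ou_sd_def using pos by (intro continuous_intros) auto

lemma measurable_ou [measurable]:
  "(\<lambda>(t, x). ou_mean t x) \<in> borel_measurable (borel \<Otimes>\<^sub>M borel)" "ou_sd \<in> borel_measurable borel"
  unfolding ou_mean_def ou_sd_def by measurable

lemma abs_ou_mean_le: "t \<ge> 0 \<Longrightarrow> \<bar>ou_mean t x\<bar> \<le> \<bar>\<mu>\<bar> + \<bar>x - \<mu>\<bar>"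
proof -
  assume "t \<ge> 0"
  then have "\<bar>x - \<mu>\<bar> * exp (- \<theta> * t) \<le> \<bar>x - \<mu>\<bar> * 1"
    using pos by (intro mult_left_mono) auto
  then have "\<bar>(x - \<mu>) * exp (- \<theta> * t)\<bar> \<le> \<bar>x - \<mu>\<bar>" by (simp add: abs_mult)
  then show ?thesis
    unfolding ou_mean_def using abs_triangle_ineq[of \<mu> "(x - \<mu>) * exp (- \<theta> * t)"] by linarith
qed

text \<open>The mean stays within a bounded distance of \<open>\<mu>\<close> and the standard
  deviation below its stationary value, so one constant serves all times
  \<open>t \<ge> 0\<close>.\<close>

lemma ou_square_bound:
  obtains K where "K > 0" "\<And>t z. t \<ge> 0 \<Longrightarrow> 1 + (ou_mean t x + ou_sd t * z)\<^sup>2 \<le> K * (1 + z\<^sup>2)"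
proof
  define a where "a = \<bar>\<mu>\<bar> + \<bar>x - \<mu>\<bar>"
  define b where "b = \<sigma> * sqrt (1 / (2 * \<theta>))"
  show "1 + 2 * a\<^sup>2 + 2 * b\<^sup>2 > 0"
    using zero_le_power2[of a] zero_le_power2[of b] by linarith
  fix t z :: real assume t: "t \<ge> 0"
  have "\<bar>ou_mean t x + ou_sd t * z\<bar> \<le> a + b * \<bar>z\<bar>"
  proof -
    have "\<bar>ou_sd t * z\<bar> \<le> b * \<bar>z\<bar>"
      using mult_right_mono[OF ou_sd_le[OF t] abs_ge_zero[of z]] ou_sd_nonneg[OF t]
      unfolding b_def abs_mult by simp
    then show ?thesis
      using abs_ou_mean_le[OF t, of x] abs_triangle_ineq[of "ou_mean t x" "ou_sd t * z"]
      unfolding a_def by linarith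
  qed
  then have "(ou_mean t x + ou_sd t * z)\<^sup>2 \<le> (a + b * \<bar>z\<bar>)\<^sup>2"
    by (metis abs_ge_zero power2_abs power_mono)
  also have "\<dots> \<le> 2 * a\<^sup>2 + 2 * b\<^sup>2 * z\<^sup>2"
    using zero_le_power2[of "a - b * \<bar>z\<bar>"] unfolding power2_sum power2_diff power_mult_distrib power2_abs by linarith
  also have "1 + \<dots> \<le> (1 + 2 * a\<^sup>2 + 2 * b\<^sup>2) * (1 + z\<^sup>2)"
    by (simp add: algebra_simps)
  finally show "1 + (ou_mean t x + ou_sd t * z)\<^sup>2 \<le> (1 + 2 * a\<^sup>2 + 2 * b\<^sup>2) * (1 + z\<^sup>2)"
    by linarith
qed

text \<open>The transition semigroup with values in \<open>ennreal\<close>: the coercion keeps the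
  positive part of \<open>h\<close> only, and Tonelli's theorem then applies without integrability
  conditions.\<close>

definition ou_semigroup :: "real \<Rightarrow> (real \<Rightarrow> real) \<Rightarrow> real \<Rightarrow> ennreal" where
  "ou_semigroup t h x = (\<integral>\<^sup>+z. ennreal (h (ou_mean t x + ou_sd t * z)) \<partial>std_normal_distribution)"

definition ou_resolvent :: "(real \<Rightarrow> real) \<Rightarrow> real \<Rightarrow> ennreal" where
  "ou_resolvent h x = (\<integral>\<^sup>+t\<in>{0..}. ennreal (exp (- lam * t)) * ou_semigroup t h x \<partial>lborel)"

text \<open>Along \<open>t \<mapsto> m\<^sub>t + v\<^sub>t z\<close> the discounted value of \<open>u\<close> is differentiated for fixed \<open>z\<close>; the
  singular factor \<open>v'\<^sub>t z\<close> is then removed by Gaussian integration by parts, using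
  \<open>v\<^sub>t v'\<^sub>t = \<sigma>\<^sup>2/2 - \<theta> v\<^sub>t\<^sup>2\<close>.\<close>

lemma ou_resolvent_eq:
  fixes u u1 u2 h :: "real \<Rightarrow> real"
  assumes S: "finite S"
    and u: "\<And>y. (u has_real_derivative u1 y) (at y)" and u1: "continuous_on UNIV u1"
    and u2: "\<And>y. y \<notin> S \<Longrightarrow> (u1 has_real_derivative u2 y) (at y)"
    and [measurable]: "u2 \<in> borel_measurable borel"
    and bu: "\<And>y. \<bar>u y\<bar> \<le> C * (1 + y\<^sup>2)" and bu1: "\<And>y. \<bar>u1 y\<bar> \<le> C * (1 + y\<^sup>2)"
    and bu2: "\<And>y. \<bar>u2 y\<bar> \<le> C * (1 + y\<^sup>2)"
    and h: "\<And>y. h y = lam * u y - \<sigma>\<^sup>2 / 2 * u2 y - \<theta> * (\<mu> - y) * u1 y"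
    and h0: "\<And>y. h y \<ge> 0"
  shows "ou_resolvent h x = ennreal (u x)"
proof -
  have C: "C \<ge> 0" using bu[of 0] by simp
  have cu: "continuous_on UNIV u"
    using DERIV_continuous_on[OF has_field_derivative_at_within[OF u]] .
  have [measurable]: "u \<in> borel_measurable borel" "u1 \<in> borel_measurable borel"
    using cu u1 by (auto intro: borel_measurable_continuous_onI)
  have [measurable]: "h \<in> borel_measurable borel" unfolding h[abs_def] by measurable
  obtain K where K: "K > 0" "\<And>t z. t \<ge> 0 \<Longrightarrow> 1 + (ou_mean t x + ou_sd t * z)\<^sup>2 \<le> K * (1 + z\<^sup>2)"
    using ou_square_bound[of x] by blast
  define Y where "Y t z = ou_mean t x + ou_sd t * z" for t z
  have [measurable]: "(\<lambda>(t, z). Y t z) \<in> borel_measurable (borel \<Otimes>\<^sub>M borel)"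
    unfolding Y_def by measurable
  have [measurable]: "(\<lambda>p. Y (fst p) (snd p)) \<in> borel_measurable (lborel \<Otimes>\<^sub>M std_normal_distribution)"
    unfolding Y_def by measurable
  have [measurable]: "Y t \<in> borel_measurable borel" for t
    unfolding Y_def by measurable
  have CK: "C * (1 + (Y t z)\<^sup>2) \<le> C * K * (1 + z\<^sup>2)" if "t \<ge> 0" for t z
    using mult_left_mono[OF K(2)[OF that, of z] C] by (simp add: Y_def mult.assoc)
  have bf: "\<bar>u (Y t z)\<bar> \<le> C * K * (1 + z\<^sup>2)" "\<bar>u1 (Y t z)\<bar> \<le> C * K * (1 + z\<^sup>2)"
     "\<bar>u2 (Y t z)\<bar> \<le> C * K * (1 + z\<^sup>2)" if "t \<ge> 0" for t z
    using CK[OF that, of z] bu[of "Y t z"] bu1[of "Y t z"] bu2[of "Y t z"] by linarith+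
  have CKn: "C * K \<ge> 0" using C K by simp
  have cub: "D * (1 + z\<^sup>2) \<le> 4 * D * (1 + \<bar>z\<bar>^3)" "D * (1 + z\<^sup>2) * \<bar>z\<bar> \<le> 4 * D * (1 + \<bar>z\<bar>^3)"
       "D * ((1 + z\<^sup>2) * (1 + \<bar>z\<bar>)) \<le> 4 * D * (1 + \<bar>z\<bar>^3)" if "D \<ge> 0" for D z :: real
  proof -
    have "D * ((1 + z\<^sup>2) * (1 + \<bar>z\<bar>)) \<le> D * (4 * (1 + \<bar>z\<bar>^3))"
      using that cubic_bound by (intro mult_left_mono) auto
    moreover have "D * ((1 + z\<^sup>2) * (1 + \<bar>z\<bar>)) = D * (1 + z\<^sup>2) + D * (1 + z\<^sup>2) * \<bar>z\<bar>" by (simp add: algebra_simps)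
    moreover have "D * (1 + z\<^sup>2) \<ge> 0" "D * (1 + z\<^sup>2) * \<bar>z\<bar> \<ge> 0" using that by auto
    ultimately show "D * (1 + z\<^sup>2) \<le> 4 * D * (1 + \<bar>z\<bar>^3)" "D * (1 + z\<^sup>2) * \<bar>z\<bar> \<le> 4 * D * (1 + \<bar>z\<bar>^3)"
       "D * ((1 + z\<^sup>2) * (1 + \<bar>z\<bar>)) \<le> 4 * D * (1 + \<bar>z\<bar>^3)"
      unfolding mult.commute[of 4 D] mult.assoc by linarith+
  qed
  have ints: "integrable std_normal_distribution (\<lambda>z. u (Y t z))" "integrable std_normal_distribution (\<lambda>z. u1 (Y t z))"
    "integrable std_normal_distribution (\<lambda>z. u2 (Y t z))" "integrable std_normal_distribution (\<lambda>z. z * u1 (Y t z))"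
    if t: "t \<ge> 0" for t
  proof -
    show "integrable std_normal_distribution (\<lambda>z. u (Y t z))"
      by (rule std_normal_integrable_cubic) (measurable, rule order_trans[OF bf(1)[OF t] cub(1)[OF CKn]])
    show "integrable std_normal_distribution (\<lambda>z. u1 (Y t z))"
      by (rule std_normal_integrable_cubic) (measurable, rule order_trans[OF bf(2)[OF t] cub(1)[OF CKn]])
    show "integrable std_normal_distribution (\<lambda>z. u2 (Y t z))"
      by (rule std_normal_integrable_cubic) (measurable, rule order_trans[OF bf(3)[OF t] cub(1)[OF CKn]])
    show "integrable std_normal_distribution (\<lambda>z. z * u1 (Y t z))"
    proof (rule std_normal_integrable_cubic)
      fix z
      have "\<bar>z * u1 (Y t z)\<bar> \<le> C * K * (1 + z\<^sup>2) * \<bar>z\<bar>"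
        using mult_right_mono[OF bf(2)[OF t, of z] abs_ge_zero[of z]] by (simp add: abs_mult mult.commute)
      then show "\<bar>z * u1 (Y t z)\<bar> \<le> 4 * (C * K) * (1 + \<bar>z\<bar>^3)" using cub(2)[OF CKn, of z] by linarith
    qed measurable
  qed
  \<comment> \<open>\<open>D\<close> is the discounted expectation of \<open>u\<close> at time
    \<open>t\<close>, \<open>Q\<close> the undiscounted one of \<open>h\<close>. The aim is the
    integrated form of \<open>D' = - exp (- lam * t) * Q\<close> on positive times.\<close>
  define D where "D t = exp (- lam * t) * (LINT z|std_normal_distribution. u (Y t z))" for t
  define Q where "Q t = (LINT z|std_normal_distribution. h (Y t z))" for t
  have ih: "integrable std_normal_distribution (\<lambda>z. h (Y t z))"
    and Qeq: "Q t = lam * (LINT z|std_normal_distribution. u (Y t z)) - \<sigma>\<^sup>2 / 2 * (LINT z|std_normal_distribution. u2 (Y t z))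
       - \<theta> * (\<mu> - ou_mean t x) * (LINT z|std_normal_distribution. u1 (Y t z))
       + \<theta> * ou_sd t * (LINT z|std_normal_distribution. z * u1 (Y t z))" if t: "t \<ge> 0" for t
  proof -
    have *: "h (Y t z) = lam * u (Y t z) - \<sigma>\<^sup>2 / 2 * u2 (Y t z) - \<theta> * (\<mu> - ou_mean t x) * u1 (Y t z)
         + \<theta> * ou_sd t * (z * u1 (Y t z))" for z
      unfolding h by (simp add: Y_def algebra_simps)
    show "integrable std_normal_distribution (\<lambda>z. h (Y t z))"
      unfolding * using ints[OF t]
      by (intro Bochner_Integration.integrable_add Bochner_Integration.integrable_diff integrable_mult_right)
    show "Q t = lam * (LINT z|std_normal_distribution. u (Y t z)) - \<sigma>\<^sup>2 / 2 * (LINT z|std_normal_distribution. u2 (Y t z))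
       - \<theta> * (\<mu> - ou_mean t x) * (LINT z|std_normal_distribution. u1 (Y t z))
       + \<theta> * ou_sd t * (LINT z|std_normal_distribution. z * u1 (Y t z))"
      unfolding Q_def * using ints[OF t] by (simp add: Bochner_Integration.integrable_add Bochner_Integration.integrable_diff)
  qed
  have Q0: "Q t \<ge> 0" for t unfolding Q_def using h0 by (intro Bochner_Integration.integral_nonneg)
  have sg: "ou_semigroup t h x = ennreal (Q t)" if "t \<ge> 0" for t
    unfolding ou_semigroup_def Q_def using ih[OF that] h0
    by (subst nn_integral_eq_integral) (auto simp: Y_def)
  define ds where "ds t = \<sigma>\<^sup>2 * exp (- 2 * \<theta> * t) / (2 * ou_sd t)" for t
  define dm where "dm t = - \<theta> * (x - \<mu>) * exp (- \<theta> * t)" for t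
  \<comment> \<open>For \<open>t > 0\<close> this is minus the time derivative of
    \<open>exp (- lam * t) * u (Y t z)\<close>.\<close>
  define k where "k t z = exp (- lam * t) * (lam * u (Y t z) - u1 (Y t z) * (dm t + ds t * z))" for t z
  have dY: "((\<lambda>t. Y t z) has_real_derivative (dm t + ds t * z)) (at t)" if "t > 0" for t z
  proof -
    have "(ou_sd has_real_derivative ds t) (at t)"
    proof -
      have p: "(1 - exp (- 2 * \<theta> * t)) / (2 * \<theta>) > 0" using pos that by simp
      have "((\<lambda>t. \<sigma> * sqrt ((1 - exp (- 2 * \<theta> * t)) / (2 * \<theta>))) has_real_derivative
          \<sigma> * (inverse (sqrt ((1 - exp (- 2 * \<theta> * t)) / (2 * \<theta>))) / 2 * exp (- 2 * \<theta> * t))) (at t)"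
        using pos p by (auto intro!: derivative_eq_intros simp: field_simps)
      moreover have "\<sigma> * (inverse (sqrt ((1 - exp (- 2 * \<theta> * t)) / (2 * \<theta>))) / 2 * exp (- 2 * \<theta> * t)) = ds t"
        unfolding ds_def ou_sd_def using pos by (simp add: power2_eq_square field_simps)
      ultimately show ?thesis unfolding ou_sd_def[abs_def] by simp
    qed
    moreover have "((\<lambda>t. ou_mean t x) has_real_derivative dm t) (at t)"
      unfolding ou_mean_def dm_def by (auto intro!: derivative_eq_intros)
    ultimately show ?thesis unfolding Y_def by (auto intro!: derivative_eq_intros)
  qed
  have inner: "(LINT z|std_normal_distribution. k t z) = exp (- lam * t) * Q t" if t: "t > 0" for t
  proof -
    have v: "ou_sd t > 0" using ou_sd_pos[OF t] .
    have "(LINT z|std_normal_distribution. z * u1 (Y t z)) = (LINT z|std_normal_distribution. u2 (Y t z) * ou_sd t)"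
    proof (rule gaussian_integration_by_parts)
      show "finite ((\<lambda>y. (y - ou_mean t x) / ou_sd t) ` S)" using S by simp
      show "continuous_on UNIV (\<lambda>z. u1 (Y t z))"
        unfolding Y_def by (intro continuous_on_compose2[OF u1] continuous_intros) auto
      fix z
      assume "z \<notin> (\<lambda>y. (y - ou_mean t x) / ou_sd t) ` S"
      then have "Y t z \<notin> S" using v unfolding Y_def by (force simp: image_iff field_simps)
      then show "((\<lambda>z. u1 (Y t z)) has_real_derivative u2 (Y t z) * ou_sd t) (at z)"
        by (intro DERIV_chain2[OF u2]) (auto intro!: derivative_eq_intros simp: Y_def)
    next
      fix z
      show "\<bar>u1 (Y t z)\<bar> \<le> C * K * (1 + ou_sd t) * (1 + z\<^sup>2)"
        "\<bar>u2 (Y t z) * ou_sd t\<bar> \<le> C * K * (1 + ou_sd t) * (1 + z\<^sup>2)"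
      proof -
        have "C * K * (1 + z\<^sup>2) \<ge> 0" using CKn by simp
        then have "C * K * (1 + z\<^sup>2) \<le> C * K * (1 + z\<^sup>2) * (1 + ou_sd t)"
           "C * K * (1 + z\<^sup>2) * ou_sd t \<le> C * K * (1 + z\<^sup>2) * (1 + ou_sd t)" using v mult_left_mono[of 1 "1 + ou_sd t" "C * K * (1 + z\<^sup>2)"] mult_left_mono[of "ou_sd t" "1 + ou_sd t" "C * K * (1 + z\<^sup>2)"]
          by simp_all
        then show "\<bar>u1 (Y t z)\<bar> \<le> C * K * (1 + ou_sd t) * (1 + z\<^sup>2)"
          "\<bar>u2 (Y t z) * ou_sd t\<bar> \<le> C * K * (1 + ou_sd t) * (1 + z\<^sup>2)"
          using bf(2)[OF less_imp_le[OF t], of z] mult_right_mono[OF bf(3)[OF less_imp_le[OF t], of z] less_imp_le[OF v]] v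
          by (auto simp only: abs_mult mult.commute[of "1 + ou_sd t"] mult.assoc abs_of_pos)
      qed
    qed measurable
    then have I: "(LINT z|std_normal_distribution. z * u1 (Y t z)) = ou_sd t * (LINT z|std_normal_distribution. u2 (Y t z))"
      by simp
    have *: "k t z = exp (- lam * t) * (lam * u (Y t z) - dm t * u1 (Y t z) - ds t * (z * u1 (Y t z)))" for z
      unfolding k_def by (simp add: algebra_simps)
    have "(LINT z|std_normal_distribution. k t z) = exp (- lam * t) *
       (lam * (LINT z|std_normal_distribution. u (Y t z)) - dm t * (LINT z|std_normal_distribution. u1 (Y t z))
        - ds t * (LINT z|std_normal_distribution. z * u1 (Y t z)))"
      unfolding * using ints[of t] t by (simp add: Bochner_Integration.integrable_diff)
    also have "\<dots> = exp (- lam * t) * Q t"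
    proof -
      have "ds t * ou_sd t = \<sigma>\<^sup>2 / 2 - \<theta> * (ou_sd t)\<^sup>2"
        using v t pos by (simp add: ds_def ou_sd_power2 field_simps)
      then have e: "ds t * (ou_sd t * w) = \<sigma>\<^sup>2 / 2 * w - \<theta> * ou_sd t * (ou_sd t * w)" for w
        unfolding mult.assoc[symmetric] by (simp only: power2_eq_square mult.assoc left_diff_distrib)
      have "dm t = \<theta> * (\<mu> - ou_mean t x)" by (simp add: dm_def ou_mean_def algebra_simps)
      then show ?thesis unfolding Qeq[OF less_imp_le[OF t]] I using e by simp
    qed
    finally show ?thesis .
  qed
  have [measurable]: "(\<lambda>p. k (fst p) (snd p)) \<in> borel_measurable (lborel \<Otimes>\<^sub>M std_normal_distribution)"
    unfolding k_def dm_def ds_def by measurable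
  \<comment> \<open>The interval starts at \<open>a > 0\<close> because \<open>ds t\<close> blows up
    like 1 / sqrt t at 0; the bound \<open>R\<close> that justifies Fubini depends on
    \<open>ou_sd a\<close>.\<close>
  have diff: "(LBINT t:{a..b}. exp (- lam * t) * Q t) = D a - D b"
    and isdiff: "set_integrable lborel {a..b} (\<lambda>t. exp (- lam * t) * Q t)" if ab: "0 < a" "a \<le> b" for a b
  proof -
    define R where "R = C * K * (lam + \<theta> * \<bar>x - \<mu>\<bar> + \<sigma>\<^sup>2 / (2 * ou_sd a))"
    have R: "R \<ge> 0" unfolding R_def using CKn pos ou_sd_pos[OF ab(1)] by simp
    have kb: "\<bar>k t z\<bar> \<le> 4 * R * (1 + \<bar>z\<bar>^3)" if t: "t \<in> {a..b}" for t z
    proof -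
      have t0: "t \<ge> 0" using t ab by simp
      have 1: "\<bar>dm t\<bar> \<le> \<theta> * \<bar>x - \<mu>\<bar>"
      proof -
        have "exp (- \<theta> * t) \<le> 1" using pos t0 by simp
        then show ?thesis unfolding dm_def using pos by (simp add: abs_mult mult_left_le)
      qed
      have 2: "\<bar>ds t\<bar> \<le> \<sigma>\<^sup>2 / (2 * ou_sd a)"
      proof -
        have "\<sigma>\<^sup>2 * exp (- 2 * \<theta> * t) \<le> \<sigma>\<^sup>2 * 1" using pos t0 by (intro mult_left_mono) auto
        moreover have "ou_sd a \<le> ou_sd t" using ou_sd_mono t ab by simp
        ultimately have "ds t \<le> \<sigma>\<^sup>2 / (2 * ou_sd a)" unfolding ds_def
          using ou_sd_pos[OF ab(1)] by (intro frac_le) auto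
        moreover have "ds t \<ge> 0" unfolding ds_def using ou_sd_nonneg[OF t0] by simp
        ultimately show ?thesis by simp
      qed
      have 3: "\<bar>dm t + ds t * z\<bar> \<le> (\<theta> * \<bar>x - \<mu>\<bar> + \<sigma>\<^sup>2 / (2 * ou_sd a)) * (1 + \<bar>z\<bar>)"
      proof -
        have "\<bar>dm t + ds t * z\<bar> \<le> \<bar>dm t\<bar> + \<bar>ds t\<bar> * \<bar>z\<bar>" by (metis abs_mult abs_triangle_ineq)
        also have "\<dots> \<le> \<theta> * \<bar>x - \<mu>\<bar> * (1 + \<bar>z\<bar>) + \<sigma>\<^sup>2 / (2 * ou_sd a) * (1 + \<bar>z\<bar>)"
        proof (rule add_mono)
          have "\<bar>dm t\<bar> * 1 \<le> \<theta> * \<bar>x - \<mu>\<bar> * (1 + \<bar>z\<bar>)" using 1 pos by (intro mult_mono) auto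
          then show "\<bar>dm t\<bar> \<le> \<theta> * \<bar>x - \<mu>\<bar> * (1 + \<bar>z\<bar>)" by simp
          show "\<bar>ds t\<bar> * \<bar>z\<bar> \<le> \<sigma>\<^sup>2 / (2 * ou_sd a) * (1 + \<bar>z\<bar>)" using 2 by (intro mult_mono) (auto intro: order_trans[OF abs_ge_zero])
        qed
        finally show ?thesis by (simp add: algebra_simps)
      qed
      have "\<bar>k t z\<bar> \<le> 1 * \<bar>lam * u (Y t z) - u1 (Y t z) * (dm t + ds t * z)\<bar>"
        unfolding k_def abs_mult using pos t0 by (intro mult_right_mono) auto
      also have "\<dots> \<le> lam * \<bar>u (Y t z)\<bar> + \<bar>u1 (Y t z)\<bar> * \<bar>dm t + ds t * z\<bar>"
        using pos abs_triangle_ineq4[of "lam * u (Y t z)" "u1 (Y t z) * (dm t + ds t * z)"] by (simp add: abs_mult)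
      also have "\<dots> \<le> lam * (C * K * (1 + z\<^sup>2)) * (1 + \<bar>z\<bar>) +
           (C * K * (1 + z\<^sup>2)) * ((\<theta> * \<bar>x - \<mu>\<bar> + \<sigma>\<^sup>2 / (2 * ou_sd a)) * (1 + \<bar>z\<bar>))"
      proof (rule add_mono)
        have "lam * \<bar>u (Y t z)\<bar> \<le> lam * (C * K * (1 + z\<^sup>2))" using bf(1)[OF t0, of z] pos by (intro mult_left_mono) auto
        also have "\<dots> \<le> lam * (C * K * (1 + z\<^sup>2)) * (1 + \<bar>z\<bar>)"
        proof -
          have "0 \<le> lam * (C * K * (1 + z\<^sup>2))" using CKn pos by simp
          from mult_left_mono[OF _ this, of 1 "1 + \<bar>z\<bar>"] show ?thesis by simp
        qed
        finally show "lam * \<bar>u (Y t z)\<bar> \<le> lam * (C * K * (1 + z\<^sup>2)) * (1 + \<bar>z\<bar>)" .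
        show "\<bar>u1 (Y t z)\<bar> * \<bar>dm t + ds t * z\<bar> \<le> (C * K * (1 + z\<^sup>2)) * ((\<theta> * \<bar>x - \<mu>\<bar> + \<sigma>\<^sup>2 / (2 * ou_sd a)) * (1 + \<bar>z\<bar>))"
          using bf(2)[OF t0] 3 CKn by (intro mult_mono) auto
      qed
      also have "\<dots> = R * ((1 + z\<^sup>2) * (1 + \<bar>z\<bar>))"
        unfolding R_def by (simp only: algebra_simps)
      also have "\<dots> \<le> 4 * R * (1 + \<bar>z\<bar>^3)" by (rule cub(3)[OF R])
      finally show ?thesis .
    qed
    interpret pair_sigma_finite lborel std_normal_distribution
      by (intro pair_sigma_finite.intro sigma_finite_lborel std_normal.sigma_finite_measure)
    define f where "f = (\<lambda>t z. indicator {a..b} t * k t z)"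
    have [measurable]: "(\<lambda>p. f (fst p) (snd p)) \<in> borel_measurable (lborel \<Otimes>\<^sub>M std_normal_distribution)"
      unfolding f_def by measurable
    have i3: "integrable std_normal_distribution (\<lambda>z. 4 * R * (1 + \<bar>z\<bar>^3))"
      by (rule std_normal_integrable_cubic[where C="4 * R"]) (use R in \<open>auto simp: abs_mult\<close>)
    have int: "integrable (lborel \<Otimes>\<^sub>M std_normal_distribution) (case_prod f)"
    proof (rule Bochner_Integration.integrable_bound)
      show "integrable (lborel \<Otimes>\<^sub>M std_normal_distribution) (\<lambda>p. indicat_real {a..b} (fst p) * (4 * R * (1 + \<bar>snd p\<bar>^3)))"
      proof (rule Fubini_integrable)
        have "(\<lambda>t. LINT z|std_normal_distribution. norm (indicat_real {a..b} (fst (t, z)) * (4 * R * (1 + \<bar>snd (t, z)\<bar>^3))))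
           = (\<lambda>t. indicat_real {a..b} t * (LINT z|std_normal_distribution. 4 * R * (1 + \<bar>z\<bar>^3)))"
          using R by (simp add: abs_mult)
        then show "integrable lborel (\<lambda>t. LINT z|std_normal_distribution. norm (indicat_real {a..b} (fst (t, z)) * (4 * R * (1 + \<bar>snd (t, z)\<bar>^3))))"
          by (simp only:) (intro integrable_mult_left integrable_real_indicator, auto simp: emeasure_lborel_Icc_eq)
        show "AE t in lborel. integrable std_normal_distribution (\<lambda>z. indicat_real {a..b} (fst (t, z)) * (4 * R * (1 + \<bar>snd (t, z)\<bar>^3)))"
          by (intro AE_I2) (simp only: fst_conv snd_conv, rule integrable_mult_right, rule i3)
      qed measurable
      show "case_prod f \<in> borel_measurable (lborel \<Otimes>\<^sub>M std_normal_distribution)"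
        unfolding case_prod_beta by measurable
      have b: "\<bar>f t z\<bar> \<le> indicat_real {a..b} t * (4 * R * (1 + \<bar>z\<bar>^3))" for t z
        unfolding f_def using kb[of t z] by (auto simp: indicator_def)
      show "AE p in lborel \<Otimes>\<^sub>M std_normal_distribution. norm (case_prod f p) \<le> norm (indicat_real {a..b} (fst p) * (4 * R * (1 + \<bar>snd p\<bar>^3)))"
        using b by (intro AE_I2) (auto simp: case_prod_beta intro: order_trans[OF _ abs_ge_self])
    qed
    have fz: "(LINT t|lborel. f t z) = exp (- lam * a) * u (Y a z) - exp (- lam * b) * u (Y b z)" for z
    proof -
      have ck: "continuous_on {a..b} (\<lambda>t. k t z)"
        unfolding k_def dm_def ds_def Y_def using ab ou_sd_pos
        by (intro continuous_intros continuous_on_compose2[OF cu] continuous_on_compose2[OF u1]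
             continuous_ou_mean continuous_ou_sd) (auto simp: less_le_trans less_imp_neq[symmetric] dest!: ou_sd_pos[OF less_le_trans])
      have "((\<lambda>t. k t z) has_integral (- (exp (- lam * b) * u (Y b z)) - - (exp (- lam * a) * u (Y a z)))) {a..b}"
      proof (rule fundamental_theorem_of_calculus)
        fix t assume "t \<in> {a..b}"
        then have "t > 0" using ab by simp
        have "((\<lambda>t. - (exp (- lam * t) * u (Y t z))) has_real_derivative k t z) (at t)"
          unfolding k_def
          by (auto intro!: derivative_eq_intros DERIV_chain2[OF u dY[OF \<open>t > 0\<close>]] simp: algebra_simps)
        then show "((\<lambda>t. - (exp (- lam * t) * u (Y t z))) has_vector_derivative k t z) (at t within {a..b})"
          by (simp add: has_real_derivative_iff_has_vector_derivative has_vector_derivative_at_within)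
      qed (use ab in simp)
      moreover have "set_integrable lborel {a..b} (\<lambda>t. k t z)"
        by (rule borel_integrable_atLeastAtMost'[OF ck])
      ultimately have "(LBINT t:{a..b}. k t z) = exp (- lam * a) * u (Y a z) - exp (- lam * b) * u (Y b z)"
        by (simp add: set_borel_integral_eq_integral(2) integral_unique)
      then show ?thesis unfolding f_def set_lebesgue_integral_def by simp
    qed
    have ft: "(LINT z|std_normal_distribution. f t z) = indicator {a..b} t * (exp (- lam * t) * Q t)" for t
      unfolding f_def using inner[of t] ab by (auto simp: indicator_def)
    have "(LINT z|std_normal_distribution. LINT t|lborel. f t z) = (LINT t|lborel. LINT z|std_normal_distribution. f t z)"
      by (rule Fubini_integral[OF int])
    moreover have "(LINT z|std_normal_distribution. LINT t|lborel. f t z) = D a - D b"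
      unfolding fz D_def using ints(1)[of a] ints(1)[of b] ab by simp
    ultimately show "(LBINT t:{a..b}. exp (- lam * t) * Q t) = D a - D b"
      unfolding ft set_lebesgue_integral_def by simp
    have "integrable lborel (\<lambda>t. LINT z|std_normal_distribution. f t z)"
      by (rule integrable_fst[OF int])
    then show "set_integrable lborel {a..b} (\<lambda>t. exp (- lam * t) * Q t)"
      unfolding ft set_integrable_def by simp
  qed
  have [measurable]: "Q \<in> borel_measurable borel"
    unfolding Q_def Y_def by measurable
  \<comment> \<open>Truncation to [1/(n+1), n+1] avoids the singularity at 0; monotone convergence
    in \<open>n\<close> recovers the half-line up to the null set \<open>{0}\<close>.\<close>
  define g where "g n t = ennreal (exp (- lam * t) * Q t) * indicator {1 / Suc n..real (Suc n)} t" for n t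
  have gI: "(\<integral>\<^sup>+t. g n t \<partial>lborel) = ennreal (D (1 / Suc n) - D (Suc n))" for n
  proof -
    have n: "0 < 1 / real (Suc n)" "1 / real (Suc n) \<le> real (Suc n)" by (auto simp: field_simps)
    show ?thesis unfolding g_def diff[OF n, symmetric]
      using isdiff[OF n] Q0 unfolding set_lebesgue_integral_def set_integrable_def
      by (subst nn_integral_eq_integral[symmetric]) (auto simp: indicator_def intro!: nn_integral_cong split: if_splits)
  qed
  have "ou_resolvent h x = (\<integral>\<^sup>+t. (SUP n. g n t) \<partial>lborel)"
    unfolding ou_resolvent_def
  proof (rule nn_integral_cong_AE)
    have gs: "(SUP n. g n t) = ennreal (exp (- lam * t)) * ou_semigroup t h x * indicator {0..} t" if "t \<noteq> 0" for t
    proof (cases "t > 0")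
      case True
      obtain n where n: "1 / real (Suc n) < t" "t < real (Suc n)"
      proof -
        obtain n1 where 1: "inverse (real (Suc n1)) < t" using reals_Archimedean[OF True] by auto
        obtain n2 where 2: "t < real n2" using reals_Archimedean2 by blast
        have "1 / real (Suc (max n1 n2)) \<le> inverse (real (Suc n1))" by (simp add: field_simps)
        with 1 2 that[of "max n1 n2"] show ?thesis by simp
      qed
      have "(SUP n. g n t) = ennreal (exp (- lam * t) * Q t)"
      proof (rule antisym)
        show "(SUP n. g n t) \<le> ennreal (exp (- lam * t) * Q t)"
          by (rule SUP_least) (auto simp: g_def indicator_def)
        have "ennreal (exp (- lam * t) * Q t) = g n t" using n by (simp add: g_def)
        also have "\<dots> \<le> (SUP n. g n t)" by (rule SUP_upper) simp
        finally show "ennreal (exp (- lam * t) * Q t) \<le> (SUP n. g n t)" .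
      qed
      then show ?thesis using True by (simp add: sg ennreal_mult Q0)
    next
      case False
      then have "g n t = 0" for n using order_less_le_trans[of 0 "1 / real (Suc n)" t] unfolding g_def by (auto simp: indicator_def)
      then show ?thesis using False that by simp
    qed
    have "AE t in lborel. t \<noteq> (0::real)" by (rule AE_lborel_singleton)
    then show "AE t in lborel. ennreal (exp (- lam * t)) * ou_semigroup t h x * indicator {0..} t = (SUP n. g n t)"
      by eventually_elim (simp add: gs)
  qed
  also have "\<dots> = (SUP n. \<integral>\<^sup>+t. g n t \<partial>lborel)"
  proof (rule nn_integral_monotone_convergence_SUP)
    show "incseq g"
    proof (rule incseq_SucI, rule le_funI)
      fix n t
      have "{1 / Suc n..real (Suc n)} \<subseteq> {1 / Suc (Suc n)..real (Suc (Suc n))}" by (auto simp: field_simps)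
      then show "g n t \<le> g (Suc n) t" unfolding g_def by (intro mult_left_mono) (auto simp: indicator_def)
    qed
  qed (unfold g_def, measurable)
  finally have res: "ou_resolvent h x = (SUP n. ennreal (D (1 / Suc n) - D (Suc n)))" unfolding gI .
  have "incseq (\<lambda>n. ennreal (D (1 / Suc n) - D (Suc n)))"
    unfolding gI[symmetric]
  proof (intro incseq_SucI nn_integral_mono)
    fix n t
    have "{1 / Suc n..real (Suc n)} \<subseteq> {1 / Suc (Suc n)..real (Suc (Suc n))}" by (auto simp: field_simps)
    then show "g n t \<le> g (Suc n) t" unfolding g_def by (intro mult_left_mono) (auto simp: indicator_def)
  qed
  then have "(\<lambda>n. ennreal (D (1 / Suc n) - D (Suc n))) \<longlonglongrightarrow> ou_resolvent h x"
    unfolding res by (rule LIMSEQ_SUP)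
  \<comment> \<open>The lower end contributes \<open>u x\<close>, since the law degenerates to a
    point mass at \<open>x\<close>. The upper end vanishes through the discount factor, the Gaussian
    moments being bounded in time.\<close>
  moreover have "(\<lambda>n. ennreal (D (1 / Suc n) - D (Suc n))) \<longlonglongrightarrow> ennreal (u x - 0)"
  proof (intro tendsto_ennrealI tendsto_diff)
    have "(\<lambda>n. LINT z|std_normal_distribution. u (Y (1 / Suc n) z)) \<longlonglongrightarrow> (LINT z|std_normal_distribution. u x)"
    proof (rule integral_dominated_convergence)
      show "integrable std_normal_distribution (\<lambda>z. C * K * (1 + z\<^sup>2))"
        by (rule std_normal_integrable_cubic[where C="4 * (C * K)"]) (use CKn cub(1)[OF CKn] C K(1) in \<open>auto simp: abs_mult\<close>)
      show "AE z in std_normal_distribution. (\<lambda>n. u (Y (1 / Suc n) z)) \<longlonglongrightarrow> u x"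
      proof (intro AE_I2)
        fix z
        have l: "(\<lambda>n. 1 / real (Suc n)) \<longlonglongrightarrow> 0" using LIMSEQ_inverse_real_of_nat by (simp add: inverse_eq_divide)
        have "continuous_on UNIV (\<lambda>t. u (Y t z))"
          unfolding Y_def by (intro continuous_on_compose2[OF cu] continuous_intros continuous_ou_mean continuous_ou_sd) auto
        then have "isCont (\<lambda>t. u (Y t z)) 0" by (simp add: continuous_on_eq_continuous_at)
        from isCont_tendsto_compose[OF this l] show "(\<lambda>n. u (Y (1 / Suc n) z)) \<longlonglongrightarrow> u x"
          by (simp add: Y_def)
      qed
      show "AE z in std_normal_distribution. norm (u (Y (1 / Suc n) z)) \<le> C * K * (1 + z\<^sup>2)" for n
        using bf(1) by (intro AE_I2) simp
    qed measurable
    moreover have "(\<lambda>n. exp (- lam * (1 / real (Suc n)))) \<longlonglongrightarrow> 1" by real_asymp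
    ultimately have "(\<lambda>n. exp (- lam * (1 / real (Suc n))) * (LINT z|std_normal_distribution. u (Y (1 / Suc n) z))) \<longlonglongrightarrow> 1 * (LINT z|std_normal_distribution. u x)"
      by (intro tendsto_mult)
    then show "(\<lambda>n. D (1 / Suc n)) \<longlonglongrightarrow> u x" unfolding D_def using std_normal.prob_space by simp
  next
    have b: "\<bar>D (real (Suc n))\<bar> \<le> exp (- lam * real (Suc n)) * (LINT z|std_normal_distribution. C * K * (1 + z\<^sup>2))" for n
      unfolding D_def abs_mult abs_exp_cancel
    proof (intro mult_left_mono order_trans[OF integral_abs_bound] integral_mono)
      show "integrable std_normal_distribution (\<lambda>z. C * K * (1 + z\<^sup>2))"
        by (rule std_normal_integrable_cubic[where C="4 * (C * K)"]) (use CKn cub(1)[OF CKn] C K(1) in \<open>auto simp: abs_mult\<close>)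
      show "integrable std_normal_distribution (\<lambda>z. \<bar>u (Y (real (Suc n)) z)\<bar>)" using ints(1) by simp
      show "\<bar>u (Y (real (Suc n)) z)\<bar> \<le> C * K * (1 + z\<^sup>2)" for z using bf(1) by simp
    qed simp
    show "(\<lambda>n. D (real (Suc n))) \<longlonglongrightarrow> 0"
    proof (rule Lim_null_comparison)
      show "\<forall>\<^sub>F n in sequentially. norm (D (real (Suc n))) \<le> exp (- lam * real (Suc n)) * (LINT z|std_normal_distribution. C * K * (1 + z\<^sup>2))"
        using b by (intro always_eventually) simp
      have "(\<lambda>n. exp (- lam * real (Suc n))) \<longlonglongrightarrow> 0" using pos by real_asymp
      from tendsto_mult_left_zero[OF this]
      show "(\<lambda>n. exp (- lam * real (Suc n)) * (LINT z|std_normal_distribution. C * K * (1 + z\<^sup>2))) \<longlonglongrightarrow> 0" .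
    qed
  qed
  ultimately show ?thesis using LIMSEQ_unique by fastforce
qed

end

section \<open>Paths as limits of Riemann sums\<close>

text \<open>Variation of constants, path by path: with Y = y - \<mu>, the function exp(\<theta> t) Y
  has increments \<sigma> exp(\<theta> t) dB, and as the weight is smooth the Riemann-Stieltjes sums
  converge for each continuous path.\<close>

lemma ou_path_riemann:
  fixes y b :: "real \<Rightarrow> real" and \<theta> \<mu> \<sigma> x s t :: real
  assumes y: "continuous_on {0..} y" and th: "\<theta> > 0"
    and eq: "\<And>t. t \<ge> 0 \<Longrightarrow> y t = x + (LBINT s:{0..t}. \<theta> * (\<mu> - y s)) + \<sigma> * b t"
    and st: "0 \<le> s" "s < t"
  defines "r \<equiv> \<lambda>n i. s + real i * ((t - s) / real n)"
  shows "(\<lambda>n. \<sigma> * (\<Sum>i<Suc n. exp (- \<theta> * (t - r (Suc n) i)) * (b (r (Suc n) (Suc i)) - b (r (Suc n) i))))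
           \<longlonglongrightarrow> y t - (\<mu> + (y s - \<mu>) * exp (- \<theta> * (t - s)))"
proof -
  define Y where "Y q = y q - \<mu>" for q
  have cY: "continuous_on {0..} Y" unfolding Y_def by (intro continuous_intros y)
  have iY: "Y integrable_on {p..q}" if "0 \<le> p" for p q
    using that by (intro integrable_continuous_real continuous_on_subset[OF cY]) auto
  \<comment> \<open>The noise increment is expressed by the path and its drift, so that continuity
    of \<open>y\<close> controls all that follows.\<close>
  have incr: "\<sigma> * (b q - b p) = Y q - Y p + \<theta> * integral {p..q} Y" if pq: "0 \<le> p" "p \<le> q" for p q
  proof -
    have *: "(LBINT s:{0..t}. \<theta> * (\<mu> - y s)) = - \<theta> * integral {0..t} Y" if "t \<ge> 0" for t
    proof -
      have "set_integrable lborel {0..t} (\<lambda>s. \<theta> * (\<mu> - y s))"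
        using that by (intro borel_integrable_atLeastAtMost' continuous_intros continuous_on_subset[OF y]) auto
      then have "(LBINT s:{0..t}. \<theta> * (\<mu> - y s)) = integral {0..t} (\<lambda>s. - \<theta> * Y s)"
        by (simp add: set_borel_integral_eq_integral(2) Y_def algebra_simps)
      then show ?thesis by simp
    qed
    have "integral {0..p} Y + integral {p..q} Y = integral {0..q} Y"
      using pq by (intro Henstock_Kurzweil_Integration.integral_combine iY) auto
    then have "\<theta> * integral {0..p} Y + \<theta> * integral {p..q} Y = \<theta> * integral {0..q} Y"
      by (simp only: distrib_left[symmetric])
    then show ?thesis
      using eq[of p] eq[of q] *[of p] *[of q] pq by (simp add: Y_def algebra_simps)
  qed
  \<comment> \<open>On a subinterval with end points \<open>p\<close>, \<open>p'\<close> the error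
    is \<theta> times the integral over \<open>v\<close> of \<open>f (v, p') - f (p, v)\<close>,
    which is small by uniform continuity of \<open>f\<close>.\<close>
  define f where "f = (\<lambda>(p, q). exp (\<theta> * p) * Y q)"
  have cf: "uniformly_continuous_on ({s..t} \<times> {s..t}) f"
    unfolding f_def case_prod_beta
    by (intro compact_uniformly_continuous continuous_intros compact_Times continuous_on_compose2[OF cY])
      (use st in auto)
  define E where "E n = exp (\<theta> * t) * Y t - exp (\<theta> * s) * Y s
     - \<sigma> * (\<Sum>i<Suc n. exp (\<theta> * r (Suc n) i) * (b (r (Suc n) (Suc i)) - b (r (Suc n) i)))" for n
  have "E \<longlonglongrightarrow> 0"
  proof (rule LIMSEQ_I)
    fix e :: real assume e: "e > 0"
    define e' where "e' = e / (2 * \<theta> * (t - s))"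
    have e': "e' > 0" using e th st by (simp add: e'_def)
    obtain d where d: "d > 0" "\<And>u v. u \<in> {s..t} \<times> {s..t} \<Longrightarrow> v \<in> {s..t} \<times> {s..t} \<Longrightarrow> dist v u < d \<Longrightarrow> dist (f v) (f u) < e'"
      using cf e' unfolding uniformly_continuous_on_def by blast
    obtain N where N: "2 * (t - s) / d < real N" using reals_Archimedean2 by blast
    show "\<exists>N. \<forall>n\<ge>N. norm (E n - 0) < e"
    proof (intro exI[of _ N] allI impI)
      fix n assume n: "N \<le> n"
      define D where "D = (t - s) / real (Suc n)"
      have D0: "D > 0" using st by (simp add: D_def)
      have "2 * (t - s) / d < real (Suc n)" using N n by linarith
      then have Dd: "2 * D < d" using d(1) by (simp add: D_def field_simps)
      define q where "q i = s + real i * D" for i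
      have rq: "r (Suc n) i = q i" for i by (simp add: r_def q_def D_def)
      have q0: "q 0 = s" and qn: "q (Suc n) = t" by (auto simp: q_def D_def)
      have qS: "q (Suc i) = q i + D" for i by (simp add: q_def algebra_simps)
      have qm: "s \<le> q i" "i \<le> Suc n \<Longrightarrow> q i \<le> t" for i
      proof -
        show "s \<le> q i" using D0 by (simp add: q_def)
        assume "i \<le> Suc n"
        then have "real i * D \<le> real (Suc n) * D" using D0 by (intro mult_right_mono) auto
        then show "q i \<le> t" using qn by (simp add: q_def)
      qed
      define T where "T i = exp (\<theta> * q (Suc i)) * Y (q (Suc i)) - exp (\<theta> * q i) * Y (q i)
          - \<sigma> * (exp (\<theta> * q i) * (b (q (Suc i)) - b (q i)))" for i
      have "(\<Sum>i<Suc n. exp (\<theta> * q (Suc i)) * Y (q (Suc i)) - exp (\<theta> * q i) * Y (q i)) = exp (\<theta> * t) * Y t - exp (\<theta> * s) * Y s"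
        using sum_lessThan_telescope[of "\<lambda>i. exp (\<theta> * q i) * Y (q i)" "Suc n"] by (simp only: q0 qn)
      then have ET: "E n = (\<Sum>i<Suc n. T i)"
        unfolding E_def T_def rq sum_subtractf sum_distrib_left by simp
      have Tb: "\<bar>T i\<bar> \<le> \<theta> * (e' * D)" if i: "i < Suc n" for i
      proof -
        let ?p = "q i" let ?p' = "q (Suc i)"
        have pp: "0 \<le> ?p" "?p \<le> ?p'" "?p \<in> {s..t}" "?p' \<in> {s..t}" using qm[of i] qm[of "Suc i"] i st D0 by (auto simp: qS)
        have 1: "((\<lambda>v. \<theta> * exp (\<theta> * v)) has_integral (exp (\<theta> * ?p') - exp (\<theta> * ?p))) {?p..?p'}"
          by (rule fundamental_theorem_of_calculus[OF pp(2)])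
            (auto intro!: derivative_eq_intros simp: has_real_derivative_iff_has_vector_derivative[symmetric])
        have 2: "(Y has_integral (integral {?p..?p'} Y)) {?p..?p'}" using iY[OF pp(1)] by (rule integrable_integral)
        have "((\<lambda>v. \<theta> * exp (\<theta> * v) * Y ?p' - \<theta> * exp (\<theta> * ?p) * Y v) has_integral
              ((exp (\<theta> * ?p') - exp (\<theta> * ?p)) * Y ?p' - \<theta> * exp (\<theta> * ?p) * integral {?p..?p'} Y)) {?p..?p'}"
          by (intro has_integral_diff has_integral_mult_left has_integral_mult_right 1 2)
        moreover have "(exp (\<theta> * ?p') - exp (\<theta> * ?p)) * Y ?p' - \<theta> * exp (\<theta> * ?p) * integral {?p..?p'} Y = T i"
        proof -
          have "\<sigma> * (exp (\<theta> * ?p) * (b ?p' - b ?p)) = exp (\<theta> * ?p) * (\<sigma> * (b ?p' - b ?p))" by simp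
          then show ?thesis unfolding T_def incr[OF pp(1,2)] by (simp add: algebra_simps)
        qed
        ultimately have hi: "((\<lambda>v. \<theta> * exp (\<theta> * v) * Y ?p' - \<theta> * exp (\<theta> * ?p) * Y v) has_integral T i) (cbox ?p ?p')"
          by simp
        have "norm (T i) \<le> (\<theta> * e') * measure lborel (cbox ?p ?p')"
        proof (rule has_integral_bound[OF _ hi])
          fix v assume v: "v \<in> cbox ?p ?p'"
          then have vv: "?p \<le> v" "v \<le> ?p'" by auto
          have "dist (v, ?p') (?p, v) < d"
          proof -
            have "dist (v, ?p') (?p, v) \<le> dist v ?p + dist ?p' v"
              unfolding dist_Pair_Pair by (rule sqrt_sum_squares_le_sum) auto
            also have "\<dots> \<le> 2 * D" using vv by (simp add: dist_real_def qS)
            finally show ?thesis using Dd by simp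
          qed
          moreover have "v \<in> {s..t}" using vv pp by auto
          ultimately have "dist (f (v, ?p')) (f (?p, v)) < e'" using pp by (intro d(2)) auto
          then have "\<bar>exp (\<theta> * v) * Y ?p' - exp (\<theta> * ?p) * Y v\<bar> \<le> e'" by (simp add: f_def dist_real_def)
          then have "\<theta> * \<bar>exp (\<theta> * v) * Y ?p' - exp (\<theta> * ?p) * Y v\<bar> \<le> \<theta> * e'" using th by simp
          moreover have "\<theta> * exp (\<theta> * v) * Y ?p' - \<theta> * exp (\<theta> * ?p) * Y v = \<theta> * (exp (\<theta> * v) * Y ?p' - exp (\<theta> * ?p) * Y v)"
            by (simp add: algebra_simps)
          ultimately show "norm (\<theta> * exp (\<theta> * v) * Y ?p' - \<theta> * exp (\<theta> * ?p) * Y v) \<le> \<theta> * e'"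
            using th by (simp add: abs_mult)
        qed (use th e' in simp)
        then show ?thesis using D0 by (simp add: qS algebra_simps)
      qed
      have "\<bar>E n\<bar> \<le> (\<Sum>i<Suc n. \<theta> * (e' * D))"
        unfolding ET by (rule order_trans[OF sum_abs]) (intro sum_mono Tb, simp)
      also have "\<dots> = \<theta> * e' * (t - s)" by (simp add: D_def del: of_nat_Suc)
      also have "\<dots> = e / 2" using th st by (simp add: e'_def del: diff_gt_0_iff_gt diff_less_0_iff_less) (simp add: field_simps)
      finally show "norm (E n - 0) < e" using e by simp
    qed
  qed
  then have "(\<lambda>n. exp (- \<theta> * t) * (exp (\<theta> * t) * Y t - exp (\<theta> * s) * Y s - E n)) \<longlonglongrightarrow>
      exp (- \<theta> * t) * (exp (\<theta> * t) * Y t - exp (\<theta> * s) * Y s - 0)"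
    by (intro tendsto_intros)
  moreover have "exp (- \<theta> * t) * (exp (\<theta> * t) * Y t - exp (\<theta> * s) * Y s - 0) = y t - (\<mu> + (y s - \<mu>) * exp (- \<theta> * (t - s)))"
    unfolding Y_def by (simp add: algebra_simps flip: exp_add)
  moreover have "exp (- \<theta> * t) * (exp (\<theta> * t) * Y t - exp (\<theta> * s) * Y s - E n) =
     \<sigma> * (\<Sum>i<Suc n. exp (- \<theta> * (t - r (Suc n) i)) * (b (r (Suc n) (Suc i)) - b (r (Suc n) i)))" for n
  proof -
    have "exp (- \<theta> * (t - w)) = exp (- \<theta> * t) * exp (\<theta> * w)" for w
      by (simp add: algebra_simps flip: exp_add)
    then show ?thesis unfolding E_def by (simp only: sum_distrib_left mult_ac) (simp add: sum_distrib_left mult_ac distrib_left)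
  qed
  ultimately show ?thesis by (simp only:)
qed

text \<open>A geometric sum. The limit is the integral of exp(- a r) over [0, d]; with a = 2
  \<theta> it is the limiting variance of the weighted Brownian increments.\<close>

lemma riemann_exp_limit:
  fixes a d :: real assumes a: "a > 0" and d: "d > 0"
  shows "(\<lambda>n. \<Sum>i<Suc n. exp (- a * (d - real i * (d / real (Suc n)))) * (d / real (Suc n)))
     \<longlonglongrightarrow> (1 - exp (- a * d)) / a"
proof -
  have eq: "(\<Sum>i<Suc n. exp (- a * (d - real i * (d / real (Suc n)))) * (d / real (Suc n)))
      = exp (- a * d) * (d / real (Suc n)) * ((exp (a * d) - 1) / (exp (a * d / real (Suc n)) - 1))" for n
  proof -
    let ?q = "exp (a * d / real (Suc n))"
    have "exp (- a * (d - real i * (d / real (Suc n)))) = exp (- a * d) * ?q ^ i" for i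
      by (simp add: exp_of_nat_mult[symmetric] exp_add[symmetric] algebra_simps)
    then have "(\<Sum>i<Suc n. exp (- a * (d - real i * (d / real (Suc n)))) * (d / real (Suc n)))
       = (\<Sum>i<Suc n. exp (- a * d) * (d / real (Suc n)) * ?q ^ i)" by (simp add: mult_ac)
    also have "\<dots> = exp (- a * d) * (d / real (Suc n)) * (\<Sum>i<Suc n. ?q ^ i)"
      by (rule sum_distrib_left[symmetric])
    also have "(\<Sum>i<Suc n. ?q ^ i) = (?q ^ Suc n - 1) / (?q - 1)"
      using a d by (intro geometric_sum) simp
    also have "?q ^ Suc n = exp (a * d)" unfolding exp_of_nat_mult[symmetric] by simp
    finally show ?thesis .
  qed
  have "(\<lambda>n. exp (- a * d) * (d / real (Suc n)) * ((exp (a * d) - 1) / (exp (a * d / real (Suc n)) - 1))) \<longlonglongrightarrow>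
     exp (- a * d) * (exp (a * d) - 1) / a"
  proof -
    have "(\<lambda>n. d / real (Suc n) / (exp (a * d / real (Suc n)) - 1)) \<longlonglongrightarrow> inverse a"
      using a d by real_asymp
    then have "(\<lambda>n. exp (- a * d) * (exp (a * d) - 1) * (d / real (Suc n) / (exp (a * d / real (Suc n)) - 1)))
       \<longlonglongrightarrow> exp (- a * d) * (exp (a * d) - 1) * inverse a"
      by (rule tendsto_mult_left)
    then show ?thesis by (simp add: field_simps del: of_nat_Suc)
  qed
  moreover have "exp (- a * d) * (exp (a * d) - 1) / a = (1 - exp (- a * d)) / a"
    by (simp add: algebra_simps flip: exp_add)
  ultimately show ?thesis unfolding eq by (simp only:)
qed

section \<open>Independence of the noise from the past\<close>

text \<open>Writing the centred normal laws as images of the standard one keeps the degenerate case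
  \<open>v = 0\<close>.\<close>

definition scaled_normal :: "real \<Rightarrow> real measure" where
  "scaled_normal v = distr std_normal_distribution borel (\<lambda>z. v * z)"

lemma real_distribution_scaled_normal: "real_distribution (scaled_normal v)"
  unfolding scaled_normal_def by (rule std_normal.real_distribution_distr) simp

lemma char_scaled_normal: "char (scaled_normal v) u = exp (- (v * u)\<^sup>2 / 2)"
proof -
  have "char (scaled_normal v) u = (CLINT z|std_normal_distribution. iexp (u * (v * z)))"
    unfolding scaled_normal_def char_def by (subst integral_distr) auto
  also have "\<dots> = char std_normal_distribution (v * u)"
    unfolding char_def by (simp add: mult_ac)
  finally show ?thesis by (simp add: char_std_normal_distribution)
qed

lemma normal_distr_scaled_normal:
  assumes "prob_space M" and "v > 0" and X: "distributed M lborel X (normal_density 0 v)"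
  shows "distr M borel X = scaled_normal v"
proof -
  interpret prob_space M by fact
  have "distributed M lborel (\<lambda>x. (X x - 0) / v) std_normal_density"
    using X normal_standard_normal_convert[OF \<open>v > 0\<close>, of X 0] by simp
  then have "distr M lborel (\<lambda>x. X x / v) = std_normal_distribution"
    by (simp add: distributed_distr_eq_density)
  then have "scaled_normal v = distr (distr M lborel (\<lambda>x. X x / v)) borel (\<lambda>z. v * z)"
    unfolding scaled_normal_def by simp
  also have "\<dots> = distr M borel (\<lambda>x. v * (X x / v))"
    using distributed_measurable[OF X] by (subst distr_distr) (auto simp: comp_def)
  also have "\<dots> = distr M borel X" using \<open>v > 0\<close> by simp
  finally show ?thesis by simp
qed

text \<open>Almost sure convergence passes to characteristic functions by dominated convergence, and
  these see \<open>v\<close> only through its square. The space \<open>P\<close> is arbitrary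
  because the lemma is also applied under conditioning on an event.\<close>

lemma AE_limit_scaled_normal:
  assumes "prob_space P"
    and [measurable]: "\<And>n. \<xi>n n \<in> borel_measurable P" "\<xi> \<in> borel_measurable P"
    and lim: "AE \<omega> in P. (\<lambda>n. \<xi>n n \<omega>) \<longlonglongrightarrow> (\<xi> \<omega> :: real)"
    and law: "\<And>n. distr P borel (\<xi>n n) = scaled_normal (v n)"
    and v: "(\<lambda>n. (v n)\<^sup>2) \<longlonglongrightarrow> w\<^sup>2"
  shows "distr P borel \<xi> = scaled_normal w"
proof (rule Levy_uniqueness)
  interpret prob_space P by fact
  show "real_distribution (distr P borel \<xi>)" by (rule real_distribution_distr) simp
  show "real_distribution (scaled_normal w)" by (rule real_distribution_scaled_normal)
  show "char (distr P borel \<xi>) = char (scaled_normal w)"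
  proof
    fix u
    have c: "char (distr P borel f) u = (CLINT \<omega>|P. iexp (u * f \<omega>))" if [measurable]: "f \<in> borel_measurable P" for f
      unfolding char_def by (subst integral_distr) auto
    have "(\<lambda>n. CLINT \<omega>|P. iexp (u * \<xi>n n \<omega>)) \<longlonglongrightarrow> (CLINT \<omega>|P. iexp (u * \<xi> \<omega>))"
    proof (rule integral_dominated_convergence)
      show "integrable P (\<lambda>_. 1 :: real)" by simp
      show "AE \<omega> in P. (\<lambda>n. iexp (u * \<xi>n n \<omega>)) \<longlonglongrightarrow> iexp (u * \<xi> \<omega>)"
        using lim by eventually_elim (intro tendsto_intros)
    qed (auto simp: norm_exp_i_times)
    moreover have "(CLINT \<omega>|P. iexp (u * \<xi>n n \<omega>)) = of_real (exp (- ((v n)\<^sup>2 * u\<^sup>2) / 2))" for n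
      by (subst c[symmetric]) (simp_all add: law char_scaled_normal power_mult_distrib)
    moreover have "(\<lambda>n. of_real (exp (- ((v n)\<^sup>2 * u\<^sup>2) / 2)) :: complex) \<longlonglongrightarrow> of_real (exp (- (w\<^sup>2 * u\<^sup>2) / 2))"
      by (intro tendsto_intros v) simp
    ultimately have "(CLINT \<omega>|P. iexp (u * \<xi> \<omega>)) = of_real (exp (- (w\<^sup>2 * u\<^sup>2) / 2))"
      using LIMSEQ_unique by fastforce
    then show "char (distr P borel \<xi>) u = char (scaled_normal w) u"
      by (simp add: c char_scaled_normal power_mult_distrib)
  qed
qed

section \<open>The augmented Brownian filtration and weighted increments\<close>

locale brownian_space = prob_space M for M :: "'a measure" +
  fixes B :: "real \<Rightarrow> 'a \<Rightarrow> real"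
  assumes complete: "complete_measure M" and bm: "standard_brownian_motion M B"
begin

abbreviation F :: "ennreal \<Rightarrow> 'a measure" where "F \<equiv> aug_filtration M B"

lemma B_measurable: "t \<ge> 0 \<Longrightarrow> B t \<in> borel_measurable M"
  using bm unfolding standard_brownian_motion_def by blast

lemma generator_subset:
  "{B s -` A \<inter> space M | s A. 0 \<le> s \<and> ennreal s \<le> t \<and> A \<in> sets borel} \<union> null_sets M \<subseteq> sets M"
  using B_measurable by (auto intro: measurable_sets)

lemma space_F [simp]: "space (F t) = space M"
  unfolding aug_filtration_def using generator_subset[of t] sets.sets_into_space by (intro space_measure_of) blast

lemma sets_F: "sets (F t) = sigma_sets (space M)
    ({B s -` A \<inter> space M | s A. 0 \<le> s \<and> ennreal s \<le> t \<and> A \<in> sets borel} \<union> null_sets M)"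
  unfolding aug_filtration_def using generator_subset[of t] sets.sets_into_space by (intro sets_measure_of) blast

lemma F_subset: "sets (F t) \<subseteq> sets M"
  unfolding sets_F using generator_subset[of t] by (rule sets.sigma_sets_subset)

lemma F_mono: "s \<le> t \<Longrightarrow> sets (F s) \<subseteq> sets (F t)"
  unfolding sets_F by (intro sigma_sets_mono') (auto intro: order_trans)

lemma null_in_F: "N \<in> null_sets M \<Longrightarrow> N \<in> sets (F t)"
  unfolding sets_F by (intro sigma_sets.Basic) simp

lemma F_measurable_mono:
  assumes f: "f \<in> borel_measurable (F s)" and st: "s \<le> t"
  shows "f \<in> borel_measurable (F t)"
proof (rule measurableI)
  fix A :: "'b set" assume "A \<in> sets borel"
  then have "f -` A \<inter> space M \<in> sets (F s)" using measurable_sets[OF f] by simp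
  then show "f -` A \<inter> space (F t) \<in> sets (F t)" using F_mono[OF st] by auto
qed simp

lemma F_measurable_M:
  assumes f: "f \<in> borel_measurable (F s)"
  shows "f \<in> borel_measurable M"
proof (rule measurableI)
  fix A :: "'b set" assume "A \<in> sets borel"
  then have "f -` A \<inter> space M \<in> sets (F s)" using measurable_sets[OF f] by simp
  then show "f -` A \<inter> space M \<in> sets M" using F_subset[of s] by auto
qed simp

text \<open>Lets the restriction of \<open>M\<close> to \<open>F s\<close> be written as a
  \<open>distr\<close>, from which product measures over \<open>F s\<close> are formed.\<close>

lemma id_measurable_F: "(\<lambda>\<omega>. \<omega>) \<in> measurable M (F s)"
proof (rule measurableI)
  fix A assume "A \<in> sets (F s)"
  then have "A \<in> sets M" using F_subset[of s] by auto
  then show "(\<lambda>\<omega>. \<omega>) -` A \<inter> space M \<in> sets M" by (simp add: vimage_def)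
qed simp

lemma increments_indep:
  assumes "0 \<le> t 0" "mono t"
  shows "indep_vars (\<lambda>_. borel) (\<lambda>i \<omega>. B (t (Suc i)) \<omega> - B (t i) \<omega>) {..<n::nat}"
  using bm assms unfolding standard_brownian_motion_def by blast

lemma increment_normal:
  "0 \<le> s \<Longrightarrow> s < t \<Longrightarrow> distributed M lborel (\<lambda>\<omega>. B t \<omega> - B s \<omega>) (normal_density 0 (sqrt (t - s)))"
  using bm unfolding standard_brownian_motion_def by blast

text \<open>Deterministic weights make such a sum Gaussian and a function of the increments after
  \<open>s\<close> alone.\<close>

definition stieltjes_sum :: "real \<Rightarrow> real \<Rightarrow> nat \<Rightarrow> (nat \<Rightarrow> real) \<Rightarrow> 'a \<Rightarrow> real" where
  "stieltjes_sum s d n c \<omega> = (\<Sum>i<n. c i * (B (s + real (Suc i) * d) \<omega> - B (s + real i * d) \<omega>))"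

lemma stieltjes_sum_measurable: "s \<ge> 0 \<Longrightarrow> d \<ge> 0 \<Longrightarrow> stieltjes_sum s d n c \<in> borel_measurable M"
  unfolding stieltjes_sum_def
  by (intro borel_measurable_sum borel_measurable_times borel_measurable_diff borel_measurable_const B_measurable) auto

lemma stieltjes_sum_law:
  assumes s: "s \<ge> 0" and d: "d > 0" and n: "n > 0" and c: "\<And>i. i < n \<Longrightarrow> c i > 0"
  shows "distr M borel (stieltjes_sum s d n c) = scaled_normal (sqrt (\<Sum>i<n. (c i)\<^sup>2 * d))"
proof (rule normal_distr_scaled_normal)
  have mono: "mono (\<lambda>i. s + real i * d)"
    using d by (intro monoI) (simp add: mult_right_mono)
  have ind: "indep_vars (\<lambda>_. borel) (\<lambda>i \<omega>. c i * (B (s + real (Suc i) * d) \<omega> - B (s + real i * d) \<omega>)) {..<n}"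
    by (rule indep_vars_compose2[OF increments_indep[OF _ mono]]) (use s in auto)
  have "distributed M lborel (\<lambda>\<omega>. 0 + c i * (B (s + real (Suc i) * d) \<omega> - B (s + real i * d) \<omega>))
       (normal_density (0 + c i * 0) (\<bar>c i\<bar> * sqrt d))" if i: "i \<in> {..<n}" for i
  proof (rule normal_density_affine)
    have "distributed M lborel (\<lambda>\<omega>. B (s + real (Suc i) * d) \<omega> - B (s + real i * d) \<omega>)
      (normal_density 0 (sqrt (s + real (Suc i) * d - (s + real i * d))))"
      using s d by (intro increment_normal) (auto simp: algebra_simps)
    then show "distributed M lborel (\<lambda>\<omega>. B (s + real (Suc i) * d) \<omega> - B (s + real i * d) \<omega>) (normal_density 0 (sqrt d))"
      by (simp add: algebra_simps)
  qed (use c[of i] i d in auto)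
  note na = this
  have nd: "distributed M lborel (\<lambda>\<omega>. c i * (B (s + real (Suc i) * d) \<omega> - B (s + real i * d) \<omega>))
       (normal_density 0 (c i * sqrt d))" if i: "i \<in> {..<n}" for i
    using na[OF i] i c[of i] by (simp add: abs_of_pos)
  have "distributed M lborel (\<lambda>\<omega>. \<Sum>i<n. c i * (B (s + real (Suc i) * d) \<omega> - B (s + real i * d) \<omega>))
     (normal_density (\<Sum>i<n. 0) (sqrt (\<Sum>i<n. (c i * sqrt d)\<^sup>2)))"
    by (rule sum_indep_normal[OF _ _ ind _ nd]) (use n d c in auto)
  then show "distributed M lborel (stieltjes_sum s d n c) (normal_density 0 (sqrt (\<Sum>i<n. (c i)\<^sup>2 * d)))"
    using d by (simp add: stieltjes_sum_def[abs_def] power_mult_distrib)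
  show "0 < sqrt (\<Sum>i<n. (c i)\<^sup>2 * d)"
    using n d c by (auto intro!: sum_pos mult_pos_pos zero_less_power)
qed (rule prob_space_axioms)

text \<open>Together with the null sets these form an intersection-stable generator of
  \<open>F s\<close>.\<close>

definition cylinders :: "real \<Rightarrow> 'a set set" where
  "cylinders s = {{\<omega>\<in>space M. \<forall>j\<in>J. B j \<omega> \<in> A j} | J A. finite J \<and> J \<subseteq> {0..s} \<and> (\<forall>j. A j \<in> sets borel)}"

lemma cylinder_sets: "C \<in> cylinders s \<Longrightarrow> C \<in> sets M"
proof -
  assume "C \<in> cylinders s"
  then obtain J A where J: "finite J" "J \<subseteq> {0..s}" and A: "\<And>j. A j \<in> sets borel"
    and CJ: "C = {\<omega>\<in>space M. \<forall>j\<in>J. B j \<omega> \<in> A j}"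
    unfolding cylinders_def by blast
  show ?thesis
    unfolding CJ
  proof (intro sets.sets_Collect_finite_All)
    fix j assume "j \<in> J"
    then have "B j \<in> borel_measurable M" using J by (intro B_measurable) auto
    from measurable_sets[OF this A[of j]] show "{\<omega> \<in> space M. B j \<omega> \<in> A j} \<in> sets M"
      by (simp add: vimage_def Int_def conj_commute)
  qed (rule J(1))
qed

text \<open>Both events are read off the increments over one common partition: the sample times of
  the cylinder, completed by 0 and \<open>s\<close>, followed by the grid after \<open>s\<close>.
  The cylinder uses the first \<open>k\<close> increments, the sum the last
  \<open>n\<close>.\<close>

lemma cylinder_indep_stieltjes_sum:
  assumes s: "s \<ge> 0" and d: "d > 0" and C: "C \<in> cylinders s" and [measurable]: "E \<in> sets borel"
  shows "prob (C \<inter> (stieltjes_sum s d n c -` E)) = prob C * prob (stieltjes_sum s d n c -` E \<inter> space M)"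
proof -
  obtain J A where J: "finite J" "J \<subseteq> {0..s}" and [measurable]: "\<And>j. A j \<in> sets borel"
    and CJ: "C = {\<omega>\<in>space M. \<forall>j\<in>J. B j \<omega> \<in> A j}"
    using C unfolding cylinders_def by blast
  define L where "L = sorted_list_of_set (J \<union> {0, s})"
  have L: "sorted L" "set L = J \<union> {0, s}" "distinct L"
    using sorted_sorted_list_of_set[of "J \<union> {0, s}"] set_sorted_list_of_set[of "J \<union> {0, s}"]
      distinct_sorted_list_of_set[of "J \<union> {0, s}"] J(1) unfolding L_def by blast+
  define k where "k = length L - 1"
  have Lk: "length L = Suc k"
    using L(2) by (cases L) (auto simp: k_def)
  have L0: "L ! 0 = 0"
  proof -
    obtain p where p: "p < length L" "L ! p = 0" using L(2) by (metis Un_iff in_set_conv_nth insertI1)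
    have "L ! 0 \<le> L ! p" using p L(1) by (intro sorted_nth_mono) auto
    moreover have "L ! 0 \<in> J \<union> {0, s}" using Lk L(2) by (metis nth_mem zero_less_Suc)
    ultimately show ?thesis using p J s by auto
  qed
  have Ls: "L ! k = s"
  proof -
    obtain p where p: "p < length L" "L ! p = s" using L(2) by (metis Un_iff in_set_conv_nth insertI1 insertI2)
    have "L ! p \<le> L ! k" using p L(1) Lk by (intro sorted_nth_mono) auto
    moreover have "L ! k \<in> J \<union> {0, s}" using Lk L(2) by (metis nth_mem lessI)
    ultimately show ?thesis using p J s by auto
  qed
  define t where "t i = (if i \<le> k then L ! i else s + real (i - k) * d)" for i
  have tk: "t (k + i) = s + real i * d" for i by (auto simp: t_def Ls)
  have t0: "t 0 = 0" by (simp add: t_def L0)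
  have "mono t"
  proof (rule mono_iff_le_Suc[THEN iffD2], rule allI)
    fix i
    show "t i \<le> t (Suc i)"
    proof (cases "Suc i \<le> k")
      case True
      then show ?thesis using L(1) Lk by (auto simp: t_def intro!: sorted_nth_mono)
    next
      case False
      then have "i = k + (i - k)" "Suc i = k + Suc (i - k)" by auto
      then have "t i = s + real (i - k) * d" "t (Suc i) = s + real (Suc (i - k)) * d" using tk by metis+
      then show ?thesis using d by (simp add: algebra_simps)
    qed
  qed
  define I where "I i \<omega> = B (t (Suc i)) \<omega> - B (t i) \<omega>" for i \<omega>
  have ind: "indep_vars (\<lambda>_. borel) I {..<k + n}"
    unfolding I_def using \<open>mono t\<close> t0 by (intro increments_indep) auto
  have Im[measurable]: "I i \<in> borel_measurable M" for i
    unfolding I_def using t0 monoD[OF \<open>mono t\<close>, of 0 i] monoD[OF \<open>mono t\<close>, of 0 "Suc i"]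
    by (intro borel_measurable_diff B_measurable) auto
  have iv: "indep_var (PiM {..<k} (\<lambda>_. borel)) (\<lambda>\<omega>. restrict (\<lambda>i. I i \<omega>) {..<k})
      (PiM {k..<k+n} (\<lambda>_. borel)) (\<lambda>\<omega>. restrict (\<lambda>i. I i \<omega>) {k..<k+n})"
    by (rule indep_var_restrict[OF ind]) auto
  \<comment> \<open>\<open>p j\<close> is the position of the time \<open>j\<close> in the
    partition, so that \<open>B j\<close> is the sum of the first \<open>p j\<close> increments
    wherever \<open>B 0 = 0\<close>.\<close>
  define p where "p j = (SOME p. p \<le> k \<and> L ! p = j)" for j
  have p: "p j \<le> k" "L ! p j = j" if "j \<in> J" for j
  proof -
    have "\<exists>q. q \<le> k \<and> L ! q = j" using that L(2) Lk by (metis Un_iff in_set_conv_nth less_Suc_eq_le)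
    then have "p j \<le> k \<and> L ! p j = j" unfolding p_def by (rule someI_ex)
    then show "p j \<le> k" "L ! p j = j" by auto
  qed
  define X1 where "X1 = {f \<in> space (PiM {..<k} (\<lambda>_. borel)). \<forall>j\<in>J. (\<Sum>i<p j. f i) \<in> A j}"
  define X2 where "X2 = {f \<in> space (PiM {k..<k+n} (\<lambda>_. borel)). (\<Sum>i<n. c i * f (k + i)) \<in> E}"
  have m1: "(\<lambda>f. \<Sum>i<p j. f i :: real) \<in> borel_measurable (PiM {..<k} (\<lambda>_. borel))" if "j \<in> J" for j :: real
    using p(1)[OF that] by (intro borel_measurable_sum measurable_component_singleton) auto
  have X1: "X1 \<in> sets (PiM {..<k} (\<lambda>_. borel :: real measure))"
    unfolding X1_def
  proof (intro sets.sets_Collect_finite_All)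
    fix j assume "j \<in> J"
    from measurable_sets[OF m1[OF this], of "A j"]
    show "{f \<in> space (PiM {..<k} (\<lambda>_. borel)). (\<Sum>i<p j. f i) \<in> A j} \<in> sets (PiM {..<k} (\<lambda>_. borel :: real measure))"
      by (simp add: vimage_def Int_def conj_commute)
  qed (rule J(1))
  have m2: "(\<lambda>f. \<Sum>i<n. c i * f (k + i)) \<in> borel_measurable (PiM {k..<k+n} (\<lambda>_. borel))"
    by (intro borel_measurable_sum borel_measurable_times borel_measurable_const measurable_component_singleton) auto
  have X2: "X2 \<in> sets (PiM {k..<k+n} (\<lambda>_. borel :: real measure))"
    unfolding X2_def using measurable_sets[OF m2, of E] by (simp add: vimage_def Int_def conj_commute)
  \<comment> \<open>\<open>B 0 = 0\<close> holds only almost surely; \<open>C'\<close> is the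
    version of \<open>C\<close> written in increments and differs from it by a null set.\<close>
  define C' where "C' = {\<omega>\<in>space M. \<forall>j\<in>J. (\<Sum>i<p j. I i \<omega>) \<in> A j}"
  have C'm[measurable]: "C' \<in> sets M" unfolding C'_def using J(1) by measurable
  have Cm[measurable]: "C \<in> sets M" by (rule cylinder_sets[OF C])
  have Sm[measurable]: "stieltjes_sum s d n c \<in> borel_measurable M"
    using s d by (intro stieltjes_sum_measurable) auto
  have e1: "(\<lambda>\<omega>. restrict (\<lambda>i. I i \<omega>) {..<k}) -` X1 \<inter> space M = C'"
  proof -
    have "(\<Sum>i<p j. restrict (\<lambda>i. I i \<omega>) {..<k} i) = (\<Sum>i<p j. I i \<omega>)" if "j \<in> J" for j \<omega>
      using p(1)[OF that] by (intro sum.cong) auto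
    then show ?thesis unfolding X1_def C'_def by (auto simp: space_PiM)
  qed
  have S: "stieltjes_sum s d n c \<omega> = (\<Sum>i<n. c i * I (k + i) \<omega>)" for \<omega>
    unfolding stieltjes_sum_def I_def using tk tk[of "Suc _"] by simp
  have e2: "(\<lambda>\<omega>. restrict (\<lambda>i. I i \<omega>) {k..<k+n}) -` X2 \<inter> space M = stieltjes_sum s d n c -` E \<inter> space M"
    unfolding X2_def S[abs_def] by (auto simp: space_PiM)
  have *: "prob (C' \<inter> (stieltjes_sum s d n c -` E)) = prob C' * prob (stieltjes_sum s d n c -` E \<inter> space M)"
  proof -
    have "C' \<inter> (stieltjes_sum s d n c -` E) = (\<lambda>\<omega>. (restrict (\<lambda>i. I i \<omega>) {..<k}, restrict (\<lambda>i. I i \<omega>) {k..<k+n})) -` (X1 \<times> X2) \<inter> space M"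
    proof -
      have "(\<lambda>\<omega>. (f \<omega>, g \<omega>)) -` (X1 \<times> X2) \<inter> space M = (f -` X1 \<inter> space M) \<inter> (g -` X2 \<inter> space M)" for f g
        by auto
      then have "(\<lambda>\<omega>. (restrict (\<lambda>i. I i \<omega>) {..<k}, restrict (\<lambda>i. I i \<omega>) {k..<k+n})) -` (X1 \<times> X2) \<inter> space M
        = C' \<inter> (stieltjes_sum s d n c -` E \<inter> space M)" by (simp only: e1 e2)
      then show ?thesis using sets.sets_into_space[OF C'm] by auto
    qed
    then show ?thesis using indep_varD[OF iv X1 X2] unfolding e1 e2 by simp
  qed
  have "AE \<omega> in M. B 0 \<omega> = 0" using bm unfolding standard_brownian_motion_def by blast
  then have ae: "AE \<omega> in M. \<omega> \<in> C \<longleftrightarrow> \<omega> \<in> C'"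
  proof eventually_elim
    fix \<omega> assume b: "B 0 \<omega> = 0"
    have "(\<Sum>i<p j. I i \<omega>) = B j \<omega>" if "j \<in> J" for j
    proof -
      have "(\<Sum>i<p j. I i \<omega>) = B (t (p j)) \<omega> - B (t 0) \<omega>"
        unfolding I_def by (rule sum_lessThan_telescope)
      then show ?thesis using p[OF that] b t0 by (simp add: t_def)
    qed
    then show "\<omega> \<in> C \<longleftrightarrow> \<omega> \<in> C'" unfolding CJ C'_def by auto
  qed
  have "prob C = prob C'" using ae by (intro finite_measure_eq_AE) auto
  moreover have "prob (C \<inter> (stieltjes_sum s d n c -` E)) = prob (C' \<inter> (stieltjes_sum s d n c -` E))"
  proof (rule finite_measure_eq_AE)
    have "stieltjes_sum s d n c -` E \<inter> space M \<in> sets M" by measurable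
    moreover have "Z \<inter> (stieltjes_sum s d n c -` E) = Z \<inter> (stieltjes_sum s d n c -` E \<inter> space M)" if "Z \<in> sets M" for Z
      using sets.sets_into_space[OF that] by auto
    ultimately show "C \<inter> (stieltjes_sum s d n c -` E) \<in> sets M" "C' \<inter> (stieltjes_sum s d n c -` E) \<in> sets M"
      using C'm Cm by (metis sets.Int)+
  qed (use ae in auto)
  ultimately show ?thesis using * by simp
qed

lemma cylinder_Int: "C \<in> cylinders s \<Longrightarrow> C' \<in> cylinders s \<Longrightarrow> C \<inter> C' \<in> cylinders s"
proof -
  assume "C \<in> cylinders s" "C' \<in> cylinders s"
  then obtain J A J' A' where J: "finite J" "J \<subseteq> {0..s}" "\<And>j. A j \<in> sets borel" "C = {\<omega>\<in>space M. \<forall>j\<in>J. B j \<omega> \<in> A j}"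
    "finite J'" "J' \<subseteq> {0..s}" "\<And>j. A' j \<in> sets borel" "C' = {\<omega>\<in>space M. \<forall>j\<in>J'. B j \<omega> \<in> A' j}"
    unfolding cylinders_def by blast
  have "C \<inter> C' = {\<omega>\<in>space M. \<forall>j\<in>J\<union>J'. B j \<omega> \<in> (if j \<in> J then A j else UNIV) \<inter> (if j \<in> J' then A' j else UNIV)}"
    unfolding J by auto
  then show ?thesis
    unfolding cylinders_def using J
    by (intro CollectI exI[of _ "J \<union> J'"] exI[of _ "\<lambda>j. (if j \<in> J then A j else UNIV) \<inter> (if j \<in> J' then A' j else UNIV)"]) auto
qed

text \<open>Given a cylinder of positive probability, the sums keep their normal laws, so the limit
  \<open>\<xi>\<close> has the same law with and without conditioning: this is independence from
  cylinders. Intersection stability extends it to all of \<open>F s\<close>.\<close>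

lemma F_indep_limit:
  assumes s: "s \<ge> 0" and [measurable]: "\<xi> \<in> borel_measurable M"
    and lim: "AE \<omega> in M. (\<lambda>n. stieltjes_sum s (d n) (Suc n) (c n) \<omega>) \<longlonglongrightarrow> \<xi> \<omega>"
    and d: "\<And>n. d n > 0" and c: "\<And>n i. c n i > 0"
    and v: "(\<lambda>n. \<Sum>i<Suc n. (c n i)\<^sup>2 * d n) \<longlonglongrightarrow> w\<^sup>2"
  shows "distr M borel \<xi> = scaled_normal w"
    and "A \<in> sets (F (ennreal s)) \<Longrightarrow> E \<in> sets borel \<Longrightarrow>
           prob (A \<inter> (\<xi> -` E)) = prob A * prob (\<xi> -` E \<inter> space M)"
proof -
  have Sm[measurable]: "stieltjes_sum s (d n) (Suc n) (c n) \<in> borel_measurable M" for n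
    using s d[of n] by (intro stieltjes_sum_measurable) auto
  have law: "distr M borel (stieltjes_sum s (d n) (Suc n) (c n)) = scaled_normal (sqrt (\<Sum>i<Suc n. (c n i)\<^sup>2 * d n))" for n
    by (rule stieltjes_sum_law) (use s d c in auto)
  have v': "(\<lambda>n. (sqrt (\<Sum>i<Suc n. (c n i)\<^sup>2 * d n))\<^sup>2) \<longlonglongrightarrow> w\<^sup>2"
  proof -
    have "(sqrt (\<Sum>i<Suc n. (c n i)\<^sup>2 * d n))\<^sup>2 = (\<Sum>i<Suc n. (c n i)\<^sup>2 * d n)" for n
      using d[of n] by (intro real_sqrt_pow2 sum_nonneg) auto
    then show ?thesis using v by simp
  qed
  show law\<xi>: "distr M borel \<xi> = scaled_normal w"
    by (rule AE_limit_scaled_normal[OF prob_space_axioms Sm _ lim law v']) simp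
  have cyl: "prob (C \<inter> (\<xi> -` E)) = prob C * prob (\<xi> -` E \<inter> space M)" if C: "C \<in> cylinders s" and E[measurable]: "E \<in> sets borel" for C E
  proof (cases "prob C = 0")
    case True
    moreover have "prob (C \<inter> (\<xi> -` E)) \<le> prob C"
      using cylinder_sets[OF C] by (intro finite_measure_mono) auto
    ultimately show ?thesis using measure_nonneg[of M] by (simp add: order_antisym)
  next
    case False
    have Cm[measurable]: "C \<in> sets M" using C by (rule cylinder_sets)
    let ?P = "uniform_measure M C"
    have P: "prob_space ?P"
      using False by (intro prob_space_uniform_measure) (auto simp: emeasure_eq_measure)
    have cond: "emeasure (distr ?P borel f) E = ennreal (prob (C \<inter> (f -` E)) / prob C)"
      if f[measurable]: "f \<in> borel_measurable M" and E[measurable]: "E \<in> sets borel" for f and E :: "real set"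
    proof -
      have "emeasure (distr ?P borel f) E = emeasure ?P (f -` E \<inter> space M)"
        by (subst emeasure_distr) auto
      also have "\<dots> = emeasure M (C \<inter> (f -` E \<inter> space M)) / emeasure M C"
        by (rule emeasure_uniform_measure) auto
      also have "C \<inter> (f -` E \<inter> space M) = C \<inter> (f -` E)" using sets.sets_into_space[OF Cm] by auto
      finally show ?thesis using False by (simp add: emeasure_eq_measure divide_ennreal zero_less_measure_iff)
    qed
    have "distr ?P borel (stieltjes_sum s (d n) (Suc n) (c n)) = scaled_normal (sqrt (\<Sum>i<Suc n. (c n i)\<^sup>2 * d n))" for n
      unfolding law[symmetric]
    proof (rule measure_eqI)
      fix E assume "E \<in> sets (distr ?P borel (stieltjes_sum s (d n) (Suc n) (c n)))"
      then have E[measurable]: "E \<in> sets borel" by simp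
      show "emeasure (distr ?P borel (stieltjes_sum s (d n) (Suc n) (c n))) E = emeasure (distr M borel (stieltjes_sum s (d n) (Suc n) (c n))) E"
        unfolding cond[OF Sm E] cylinder_indep_stieltjes_sum[OF s d C E]
        using False by (simp add: emeasure_distr emeasure_eq_measure)
    qed simp
    moreover have "AE \<omega> in ?P. (\<lambda>n. stieltjes_sum s (d n) (Suc n) (c n) \<omega>) \<longlonglongrightarrow> \<xi> \<omega>"
      using lim by (intro AE_uniform_measureI) auto
    ultimately have "distr ?P borel \<xi> = scaled_normal w"
      by (intro AE_limit_scaled_normal[OF P _ _ _ _ v']) auto
    note law2 = this
    have "ennreal (prob (C \<inter> (\<xi> -` E)) / prob C) = emeasure (distr ?P borel \<xi>) E"
      by (rule cond[symmetric]) auto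
    also have "\<dots> = emeasure (distr M borel \<xi>) E" unfolding law2 law\<xi> ..
    also have "\<dots> = ennreal (prob (\<xi> -` E \<inter> space M))" by (simp add: emeasure_distr emeasure_eq_measure)
    finally have "prob (C \<inter> (\<xi> -` E)) / prob C = prob (\<xi> -` E \<inter> space M)"
      by (subst (asm) ennreal_inj) auto
    then show ?thesis using False by (simp add: field_simps)
  qed
  assume A: "A \<in> sets (F (ennreal s))" and E: "E \<in> sets borel"
  show "prob (A \<inter> (\<xi> -` E)) = prob A * prob (\<xi> -` E \<inter> space M)"
  proof -
    let ?G = "cylinders s \<union> null_sets M" let ?H = "{\<xi> -` E \<inter> space M | E. E \<in> sets borel}"
    have "indep_set ?G ?H"
    proof (rule indep_setI)
      show "?G \<subseteq> events" using cylinder_sets by auto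
      show "?H \<subseteq> events" by auto
      fix a b assume a: "a \<in> ?G" and "b \<in> ?H"
      then obtain E where E: "E \<in> sets borel" "b = \<xi> -` E \<inter> space M" by auto
      show "prob (a \<inter> b) = prob a * prob b"
      proof (cases "a \<in> null_sets M")
        case True
        then have "a \<inter> b \<in> null_sets M" using E by (intro null_set_Int2) auto
        then show ?thesis using True by (simp add: measure_eq_0_null_sets)
      next
        case False
        then have "a \<in> cylinders s" using a by auto
        moreover have "a \<inter> b = a \<inter> (\<xi> -` E)" using E sets.sets_into_space[OF cylinder_sets[OF calculation]] by auto
        ultimately show ?thesis using cyl E by simp
      qed
    qed
    moreover have "Int_stable ?G"
    proof (rule Int_stableI)
      fix a b assume "a \<in> ?G" "b \<in> ?G"
      then show "a \<inter> b \<in> ?G"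
        using cylinder_sets cylinder_Int by (auto intro: null_set_Int1 null_set_Int2)
    qed
    moreover have "Int_stable ?H"
    proof (rule Int_stableI)
      fix a b assume "a \<in> ?H" "b \<in> ?H"
      then obtain E E' where "E \<in> sets borel" "a = \<xi> -` E \<inter> space M" "E' \<in> sets borel" "b = \<xi> -` E' \<inter> space M" by auto
      then show "a \<inter> b \<in> ?H" by (intro CollectI exI[of _ "E \<inter> E'"]) auto
    qed
    ultimately have "indep_set (sigma_sets (space M) ?G) (sigma_sets (space M) ?H)"
      by (rule indep_set_sigma_sets)
    moreover have "A \<in> sigma_sets (space M) ?G"
    proof -
      have gen: "{B r -` A \<inter> space M | r A. 0 \<le> r \<and> ennreal r \<le> ennreal s \<and> A \<in> sets borel} \<subseteq> cylinders s"
      proof safe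
        fix r and A :: "real set" assume "0 \<le> r" "ennreal r \<le> ennreal s" "A \<in> sets borel"
        then show "B r -` A \<inter> space M \<in> cylinders s"
          using s unfolding cylinders_def
          by (intro CollectI exI[of _ "{r}"] exI[of _ "\<lambda>_. A"]) auto
      qed
      have "sets (F (ennreal s)) \<subseteq> sigma_sets (space M) ?G"
        unfolding sets_F using gen by (intro sigma_sets_mono') auto
      then show ?thesis using A by blast
    qed
    moreover have "\<xi> -` E \<inter> space M \<in> sigma_sets (space M) ?H"
      using E by (intro sigma_sets.Basic) auto
    ultimately have "prob (A \<inter> (\<xi> -` E \<inter> space M)) = prob A * prob (\<xi> -` E \<inter> space M)"
      by (rule indep_setD)
    moreover have "A \<inter> (\<xi> -` E \<inter> space M) = A \<inter> (\<xi> -` E)"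
      using A F_subset[of "ennreal s"] sets.sets_into_space by blast
    ultimately show ?thesis by simp
  qed
qed

end

section \<open>Markov property and stopped potentials\<close>

text \<open>Second moments give uniform integrability: y \<le> min y K + y^2 / K for y \<ge> 0, the
  truncated part converges by domination, and the rest costs no more than \<open>C' / K\<close>,
  which is \<open>e\<close>.\<close>

lemma liminf_nn_integral_le_of_square_bounded:
  fixes f :: "nat \<Rightarrow> 'a \<Rightarrow> real"
  assumes "prob_space M" and [measurable]: "\<And>n. f n \<in> borel_measurable M" "g \<in> borel_measurable M"
    and nonneg: "\<And>n x. 0 \<le> f n x" "\<And>x. 0 \<le> g x"
    and lim: "AE x in M. (\<lambda>n. f n x) \<longlonglongrightarrow> g x"
    and sq: "\<And>n. (\<integral>\<^sup>+x. ennreal ((f n x)\<^sup>2) \<partial>M) \<le> ennreal C"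
  shows "liminf (\<lambda>n. \<integral>\<^sup>+x. ennreal (f n x) \<partial>M) \<le> (\<integral>\<^sup>+x. ennreal (g x) \<partial>M)"
proof (rule ennreal_le_epsilon)
  interpret prob_space M by fact
  fix e :: real assume e: "0 < e"
  \<comment> \<open>Keeps the truncation level \<open>K = C' / e\<close> positive even if
    \<open>C\<close> is not.\<close>
  define C' where "C' = max C 1"
  have sq': "(\<integral>\<^sup>+x. ennreal ((f n x)\<^sup>2) \<partial>M) \<le> ennreal C'" for n
    using sq[of n] by (rule order_trans) (simp add: C'_def ennreal_leI)
  define K where "K = C' / e"
  have K: "K > 0" using e by (simp add: K_def C'_def)
  have trunc: "y \<le> min y K + y\<^sup>2 / K" if "0 \<le> y" for y
  proof (cases "y \<le> K")
    case False
    then have "y * K \<le> y * y" using that by (intro mult_left_mono) auto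
    then have "y \<le> y\<^sup>2 / K" using K by (simp add: field_simps power2_eq_square)
    then show ?thesis using K that by simp
  qed (use K in simp)
  have b: "(\<integral>\<^sup>+x. ennreal (f n x) \<partial>M) \<le> (\<integral>\<^sup>+x. ennreal (min (f n x) K) \<partial>M) + ennreal e" for n
  proof -
    have "(\<integral>\<^sup>+x. ennreal (f n x) \<partial>M) \<le> (\<integral>\<^sup>+x. ennreal (min (f n x) K) + ennreal (1 / K) * ennreal ((f n x)\<^sup>2) \<partial>M)"
      using trunc[OF nonneg(1)] nonneg(1) K
      by (intro nn_integral_mono) (simp add: ennreal_plus[symmetric] ennreal_mult[symmetric] ennreal_leI del: ennreal_plus)
    also have "\<dots> = (\<integral>\<^sup>+x. ennreal (min (f n x) K) \<partial>M) + ennreal (1 / K) * (\<integral>\<^sup>+x. ennreal ((f n x)\<^sup>2) \<partial>M)"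
      by (subst nn_integral_add) (auto simp: nn_integral_cmult)
    also have "\<dots> \<le> (\<integral>\<^sup>+x. ennreal (min (f n x) K) \<partial>M) + ennreal (1 / K) * ennreal C'"
      by (intro add_left_mono mult_left_mono sq') simp
    also have "ennreal (1 / K) * ennreal C' = ennreal e"
      using e K by (simp add: ennreal_mult[symmetric] K_def C'_def)
    finally show ?thesis .
  qed
  have "(\<lambda>n. \<integral>\<^sup>+x. ennreal (min (f n x) K) \<partial>M) \<longlonglongrightarrow> (\<integral>\<^sup>+x. ennreal (min (g x) K) \<partial>M)"
  proof (rule nn_integral_dominated_convergence[where w="\<lambda>_. ennreal K"])
    show "AE x in M. (\<lambda>n. ennreal (min (f n x) K)) \<longlonglongrightarrow> ennreal (min (g x) K)"
      using lim by eventually_elim (intro tendsto_ennrealI tendsto_min tendsto_const)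
  qed (auto simp: emeasure_space_1 intro!: AE_I2 ennreal_leI)
  then have "(\<lambda>n. (\<integral>\<^sup>+x. ennreal (min (f n x) K) \<partial>M) + ennreal e) \<longlonglongrightarrow> (\<integral>\<^sup>+x. ennreal (min (g x) K) \<partial>M) + ennreal e"
    by (intro tendsto_add tendsto_const)
  then have "liminf (\<lambda>n. (\<integral>\<^sup>+x. ennreal (min (f n x) K) \<partial>M) + ennreal e) = (\<integral>\<^sup>+x. ennreal (min (g x) K) \<partial>M) + ennreal e"
    by (intro lim_imp_Liminf) auto
  moreover have "liminf (\<lambda>n. \<integral>\<^sup>+x. ennreal (f n x) \<partial>M) \<le> liminf (\<lambda>n. (\<integral>\<^sup>+x. ennreal (min (f n x) K) \<partial>M) + ennreal e)"
    using b by (intro Liminf_mono always_eventually) simp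
  moreover have "(\<integral>\<^sup>+x. ennreal (min (g x) K) \<partial>M) + ennreal e \<le> (\<integral>\<^sup>+x. ennreal (g x) \<partial>M) + ennreal e"
    by (intro add_right_mono nn_integral_mono ennreal_leI) simp
  ultimately show "liminf (\<lambda>n. \<integral>\<^sup>+x. ennreal (f n x) \<partial>M) \<le> (\<integral>\<^sup>+x. ennreal (g x) \<partial>M) + ennreal e"
    by (simp only: order_trans)
qed

text \<open>Completeness at work: the cost at an entry time involves \<open>X\<close>, which is well
  behaved only along almost every path.\<close>

lemma (in complete_measure) borel_measurable_AE_eq:
  assumes f: "f \<in> borel_measurable M" and ae: "AE x in M. f x = g x"
  shows "g \<in> borel_measurable M"
proof (rule measurableI)
  fix A :: "'b set" assume A: "A \<in> sets borel"
  show "g -` A \<inter> space M \<in> sets M"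
  proof (rule in_sets_AE)
    show "f -` A \<inter> space M \<in> sets M" using measurable_sets[OF f A] .
    show "AE x in M. (x \<in> f -` A \<inter> space M) = (x \<in> g -` A \<inter> space M)"
      using ae by eventually_elim auto
  qed auto
qed simp

locale ou_process = ou_parameters \<theta> \<mu> \<sigma> lam + brownian_space M B
  for \<theta> \<mu> \<sigma> lam :: real and M :: "'a measure" and B :: "real \<Rightarrow> 'a \<Rightarrow> real" +
  fixes x :: real and X :: "real \<Rightarrow> 'a \<Rightarrow> real"
  assumes sol: "OU_strong_solution M B \<theta> \<mu> \<sigma> x X"
begin

definition regular_path :: "'a \<Rightarrow> bool" where
  "regular_path \<omega> \<longleftrightarrow> continuous_on {0..} (\<lambda>t. X t \<omega>) \<and> B 0 \<omega> = 0 \<and>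
     (\<forall>t\<ge>0. X t \<omega> = x + (LBINT s:{0..t}. \<theta> * (\<mu> - X s \<omega>)) + \<sigma> * B t \<omega>)"

text \<open>A version of \<open>X\<close> with everywhere continuous paths on the whole time axis.\<close>

definition Z :: "real \<Rightarrow> 'a \<Rightarrow> real" where
  "Z t \<omega> = (if regular_path \<omega> then X (max t 0) \<omega> else 0)"

lemma AE_regular_path: "AE \<omega> in M. regular_path \<omega>"
  using sol bm unfolding OU_strong_solution_def standard_brownian_motion_def regular_path_def by auto

lemma not_regular_path_null: "{\<omega>\<in>space M. \<not> regular_path \<omega>} \<in> null_sets M"
  using AE_regular_path complete_measure.AE_iff_null_sets[OF complete] by blast

lemma Z_eq: "regular_path \<omega> \<Longrightarrow> t \<ge> 0 \<Longrightarrow> Z t \<omega> = X t \<omega>"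
  by (simp add: Z_def)

lemma Z_continuous: "continuous_on UNIV (\<lambda>t. Z t \<omega>)"
proof (cases "regular_path \<omega>")
  case True
  then have "continuous_on {0..} (\<lambda>t. X t \<omega>)" by (simp add: regular_path_def)
  then have "continuous_on UNIV (\<lambda>t. X (max t 0) \<omega>)"
    by (rule continuous_on_compose2) (auto intro!: continuous_intros)
  then show ?thesis using True by (simp add: Z_def)
qed (simp add: Z_def)

lemma Z_0: "regular_path \<omega> \<Longrightarrow> Z 0 \<omega> = x"
proof -
  assume g: "regular_path \<omega>"
  then have "X 0 \<omega> = x + (LBINT s:{0..0}. \<theta> * (\<mu> - X s \<omega>)) + \<sigma> * B 0 \<omega>" unfolding regular_path_def by blast
  moreover have "(LBINT s:{0..0}. \<theta> * (\<mu> - X s \<omega>)) = 0"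
  proof -
    have "AE s in lborel. indicator {0..0::real} s *\<^sub>R (\<theta> * (\<mu> - X s \<omega>)) = 0"
      using AE_lborel_singleton[of 0] by eventually_elim (auto simp: indicator_def)
    then show ?thesis unfolding set_lebesgue_integral_def by (rule integral_eq_zero_AE)
  qed
  ultimately show ?thesis using g by (simp add: Z_eq regular_path_def)
qed

lemma Z_adapted: "0 \<le> s \<Longrightarrow> s \<le> t \<Longrightarrow> Z s \<in> borel_measurable (F (ennreal t))"
proof -
  assume st: "0 \<le> s" "s \<le> t"
  have "X s \<in> borel_measurable (F (ennreal s))"
    using sol st(1) unfolding OU_strong_solution_def by blast
  then have X: "X s \<in> borel_measurable (F (ennreal t))"
    using ennreal_leI[OF st(2)] by (rule F_measurable_mono)
  have "{\<omega> \<in> space (F (ennreal t)). \<not> regular_path \<omega>} \<in> sets (F (ennreal t))"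
    using null_in_F[OF not_regular_path_null] by simp
  then have "{\<omega> \<in> space (F (ennreal t)). regular_path \<omega>} \<in> sets (F (ennreal t))"
    using sets.sets_Collect_neg[where P="\<lambda>\<omega>. \<not> regular_path \<omega>" and M="F (ennreal t)"] by simp
  then have "(\<lambda>\<omega>. if regular_path \<omega> then X s \<omega> else 0) \<in> borel_measurable (F (ennreal t))"
    by (intro measurable_If X borel_measurable_const)
  moreover have "max s 0 = s" using st by simp
  ultimately show ?thesis unfolding Z_def[abs_def] by (simp only:)
qed

lemma Z_measurable [measurable]: "Z t \<in> borel_measurable M"
proof -
  have "Z (max t 0) \<in> borel_measurable M"
    by (rule F_measurable_M[OF Z_adapted[of _ "max t 0"]]) auto
  moreover have "max (max t 0) 0 = max t 0" by simp
  ultimately show ?thesis unfolding Z_def[abs_def] by (simp only:)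
qed

text \<open>Time is rounded down to the grid of mesh 1/(n+1), which leaves countably many measurable
  sections; continuity of the paths gives the limit.\<close>

lemma Z_jointly_measurable: "(\<lambda>p. Z (fst p) (snd p)) \<in> borel_measurable (borel \<Otimes>\<^sub>M M)"
proof (rule borel_measurable_LIMSEQ_real)
  fix p :: "real \<times> 'a"
  have l: "(\<lambda>n. real_of_int \<lfloor>real (Suc n) * fst p\<rfloor> / real (Suc n)) \<longlonglongrightarrow> fst p"
  proof (rule tendsto_sandwich)
    show "\<forall>\<^sub>F n in sequentially. fst p - 1 / real (Suc n) \<le> real_of_int \<lfloor>real (Suc n) * fst p\<rfloor> / real (Suc n)"
    proof (intro always_eventually allI)
      fix n
      have "real (Suc n) * fst p - 1 \<le> real_of_int \<lfloor>real (Suc n) * fst p\<rfloor>" by linarith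
      then have "(real (Suc n) * fst p - 1) / real (Suc n) \<le> real_of_int \<lfloor>real (Suc n) * fst p\<rfloor> / real (Suc n)"
        by (intro divide_right_mono) auto
      then show "fst p - 1 / real (Suc n) \<le> real_of_int \<lfloor>real (Suc n) * fst p\<rfloor> / real (Suc n)"
        by (simp add: diff_divide_distrib)
    qed
    show "\<forall>\<^sub>F n in sequentially. real_of_int \<lfloor>real (Suc n) * fst p\<rfloor> / real (Suc n) \<le> fst p"
    proof (intro always_eventually allI)
      fix n
      have "real_of_int \<lfloor>real (Suc n) * fst p\<rfloor> \<le> real (Suc n) * fst p" by linarith
      then have "real_of_int \<lfloor>real (Suc n) * fst p\<rfloor> / real (Suc n) \<le> real (Suc n) * fst p / real (Suc n)"
        by (intro divide_right_mono) auto
      then show "real_of_int \<lfloor>real (Suc n) * fst p\<rfloor> / real (Suc n) \<le> fst p" by simp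
    qed
    show "(\<lambda>n. fst p - 1 / real (Suc n)) \<longlonglongrightarrow> fst p" by real_asymp
  qed simp
  have "isCont (\<lambda>t. Z t (snd p)) (fst p)"
    using Z_continuous[of "snd p"] by (simp add: continuous_on_eq_continuous_at)
  from isCont_tendsto_compose[OF this l]
  show "(\<lambda>n. Z (real_of_int \<lfloor>real (Suc n) * fst p\<rfloor> / real (Suc n)) (snd p)) \<longlonglongrightarrow> Z (fst p) (snd p)" .
next
  fix n
  show "(\<lambda>p. Z (real_of_int \<lfloor>real (Suc n) * fst p\<rfloor> / real (Suc n)) (snd p)) \<in> borel_measurable (borel \<Otimes>\<^sub>M M)"
  proof (rule measurable_compose_countable[where g="\<lambda>p. \<lfloor>real (Suc n) * fst p\<rfloor>"])
    fix i :: int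
    show "(\<lambda>p. Z (real_of_int i / real (Suc n)) (snd p)) \<in> borel_measurable (borel \<Otimes>\<^sub>M M)" by measurable
  qed measurable
qed

lemma Z_measurable_comp [measurable (raw)]:
  "f \<in> borel_measurable N \<Longrightarrow> g \<in> measurable N M \<Longrightarrow> (\<lambda>y. Z (f y) (g y)) \<in> borel_measurable N"
  using measurable_compose[OF measurable_Pair Z_jointly_measurable, of f N g] by simp

lemma semigroup_0: "ou_semigroup 0 h y = ennreal (h y)"
  by (simp add: ou_semigroup_def std_normal.emeasure_space_1[simplified])

lemma ou_semigroup_measurable [measurable (raw)]:
  assumes [measurable]: "h \<in> borel_measurable borel" "f \<in> borel_measurable N" "g \<in> borel_measurable N"
  shows "(\<lambda>y. ou_semigroup (f y) h (g y)) \<in> borel_measurable N"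
  unfolding ou_semigroup_def ou_mean_def ou_sd_def by measurable

lemma ou_resolvent_measurable [measurable (raw)]:
  assumes [measurable]: "h \<in> borel_measurable borel" "g \<in> borel_measurable N"
  shows "(\<lambda>y. ou_resolvent h (g y)) \<in> borel_measurable N"
  unfolding ou_resolvent_def by measurable

text \<open>\<open>Z t\<close> is an affine function of \<open>Z s\<close> plus
  \<open>\<sigma>\<close> times a Gaussian variable independent of \<open>F s\<close>, so the joint
  law is a product and Tonelli integrates the noise out. The set integrals stand for a conditional
  expectation.\<close>

lemma markov:
  assumes st: "0 \<le> s" "s \<le> t" and A: "A \<in> sets (F (ennreal s))" and [measurable]: "h \<in> borel_measurable borel"
  shows "(\<integral>\<^sup>+\<omega>\<in>A. ennreal (h (Z t \<omega>)) \<partial>M) = (\<integral>\<^sup>+\<omega>\<in>A. ou_semigroup (t - s) h (Z s \<omega>) \<partial>M)"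
proof (cases "s = t")
  case True
  then show ?thesis by (simp add: semigroup_0)
next
  case False
  with st have st': "0 \<le> s" "s < t" by auto
  \<comment> \<open>The normalised noise on \<open>[s, t]\<close>. The decomposition of
    \<open>Z t\<close> holds by definition; the content is that \<open>\<xi>\<close> is an almost
    sure limit of weighted increments.\<close>
  define \<xi> where "\<xi> \<omega> = (Z t \<omega> - ou_mean (t - s) (Z s \<omega>)) / \<sigma>" for \<omega>
  have [measurable]: "\<xi> \<in> borel_measurable M" unfolding \<xi>_def ou_mean_def by measurable
  define d where "d n = (t - s) / real (Suc n)" for n
  define c where "c n i = exp (- \<theta> * (t - (s + real i * d n)))" for n i
  define w where "w = ou_sd (t - s) / \<sigma>"
  have d: "d n > 0" for n using st' by (simp add: d_def)
  have lim: "AE \<omega> in M. (\<lambda>n. stieltjes_sum s (d n) (Suc n) (c n) \<omega>) \<longlonglongrightarrow> \<xi> \<omega>"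
    using AE_regular_path
  proof eventually_elim
    fix \<omega> assume g: "regular_path \<omega>"
    then have gd: "continuous_on {0..} (\<lambda>t. X t \<omega>)"
      "\<And>t. t \<ge> 0 \<Longrightarrow> X t \<omega> = x + (LBINT s:{0..t}. \<theta> * (\<mu> - X s \<omega>)) + \<sigma> * B t \<omega>" unfolding regular_path_def by blast+
    have "(\<lambda>n. \<sigma> * stieltjes_sum s (d n) (Suc n) (c n) \<omega>) \<longlonglongrightarrow> X t \<omega> - (\<mu> + (X s \<omega> - \<mu>) * exp (- \<theta> * (t - s)))"
      using ou_path_riemann[OF gd(1) pos(1) gd(2) st'] unfolding stieltjes_sum_def c_def d_def .
    from tendsto_divide[OF this tendsto_const[of \<sigma>]] pos
    show "(\<lambda>n. stieltjes_sum s (d n) (Suc n) (c n) \<omega>) \<longlonglongrightarrow> \<xi> \<omega>"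
      using g st' by (simp add: \<xi>_def ou_mean_def Z_eq)
  qed
  have v: "(\<lambda>n. \<Sum>i<Suc n. (c n i)\<^sup>2 * d n) \<longlonglongrightarrow> w\<^sup>2"
  proof -
    have e: "exp (- (2 * \<theta>) * (t - s - real i * d n)) = (c n i)\<^sup>2" for i n
      unfolding c_def by (simp add: power2_eq_square algebra_simps flip: exp_add)
    have w2: "w\<^sup>2 = (1 - exp (- (2 * \<theta>) * (t - s))) / (2 * \<theta>)"
      using st' pos by (simp add: w_def power_divide ou_sd_power2)
    have "(\<lambda>n. \<Sum>i<Suc n. exp (- (2 * \<theta>) * (t - s - real i * d n)) * d n) \<longlonglongrightarrow> (1 - exp (- (2 * \<theta>) * (t - s))) / (2 * \<theta>)"
      using riemann_exp_limit[of "2 * \<theta>" "t - s"] pos st' unfolding d_def by simp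
    then show ?thesis unfolding e w2 .
  qed
  have c0: "c n i > 0" for n i by (simp add: c_def)
  note lim_facts = F_indep_limit[OF st(1) \<open>\<xi> \<in> borel_measurable M\<close> lim d c0 v]
  have joint: "distr M (F (ennreal s)) (\<lambda>\<omega>. \<omega>) \<Otimes>\<^sub>M distr M borel \<xi> = distr M (F (ennreal s) \<Otimes>\<^sub>M borel) (\<lambda>\<omega>. (\<omega>, \<xi> \<omega>))"
  proof (rule pair_measure_eqI)
    show "sigma_finite_measure (distr M (F (ennreal s)) (\<lambda>\<omega>. \<omega>))" "sigma_finite_measure (distr M borel \<xi>)"
      by (auto intro!: prob_space_imp_sigma_finite prob_space_distr id_measurable_F)
    show "sets (distr M (F (ennreal s)) (\<lambda>\<omega>. \<omega>) \<Otimes>\<^sub>M distr M borel \<xi>) = sets (distr M (F (ennreal s) \<Otimes>\<^sub>M borel) (\<lambda>\<omega>. (\<omega>, \<xi> \<omega>)))"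
      unfolding sets_distr by (intro sets_pair_measure_cong) auto
    fix A E assume "A \<in> sets (distr M (F (ennreal s)) (\<lambda>\<omega>. \<omega>))" and "E \<in> sets (distr M borel \<xi>)"
    then have A: "A \<in> sets (F (ennreal s))" and E: "E \<in> sets borel" by auto
    have "A \<subseteq> space M" using sets.sets_into_space[OF A] by simp
    then have i: "(\<lambda>\<omega>. \<omega>) -` A \<inter> space M = A" "(\<lambda>\<omega>. (\<omega>, \<xi> \<omega>)) -` (A \<times> E) \<inter> space M = A \<inter> \<xi> -` E" by auto
    show "emeasure (distr M (F (ennreal s)) (\<lambda>\<omega>. \<omega>)) A * emeasure (distr M borel \<xi>) E =
       emeasure (distr M (F (ennreal s) \<Otimes>\<^sub>M borel) (\<lambda>\<omega>. (\<omega>, \<xi> \<omega>))) (A \<times> E)"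
      using A E lim_facts(2)[OF A E] id_measurable_F \<open>A \<subseteq> space M\<close>
      by (simp add: emeasure_distr i emeasure_eq_measure ennreal_mult Int_absorb2)
  qed
  have [measurable]: "Z s \<in> borel_measurable (F (ennreal s))" "Z s \<in> borel_measurable (distr M (F (ennreal s)) (\<lambda>\<omega>. \<omega>))"
    using st by (auto intro: Z_adapted)
  have [measurable]: "A \<in> sets (F (ennreal s))" by fact
  let ?f = "\<lambda>p. ennreal (h (ou_mean (t - s) (Z s (fst p)) + \<sigma> * snd p)) * indicator A (fst p)"
  have f[measurable]: "?f \<in> borel_measurable (F (ennreal s) \<Otimes>\<^sub>M borel)"
    unfolding ou_mean_def by measurable
  have f2: "?f \<in> borel_measurable (distr M (F (ennreal s)) (\<lambda>\<omega>. \<omega>) \<Otimes>\<^sub>M distr M borel \<xi>)"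
    using f by (subst measurable_cong_sets[OF sets_pair_measure_cong refl]) auto
  interpret N: prob_space "distr M borel \<xi>" by (rule prob_space_distr) simp
  have "(\<integral>\<^sup>+\<omega>\<in>A. ennreal (h (Z t \<omega>)) \<partial>M) = (\<integral>\<^sup>+\<omega>. ?f (\<omega>, \<xi> \<omega>) \<partial>M)"
    using pos by (intro nn_integral_cong) (simp add: \<xi>_def)
  also have "\<dots> = (\<integral>\<^sup>+p. ?f p \<partial>distr M (F (ennreal s) \<Otimes>\<^sub>M borel) (\<lambda>\<omega>. (\<omega>, \<xi> \<omega>)))"
    using id_measurable_F by (subst nn_integral_distr) auto
  also have "\<dots> = (\<integral>\<^sup>+\<omega>. (\<integral>\<^sup>+z. ?f (\<omega>, z) \<partial>distr M borel \<xi>) \<partial>distr M (F (ennreal s)) (\<lambda>\<omega>. \<omega>))"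
    unfolding joint[symmetric] by (rule N.nn_integral_fst[OF f2, symmetric])
  also have "\<dots> = (\<integral>\<^sup>+\<omega>. ou_semigroup (t - s) h (Z s \<omega>) * indicator A \<omega> \<partial>distr M (F (ennreal s)) (\<lambda>\<omega>. \<omega>))"
  proof (rule nn_integral_cong)
    fix \<omega>
    have "(\<integral>\<^sup>+z. ?f (\<omega>, z) \<partial>distr M borel \<xi>) = (\<integral>\<^sup>+z. ?f (\<omega>, w * z) \<partial>std_normal_distribution)"
      unfolding lim_facts(1) scaled_normal_def by (subst nn_integral_distr) auto
    also have "\<dots> = ou_semigroup (t - s) h (Z s \<omega>) * indicator A \<omega>"
      unfolding ou_semigroup_def using pos by (subst nn_integral_multc[symmetric]) (auto simp: w_def)
    finally show "(\<integral>\<^sup>+z. ?f (\<omega>, z) \<partial>distr M borel \<xi>) = ou_semigroup (t - s) h (Z s \<omega>) * indicator A \<omega>" .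
  qed
  also have "\<dots> = (\<integral>\<^sup>+\<omega>\<in>A. ou_semigroup (t - s) h (Z s \<omega>) \<partial>M)"
    using id_measurable_F by (subst nn_integral_distr) auto
  finally show ?thesis .
qed

definition future_cost :: "(real \<Rightarrow> real) \<Rightarrow> real \<Rightarrow> 'a \<Rightarrow> ennreal" where
  "future_cost h a \<omega> = (\<integral>\<^sup>+r\<in>{a..}. ennreal (exp (- lam * r)) * ennreal (h (Z r \<omega>)) \<partial>lborel)"

lemma future_cost_measurable [measurable (raw)]:
  assumes [measurable]: "h \<in> borel_measurable borel" "f \<in> borel_measurable N" "g \<in> measurable N M"
  shows "(\<lambda>y. future_cost h (f y) (g y)) \<in> borel_measurable N"
  unfolding future_cost_def atLeast_def indicator_def by measurable

text \<open>Tonelli, then the Markov property at each single time \<open>r \<ge> s\<close>, then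
  Tonelli back; shifting \<open>r\<close> by \<open>s\<close> splits off the factor
  \<open>exp (- lam * s)\<close>.\<close>

lemma markov_future_cost:
  assumes s: "0 \<le> s" and A: "A \<in> sets (F (ennreal s))" and [measurable]: "h \<in> borel_measurable borel"
  shows "(\<integral>\<^sup>+\<omega>\<in>A. future_cost h s \<omega> \<partial>M) = (\<integral>\<^sup>+\<omega>\<in>A. ennreal (exp (- lam * s)) * ou_resolvent h (Z s \<omega>) \<partial>M)"
proof -
  have [measurable]: "A \<in> sets M" using A F_subset by blast
  interpret pair_sigma_finite M lborel
    by (intro pair_sigma_finite.intro sigma_finite_measure_axioms sigma_finite_lborel)
  have "(\<integral>\<^sup>+\<omega>\<in>A. future_cost h s \<omega> \<partial>M) =
     (\<integral>\<^sup>+\<omega>. (\<integral>\<^sup>+r. indicator {s..} r * ennreal (exp (- lam * r)) * (ennreal (h (Z r \<omega>)) * indicator A \<omega>) \<partial>lborel) \<partial>M)"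
    unfolding future_cost_def by (intro nn_integral_cong) (subst nn_integral_multc[symmetric], auto simp: mult_ac)
  also have "\<dots> = (\<integral>\<^sup>+r. (\<integral>\<^sup>+\<omega>. indicator {s..} r * ennreal (exp (- lam * r)) * (ennreal (h (Z r \<omega>)) * indicator A \<omega>) \<partial>M) \<partial>lborel)"
    by (rule Fubini'[symmetric]) measurable
  also have "\<dots> = (\<integral>\<^sup>+r. indicator {s..} r * ennreal (exp (- lam * r)) * (\<integral>\<^sup>+\<omega>\<in>A. ou_semigroup (r - s) h (Z s \<omega>) \<partial>M) \<partial>lborel)"
  proof (intro nn_integral_cong)
    fix r
    show "(\<integral>\<^sup>+\<omega>. indicator {s..} r * ennreal (exp (- lam * r)) * (ennreal (h (Z r \<omega>)) * indicator A \<omega>) \<partial>M)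
       = indicator {s..} r * ennreal (exp (- lam * r)) * (\<integral>\<^sup>+\<omega>\<in>A. ou_semigroup (r - s) h (Z s \<omega>) \<partial>M)"
    proof (cases "s \<le> r")
      case True
      show ?thesis unfolding markov[OF s True A \<open>h \<in> borel_measurable borel\<close>, symmetric]
        by (rule nn_integral_cmult) measurable
    qed simp
  qed
  also have "\<dots> = (\<integral>\<^sup>+r. (\<integral>\<^sup>+\<omega>. indicator {s..} r * ennreal (exp (- lam * r)) * (ou_semigroup (r - s) h (Z s \<omega>) * indicator A \<omega>) \<partial>M) \<partial>lborel)"
    by (intro nn_integral_cong nn_integral_cmult[symmetric]) measurable
  also have "\<dots> = (\<integral>\<^sup>+\<omega>. (\<integral>\<^sup>+r. indicator {s..} r * ennreal (exp (- lam * r)) * (ou_semigroup (r - s) h (Z s \<omega>) * indicator A \<omega>) \<partial>lborel) \<partial>M)"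
    by (rule Fubini') measurable
  also have "\<dots> = (\<integral>\<^sup>+\<omega>\<in>A. ennreal (exp (- lam * s)) * ou_resolvent h (Z s \<omega>) \<partial>M)"
  proof (rule nn_integral_cong)
    fix \<omega>
    have "(\<integral>\<^sup>+r. indicator {s..} r * ennreal (exp (- lam * r)) * (ou_semigroup (r - s) h (Z s \<omega>) * indicator A \<omega>) \<partial>lborel)
      = (\<integral>\<^sup>+r. indicator {s..} (s + 1 * r) * ennreal (exp (- lam * (s + 1 * r))) * (ou_semigroup (s + 1 * r - s) h (Z s \<omega>) * indicator A \<omega>) \<partial>lborel)"
      by (subst nn_integral_real_affine[where c=1 and t=s]) auto
    also have "\<dots> = (\<integral>\<^sup>+r. ennreal (exp (- lam * s)) * (ennreal (exp (- lam * r)) * ou_semigroup r h (Z s \<omega>) * indicator {0..} r) * indicator A \<omega> \<partial>lborel)"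
    proof (intro nn_integral_cong)
      fix r
      have "ennreal (exp (- lam * (s + r))) = ennreal (exp (- lam * s)) * ennreal (exp (- lam * r))"
        by (simp add: ennreal_mult[symmetric] exp_add[symmetric] algebra_simps)
      then show "indicator {s..} (s + 1 * r) * ennreal (exp (- lam * (s + 1 * r))) * (ou_semigroup (s + 1 * r - s) h (Z s \<omega>) * indicator A \<omega>)
        = ennreal (exp (- lam * s)) * (ennreal (exp (- lam * r)) * ou_semigroup r h (Z s \<omega>) * indicator {0..} r) * indicator A \<omega>"
        by (simp add: mult_ac indicator_def)
    qed
    also have "\<dots> = ennreal (exp (- lam * s)) * ou_resolvent h (Z s \<omega>) * indicator A \<omega>"
      unfolding ou_resolvent_def by (subst nn_integral_multc) (auto simp: nn_integral_cmult)
    finally show "(\<integral>\<^sup>+r. indicator {s..} r * ennreal (exp (- lam * r)) * (ou_semigroup (r - s) h (Z s \<omega>) * indicator A \<omega>) \<partial>lborel)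
      = ennreal (exp (- lam * s)) * ou_resolvent h (Z s \<omega>) * indicator A \<omega>" .
  qed
  finally show ?thesis .
qed

text \<open>Rounds a finite time strictly up to a multiple of 1/(n+1), so that each value is taken
  on an event known at that value. Where \<open>\<tau> \<omega> = \<infinity>\<close>,
  \<open>enn2real\<close> yields 0 and the result is meaningless; the integrals below carry the
  indicator of \<open>\<tau> \<omega> < \<infinity>\<close>.\<close>

definition grid_time :: "('a \<Rightarrow> ennreal) \<Rightarrow> nat \<Rightarrow> 'a \<Rightarrow> real" where
  "grid_time \<tau> n \<omega> = (real (nat \<lfloor>enn2real (\<tau> \<omega>) * real (Suc n)\<rfloor>) + 1) / real (Suc n)"

lemma grid_time_bounds: "enn2real (\<tau> \<omega>) \<le> grid_time \<tau> n \<omega>" "grid_time \<tau> n \<omega> \<le> enn2real (\<tau> \<omega>) + 1 / real (Suc n)"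
proof -
  let ?t = "enn2real (\<tau> \<omega>)" let ?m = "real (nat \<lfloor>?t * real (Suc n)\<rfloor>)"
  have "?m = real_of_int \<lfloor>?t * real (Suc n)\<rfloor>" by simp
  then have m: "?m \<le> ?t * real (Suc n)" "?t * real (Suc n) \<le> ?m + 1" by linarith+
  show "?t \<le> grid_time \<tau> n \<omega>" unfolding grid_time_def using m(2) by (simp add: pos_le_divide_eq)
  have "(?m + 1) / real (Suc n) \<le> (?t * real (Suc n) + 1) / real (Suc n)"
    using m(1) by (intro divide_right_mono) auto
  then show "grid_time \<tau> n \<omega> \<le> ?t + 1 / real (Suc n)" unfolding grid_time_def by (simp add: add_divide_distrib)
qed

lemma grid_time_tendsto: "(\<lambda>n. grid_time \<tau> n \<omega>) \<longlonglongrightarrow> enn2real (\<tau> \<omega>)"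
proof (rule tendsto_sandwich[where f="\<lambda>_. enn2real (\<tau> \<omega>)" and h="\<lambda>n. enn2real (\<tau> \<omega>) + 1 / real (Suc n)"])
  show "(\<lambda>n. enn2real (\<tau> \<omega>) + 1 / real (Suc n)) \<longlonglongrightarrow> enn2real (\<tau> \<omega>)" by real_asymp
  show "\<forall>\<^sub>F n in sequentially. enn2real (\<tau> \<omega>) \<le> grid_time \<tau> n \<omega>"
    by (intro always_eventually allI grid_time_bounds)
  show "\<forall>\<^sub>F n in sequentially. grid_time \<tau> n \<omega> \<le> enn2real (\<tau> \<omega>) + 1 / real (Suc n)"
    by (intro always_eventually allI grid_time_bounds)
qed (rule tendsto_const)

lemma stopping_time_measurable: "stopping_time F \<tau> \<Longrightarrow> \<tau> \<in> borel_measurable M"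
proof (rule borel_measurableI_le)
  fix y assume "stopping_time F \<tau>"
  then have "Measurable.pred (F y) (\<lambda>\<omega>. \<tau> \<omega> \<le> y)" by (rule stopping_timeD)
  then have "{\<omega>\<in>space M. \<tau> \<omega> \<le> y} \<in> sets (F y)" by (simp add: pred_def)
  then show "{\<omega>\<in>space M. \<tau> \<omega> \<le> y} \<in> sets M" using F_subset by blast
qed

lemma stopping_time_less:
  assumes "stopping_time F \<tau>" shows "{\<omega>\<in>space M. \<tau> \<omega> < ennreal r} \<in> sets (F (ennreal r))"
proof -
  let ?Q = "{q\<in>\<rat>. 0 \<le> q \<and> q < r}"
  have "\<exists>q\<in>?Q. t \<le> ennreal q" if t: "t < ennreal r" for t
  proof -
    have r: "r > 0" using t by (metis ennreal_neg less_le_not_le not_less_zero linorder_not_less)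
    have "t \<noteq> \<infinity>" using t by auto
    then have te: "t = ennreal (enn2real t)" by (simp add: less_top)
    have "enn2real t < r" using t r by (metis te enn2real_nonneg ennreal_less_iff)
    then obtain q where q: "q \<in> \<rat>" "enn2real t < q" "q < r" using Rats_dense_in_real by blast
    have "0 \<le> q" using q(2) enn2real_nonneg[of t] by linarith
    moreover have "t \<le> ennreal q" using q(2) te by (metis ennreal_leI less_imp_le)
    ultimately show ?thesis using q by blast
  qed
  moreover have "t < ennreal r" if "q \<in> ?Q" "t \<le> ennreal q" for t q
    using that by (auto intro: le_less_trans simp: ennreal_less_iff)
  ultimately have "{\<omega>\<in>space M. \<tau> \<omega> < ennreal r} = (\<Union>q\<in>?Q. {\<omega>\<in>space M. \<tau> \<omega> \<le> ennreal q})" by blast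
  also have "\<dots> \<in> sets (F (ennreal r))"
  proof (rule sets.countable_UN'')
    show "countable ?Q" by (rule countable_subset[OF _ countable_rat]) auto
    fix q assume q: "q \<in> ?Q"
    have "{\<omega>\<in>space M. \<tau> \<omega> \<le> ennreal q} \<in> sets (F (ennreal q))"
      using stopping_timeD[OF assms, of "ennreal q"] by (simp add: pred_def)
    then show "{\<omega>\<in>space M. \<tau> \<omega> \<le> ennreal q} \<in> sets (F (ennreal r))"
      using F_mono[of "ennreal q" "ennreal r"] q by (auto intro: ennreal_leI)
  qed
  finally show ?thesis .
qed

text \<open>The strong Markov property for a time with countably many values: on each event
  \<open>A k\<close> the grid time is the constant \<open>s k\<close>, where the simple Markov
  property applies.\<close>

lemma grid_time_future_cost:
  assumes \<tau>: "stopping_time F \<tau>" and [measurable]: "h \<in> borel_measurable borel"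
  shows "(\<integral>\<^sup>+\<omega>\<in>{\<omega>. \<tau> \<omega> < \<infinity>}. future_cost h (grid_time \<tau> n \<omega>) \<omega> \<partial>M) =
     (\<integral>\<^sup>+\<omega>\<in>{\<omega>. \<tau> \<omega> < \<infinity>}. ennreal (exp (- lam * grid_time \<tau> n \<omega>)) * ou_resolvent h (Z (grid_time \<tau> n \<omega>) \<omega>) \<partial>M)"
proof -
  define s where "s k = (real k + 1) / real (Suc n)" for k
  define A where "A k = {\<omega>\<in>space M. \<tau> \<omega> < \<infinity> \<and> nat \<lfloor>enn2real (\<tau> \<omega>) * real (Suc n)\<rfloor> = k}" for k
  have AF: "A k \<in> sets (F (ennreal (s k)))" for k
  proof -
    \<comment> \<open>This is the event k/(n+1) \<le> \<tau> < (k+1)/(n+1), hence decided at the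
      right end.\<close>
    have eq: "A k = {\<omega>\<in>space M. \<tau> \<omega> < ennreal (s k)} - {\<omega>\<in>space M. \<tau> \<omega> < ennreal (real k / real (Suc n))}"
    proof -
      have "(t < \<infinity> \<and> nat \<lfloor>enn2real t * real (Suc n)\<rfloor> = k) \<longleftrightarrow> (t < ennreal (s k) \<and> \<not> t < ennreal (real k / real (Suc n)))" for t
      proof (cases t)
        case (real r)
        have "(nat \<lfloor>r * real (Suc n)\<rfloor> = k) \<longleftrightarrow> real k \<le> r * real (Suc n) \<and> r * real (Suc n) < real k + 1"
        proof -
          have r0: "0 \<le> r * real (Suc n)" using real by simp
          have "(nat \<lfloor>r * real (Suc n)\<rfloor> = k) \<longleftrightarrow> \<lfloor>r * real (Suc n)\<rfloor> = int k" using r0 by (metis nat_int int_nat_eq zero_le_floor)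
          then show ?thesis by (simp add: floor_eq_iff)
        qed
        moreover have "r < s k \<longleftrightarrow> r * real (Suc n) < real k + 1" unfolding s_def by (rule pos_less_divide_eq) simp
        moreover have "real k / real (Suc n) \<le> r \<longleftrightarrow> real k \<le> r * real (Suc n)" by (rule pos_divide_le_eq) simp
        ultimately show ?thesis using real by (auto simp: ennreal_less_iff not_less simp del: of_nat_Suc)
      next
        case top
        then show ?thesis by simp
      qed
      then show ?thesis unfolding A_def by auto
    qed
    have "{\<omega>\<in>space M. \<tau> \<omega> < ennreal (real k / real (Suc n))} \<in> sets (F (ennreal (s k)))"
    proof (rule subsetD[OF F_mono stopping_time_less[OF \<tau>]])
      show "ennreal (real k / real (Suc n)) \<le> ennreal (s k)"
        unfolding s_def by (intro ennreal_leI divide_right_mono) auto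
    qed
    then show ?thesis unfolding eq using stopping_time_less[OF \<tau>] by (intro sets.Diff)
  qed
  have [measurable]: "A k \<in> sets M" for k using AF F_subset by blast
  have dis: "disjoint_family A" by (auto simp: disjoint_family_on_def A_def)
  have dec: "f (grid_time \<tau> n \<omega>) \<omega> * indicator {\<omega>. \<tau> \<omega> < \<infinity>} \<omega> = (\<Sum>k. f (s k) \<omega> * indicator (A k) \<omega>)"
    if "\<omega> \<in> space M" for f :: "real \<Rightarrow> 'a \<Rightarrow> ennreal" and \<omega>
  proof (cases "\<tau> \<omega> < \<infinity>")
    case True
    then have a: "\<omega> \<in> A (nat \<lfloor>enn2real (\<tau> \<omega>) * real (Suc n)\<rfloor>)" using that by (simp add: A_def)
    show ?thesis
      using suminf_cmult_indicator[OF dis a, of "\<lambda>k. f (s k) \<omega>"] True by (simp add: grid_time_def s_def)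
  next
    case False
    then have "\<omega> \<notin> A k" for k by (simp add: A_def)
    then show ?thesis using False by simp
  qed
  have int: "(\<integral>\<^sup>+\<omega>\<in>{\<omega>. \<tau> \<omega> < \<infinity>}. f (grid_time \<tau> n \<omega>) \<omega> \<partial>M) = (\<Sum>k. \<integral>\<^sup>+\<omega>\<in>A k. f (s k) \<omega> \<partial>M)"
    if [measurable]: "\<And>k. f (s k) \<in> borel_measurable M" for f :: "real \<Rightarrow> 'a \<Rightarrow> ennreal"
  proof -
    have "(\<integral>\<^sup>+\<omega>\<in>{\<omega>. \<tau> \<omega> < \<infinity>}. f (grid_time \<tau> n \<omega>) \<omega> \<partial>M) = (\<integral>\<^sup>+\<omega>. (\<Sum>k. f (s k) \<omega> * indicator (A k) \<omega>) \<partial>M)"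
      by (rule nn_integral_cong) (rule dec)
    also have "\<dots> = (\<Sum>k. \<integral>\<^sup>+\<omega>\<in>A k. f (s k) \<omega> \<partial>M)" by (rule nn_integral_suminf) measurable
    finally show ?thesis .
  qed
  have s0: "s k \<ge> 0" for k by (simp add: s_def)
  show ?thesis
    by (subst int[of "\<lambda>a \<omega>. future_cost h a \<omega>"], measurable,
        subst int[of "\<lambda>a \<omega>. ennreal (exp (- lam * a)) * ou_resolvent h (Z a \<omega>)"], measurable,
        simp add: markov_future_cost[OF s0 AF \<open>h \<in> borel_measurable borel\<close>])
qed

lemma future_cost_antimono: "a \<le> b \<Longrightarrow> future_cost h b \<omega> \<le> future_cost h a \<omega>"
  unfolding future_cost_def by (intro nn_integral_mono mult_left_mono) (auto simp: indicator_def)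

lemma grid_time_measurable: "\<tau> \<in> borel_measurable M \<Longrightarrow> grid_time \<tau> n \<in> borel_measurable M"
proof -
  assume [measurable]: "\<tau> \<in> borel_measurable M"
  have "(\<lambda>\<omega>. (real (nat \<lfloor>enn2real (\<tau> \<omega>) * c\<rfloor>) + 1) / c) \<in> borel_measurable M" for c by measurable
  then show "grid_time \<tau> n \<in> borel_measurable M" unfolding grid_time_def[abs_def] .
qed

lemma future_cost_0:
  assumes [measurable]: "h \<in> borel_measurable borel"
  shows "(\<integral>\<^sup>+\<omega>. future_cost h 0 \<omega> \<partial>M) = ou_resolvent h x"
proof -
  have "space M \<in> sets (F (ennreal 0))" using sets.top[of "F (ennreal 0)"] by simp
  from markov_future_cost[OF order_refl this assms]
  have "(\<integral>\<^sup>+\<omega>. future_cost h 0 \<omega> \<partial>M) = (\<integral>\<^sup>+\<omega>. ou_resolvent h (Z 0 \<omega>) \<partial>M)"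
    by (simp cong: nn_integral_cong)
  also have "\<dots> = (\<integral>\<^sup>+\<omega>. ou_resolvent h x \<partial>M)"
    using AE_regular_path by (intro nn_integral_cong_AE, eventually_elim) (simp add: Z_0)
  finally show ?thesis by (simp add: emeasure_space_1)
qed

text \<open>Discarding the cost before a grid time can only decrease the integral, as costs are
  nonnegative; continuity of \<open>u\<close> and Fatou's lemma pass from grid times to
  \<open>\<tau>\<close>.\<close>

lemma stopped_potential_le:
  assumes \<tau>: "stopping_time F \<tau>" and [measurable]: "h \<in> borel_measurable borel"
    and u: "\<And>y. ou_resolvent h y = ennreal (u y)" and cu: "continuous_on UNIV u"
  shows "(\<integral>\<^sup>+\<omega>\<in>{\<omega>. \<tau> \<omega> < \<infinity>}. ennreal (exp (- lam * enn2real (\<tau> \<omega>))) * ennreal (u (Z (enn2real (\<tau> \<omega>)) \<omega>)) \<partial>M) \<le> ennreal (u x)"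
proof -
  have [measurable]: "\<tau> \<in> borel_measurable M" by (rule stopping_time_measurable[OF \<tau>])
  have [measurable]: "grid_time \<tau> n \<in> borel_measurable M" for n by (rule grid_time_measurable) measurable
  have [measurable]: "u \<in> borel_measurable borel" using cu by (rule borel_measurable_continuous_onI)
  let ?g = "\<lambda>a \<omega>. ennreal (exp (- lam * a)) * ennreal (u (Z a \<omega>)) * indicator {\<omega>. \<tau> \<omega> < \<infinity>} \<omega>"
  have lim: "(\<lambda>n. ?g (grid_time \<tau> n \<omega>) \<omega>) \<longlonglongrightarrow> ?g (enn2real (\<tau> \<omega>)) \<omega>" for \<omega>
  proof -
    \<comment> \<open>Here \<open>u\<close> is known through \<open>ennreal (u y)\<close> alone, so
      its positive part is what has to be continuous.\<close>
    have "continuous_on UNIV (\<lambda>a. exp (- lam * a) * max 0 (u (Z a \<omega>)))"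
      by (intro continuous_intros continuous_on_compose2[OF cu Z_continuous]) auto
    then have "isCont (\<lambda>a. exp (- lam * a) * max 0 (u (Z a \<omega>))) (enn2real (\<tau> \<omega>))" by (simp add: continuous_on_eq_continuous_at)
    from isCont_tendsto_compose[OF this grid_time_tendsto[of \<tau> \<omega>]]
    have "(\<lambda>n. ennreal (exp (- lam * grid_time \<tau> n \<omega>) * max 0 (u (Z (grid_time \<tau> n \<omega>) \<omega>)))) \<longlonglongrightarrow>
        ennreal (exp (- lam * enn2real (\<tau> \<omega>)) * max 0 (u (Z (enn2real (\<tau> \<omega>)) \<omega>)))"
      by (rule tendsto_ennrealI)
    then show ?thesis
      by (cases "\<tau> \<omega> < \<infinity>") (simp_all add: ennreal_mult)
  qed
  have bound: "(\<integral>\<^sup>+\<omega>. ?g (grid_time \<tau> n \<omega>) \<omega> \<partial>M) \<le> ennreal (u x)" for n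
  proof -
    have "(\<integral>\<^sup>+\<omega>. ?g (grid_time \<tau> n \<omega>) \<omega> \<partial>M) = (\<integral>\<^sup>+\<omega>\<in>{\<omega>. \<tau> \<omega> < \<infinity>}. future_cost h (grid_time \<tau> n \<omega>) \<omega> \<partial>M)"
      unfolding grid_time_future_cost[OF \<tau> \<open>h \<in> borel_measurable borel\<close>] u ..
    also have "\<dots> \<le> (\<integral>\<^sup>+\<omega>. future_cost h 0 \<omega> \<partial>M)"
    proof (intro nn_integral_mono)
      fix \<omega>
      have "future_cost h (grid_time \<tau> n \<omega>) \<omega> \<le> future_cost h 0 \<omega>"
        by (rule future_cost_antimono) (simp add: grid_time_def)
      then show "future_cost h (grid_time \<tau> n \<omega>) \<omega> * indicator {\<omega>. \<tau> \<omega> < \<infinity>} \<omega> \<le> future_cost h 0 \<omega>"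
        by (auto simp: indicator_def)
    qed
    finally show ?thesis by (simp add: future_cost_0 u)
  qed
  have "(\<integral>\<^sup>+\<omega>. ?g (enn2real (\<tau> \<omega>)) \<omega> \<partial>M) = (\<integral>\<^sup>+\<omega>. liminf (\<lambda>n. ?g (grid_time \<tau> n \<omega>) \<omega>) \<partial>M)"
    by (intro nn_integral_cong lim_imp_Liminf[symmetric] lim) simp
  also have "\<dots> \<le> liminf (\<lambda>n. \<integral>\<^sup>+\<omega>. ?g (grid_time \<tau> n \<omega>) \<omega> \<partial>M)"
    by (rule nn_integral_liminf) measurable
  also have "\<dots> \<le> liminf (\<lambda>n. ennreal (u x))"
    using bound by (intro Liminf_mono always_eventually) simp
  also have "\<dots> = ennreal (u x)" by (simp add: Liminf_const)
  finally show ?thesis .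
qed

end

section \<open>Verification theorem\<close>

context ou_process
begin

text \<open>A quadratic function written as a resolvent: the expectation of the discounted square of
  the state at a grid time is then bounded by a quantity depending on the starting point
  alone.\<close>

lemma quadratic_resolvent:
  obtains K h where "K \<ge> 1" "\<And>y. ou_resolvent h y = ennreal (y\<^sup>2 + K)" "h \<in> borel_measurable borel"
proof -
  \<comment> \<open>With this \<open>K\<close>, \<open>h y\<close> equals lam y^2 + lam + \<theta>
    (y^2 + (y - \<mu>)^2), which is nonnegative.\<close>
  define K where "K = 1 + (\<sigma>\<^sup>2 + \<theta> * \<mu>\<^sup>2) / lam"
  define h where "h y = lam * (y\<^sup>2 + K) - \<sigma>\<^sup>2 / 2 * 2 - \<theta> * (\<mu> - y) * (2 * y)" for y
  have K: "K \<ge> 1" unfolding K_def using pos by simp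
  have "ou_resolvent h y = ennreal (y\<^sup>2 + K)" for y
  proof (rule ou_resolvent_eq[where S="{}" and ?u1.0="\<lambda>y. 2 * y" and ?u2.0="\<lambda>_. 2" and C="2 + K"])
    show "h y = lam * (y\<^sup>2 + K) - \<sigma>\<^sup>2 / 2 * 2 - \<theta> * (\<mu> - y) * (2 * y)" for y by (simp add: h_def)
    show "((\<lambda>y. y\<^sup>2 + K) has_real_derivative 2 * y) (at y)" for y by (auto intro!: derivative_eq_intros)
    show "((*) 2 has_real_derivative 2) (at y)" for y :: real by (auto intro!: derivative_eq_intros)
    show "\<bar>y\<^sup>2 + K\<bar> \<le> (2 + K) * (1 + y\<^sup>2)" for y using K zero_le_power2[of y] by (simp add: algebra_simps)
    show "\<bar>2 * y\<bar> \<le> (2 + K) * (1 + y\<^sup>2)" for y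
    proof -
      have "\<bar>2 * y\<bar> \<le> 1 + y\<^sup>2" using zero_le_power2[of "\<bar>y\<bar> - 1"] by (simp add: power2_diff)
      moreover have "1 * (1 + y\<^sup>2) \<le> (2 + K) * (1 + y\<^sup>2)" using K by (intro mult_right_mono) auto
      ultimately show ?thesis by simp
    qed
    show "\<bar>2\<bar> \<le> (2 + K) * (1 + y\<^sup>2)" for y :: real
      using mult_mono[of 2 "2 + K" 1 "1 + y\<^sup>2"] K by simp
    show "h y \<ge> 0" for y
    proof -
      have "lam * K = lam + \<sigma>\<^sup>2 + \<theta> * \<mu>\<^sup>2" unfolding K_def using pos by (simp add: field_simps)
      moreover have "2 * \<theta> * y\<^sup>2 - 2 * \<theta> * \<mu> * y + \<theta> * \<mu>\<^sup>2 = \<theta> * (y\<^sup>2 + (y - \<mu>)\<^sup>2)"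
        by (simp add: power2_diff algebra_simps power2_eq_square)
      moreover have "\<theta> * (y\<^sup>2 + (y - \<mu>)\<^sup>2) \<ge> 0" using pos by simp
      moreover have "lam * y\<^sup>2 \<ge> 0" using pos by simp
      moreover have "h y = lam * y\<^sup>2 + lam * K - \<sigma>\<^sup>2 + (2 * \<theta> * y\<^sup>2 - 2 * \<theta> * \<mu> * y)"
        unfolding h_def by (simp add: algebra_simps power2_eq_square)
      ultimately show ?thesis using pos by linarith
    qed
  qed (auto intro: continuous_intros)
  moreover have "h \<in> borel_measurable borel" unfolding h_def by measurable
  ultimately show ?thesis using K that by blast
qed

text \<open>If \<open>h\<close> contributes nothing before \<open>\<tau>\<close>, the full cost is
  at most the liminf of the costs after the grid times. The final passage to the limit runs against
  Fatou's lemma; the growth condition supplies the second moments for it.\<close>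

lemma stopped_potential_ge:
  assumes \<tau>: "stopping_time F \<tau>" and [measurable]: "h \<in> borel_measurable borel"
    and u: "\<And>y. ou_resolvent h y = ennreal (u y)" and cu: "continuous_on UNIV u" and u0: "\<And>y. u y \<ge> 0"
    and growth: "\<And>y. (u y)\<^sup>2 \<le> C * (1 + y\<^sup>2)"
    and before: "AE \<omega> in M. \<forall>r\<ge>0. ennreal r < \<tau> \<omega> \<longrightarrow> h (Z r \<omega>) \<le> 0"
  shows "ennreal (u x) \<le> (\<integral>\<^sup>+\<omega>\<in>{\<omega>. \<tau> \<omega> < \<infinity>}. ennreal (exp (- lam * enn2real (\<tau> \<omega>))) * ennreal (u (Z (enn2real (\<tau> \<omega>)) \<omega>)) \<partial>M)"
proof -
  obtain K hw where K: "K \<ge> 1" "\<And>y. ou_resolvent hw y = ennreal (y\<^sup>2 + K)" and [measurable]: "hw \<in> borel_measurable borel"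
    using quadratic_resolvent by blast
  have C: "C \<ge> 0" using order_trans[OF zero_le_power2 growth[of 0]] by simp
  have [measurable]: "\<tau> \<in> borel_measurable M" by (rule stopping_time_measurable[OF \<tau>])
  have [measurable]: "grid_time \<tau> n \<in> borel_measurable M" for n by (rule grid_time_measurable) measurable
  have [measurable]: "u \<in> borel_measurable borel" using cu by (rule borel_measurable_continuous_onI)
  have gt0: "grid_time \<tau> n \<omega> \<ge> 0" for n \<omega> by (simp add: grid_time_def)
  define f where "f n \<omega> = exp (- lam * grid_time \<tau> n \<omega>) * u (Z (grid_time \<tau> n \<omega>) \<omega>) * indicator {\<omega>. \<tau> \<omega> < \<infinity>} \<omega>" for n \<omega>
  define g where "g \<omega> = exp (- lam * enn2real (\<tau> \<omega>)) * u (Z (enn2real (\<tau> \<omega>)) \<omega>) * indicator {\<omega>. \<tau> \<omega> < \<infinity>} \<omega>" for \<omega>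
  have [measurable]: "f n \<in> borel_measurable M" "g \<in> borel_measurable M" for n
    unfolding f_def g_def by measurable
  have lim: "(\<lambda>n. f n \<omega>) \<longlonglongrightarrow> g \<omega>" for \<omega>
  proof -
    have "continuous_on UNIV (\<lambda>a. exp (- lam * a) * u (Z a \<omega>))"
      by (intro continuous_intros continuous_on_compose2[OF cu Z_continuous]) auto
    then have "isCont (\<lambda>a. exp (- lam * a) * u (Z a \<omega>)) (enn2real (\<tau> \<omega>))" by (simp add: continuous_on_eq_continuous_at)
    from isCont_tendsto_compose[OF this grid_time_tendsto[of \<tau> \<omega>]]
    show ?thesis unfolding f_def g_def by (intro tendsto_mult_right)
  qed
  \<comment> \<open>The squared discount is at most the discount itself, so the square is dominated
    by \<open>C\<close> times the discounted quadratic resolvent at the grid time.\<close>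
  have sq: "(\<integral>\<^sup>+\<omega>. ennreal ((f n \<omega>)\<^sup>2) \<partial>M) \<le> ennreal (C * (x\<^sup>2 + K))" for n
  proof -
    have "(\<integral>\<^sup>+\<omega>. ennreal ((f n \<omega>)\<^sup>2) \<partial>M) \<le> (\<integral>\<^sup>+\<omega>. ennreal C * (ennreal (exp (- lam * grid_time \<tau> n \<omega>)) * ou_resolvent hw (Z (grid_time \<tau> n \<omega>) \<omega>) * indicator {\<omega>. \<tau> \<omega> < \<infinity>} \<omega>) \<partial>M)"
    proof (intro nn_integral_mono)
      fix \<omega>
      let ?e = "exp (- lam * grid_time \<tau> n \<omega>)" let ?z = "Z (grid_time \<tau> n \<omega>) \<omega>"
      have e: "?e * ?e \<le> ?e * 1" using gt0[of n \<omega>] pos by (intro mult_left_mono) auto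
      have "?e\<^sup>2 * (u ?z)\<^sup>2 \<le> ?e * (C * (1 + ?z\<^sup>2))"
        using e growth[of ?z] by (intro mult_mono) (auto simp: power2_eq_square)
      also have "\<dots> \<le> ?e * (C * (?z\<^sup>2 + K))" using K C by (intro mult_left_mono) auto
      finally have b: "?e\<^sup>2 * (u ?z)\<^sup>2 \<le> C * (?e * (?z\<^sup>2 + K))" by (simp add: mult_ac)
      show "ennreal ((f n \<omega>)\<^sup>2) \<le> ennreal C * (ennreal ?e * ou_resolvent hw ?z * indicator {\<omega>. \<tau> \<omega> < \<infinity>} \<omega>)"
      proof (cases "\<tau> \<omega> < \<infinity>")
        case True
        have "ennreal ((f n \<omega>)\<^sup>2) \<le> ennreal (C * (?e * (?z\<^sup>2 + K)))"
          using b True by (intro ennreal_leI) (simp add: f_def power_mult_distrib)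
        also have "\<dots> = ennreal C * (ennreal ?e * ennreal (?z\<^sup>2 + K))"
          using C K by (simp add: ennreal_mult)
        finally show ?thesis using True K by simp
      qed (simp add: f_def)
    qed
    also have "\<dots> = ennreal C * (\<integral>\<^sup>+\<omega>\<in>{\<omega>. \<tau> \<omega> < \<infinity>}. ennreal (exp (- lam * grid_time \<tau> n \<omega>)) * ou_resolvent hw (Z (grid_time \<tau> n \<omega>) \<omega>) \<partial>M)"
      by (rule nn_integral_cmult) measurable
    also have "\<dots> \<le> ennreal C * (\<integral>\<^sup>+\<omega>. future_cost hw 0 \<omega> \<partial>M)"
      unfolding grid_time_future_cost[OF \<tau> \<open>hw \<in> borel_measurable borel\<close>, symmetric]
      by (intro mult_left_mono nn_integral_mono)
        (auto simp: indicator_def intro!: future_cost_antimono gt0)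
    also have "\<dots> = ennreal (C * (x\<^sup>2 + K))" using C K by (simp add: future_cost_0 ennreal_mult)
    finally show ?thesis .
  qed
  have "ennreal (u x) = (\<integral>\<^sup>+\<omega>. future_cost h 0 \<omega> \<partial>M)" by (simp add: future_cost_0 u)
  also have "\<dots> \<le> (\<integral>\<^sup>+\<omega>. liminf (\<lambda>n. future_cost h (grid_time \<tau> n \<omega>) \<omega> * indicator {\<omega>. \<tau> \<omega> < \<infinity>} \<omega>) \<partial>M)"
  proof (rule nn_integral_mono_AE, use before in eventually_elim)
    fix \<omega> assume b: "\<forall>r\<ge>0. ennreal r < \<tau> \<omega> \<longrightarrow> h (Z r \<omega>) \<le> 0"
    show "future_cost h 0 \<omega> \<le> liminf (\<lambda>n. future_cost h (grid_time \<tau> n \<omega>) \<omega> * indicator {\<omega>. \<tau> \<omega> < \<infinity>} \<omega>)"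
    proof (cases "\<tau> \<omega> < \<infinity>")
      case False
      \<comment> \<open>A path that is never stopped has no cost at all, so nothing is lost by
        giving it the value 0.\<close>
      then have "\<tau> \<omega> = \<infinity>" by (metis infinity_ennreal_def less_top)
      then have "h (Z r \<omega>) \<le> 0" if "r \<ge> 0" for r using b that by simp
      then have "future_cost h 0 \<omega> = 0"
        unfolding future_cost_def by (intro nn_integral_zero') (auto simp: indicator_def ennreal_neg)
      then show ?thesis by simp
    next
      case True
      define t where "t = enn2real (\<tau> \<omega>)"
      have t: "\<tau> \<omega> = ennreal t" "t \<ge> 0" using True by (auto simp: t_def)
      let ?k = "\<lambda>a r. ennreal (exp (- lam * r)) * ennreal (h (Z r \<omega>)) * indicator {a..} r"
      have "future_cost h 0 \<omega> = (\<integral>\<^sup>+r. ?k t r \<partial>lborel)"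
        unfolding future_cost_def
      proof (intro nn_integral_cong)
        fix r :: real
        show "?k 0 r = ?k t r"
        proof (cases "0 \<le> r \<and> r < t")
          case True
          then have "h (Z r \<omega>) \<le> 0" using b t by (auto simp: ennreal_less_iff)
          then show ?thesis by (simp add: ennreal_neg)
        qed (use t in \<open>auto simp: indicator_def\<close>)
      qed
      also have "\<dots> \<le> (\<integral>\<^sup>+r. liminf (\<lambda>n. ?k (grid_time \<tau> n \<omega>) r) \<partial>lborel)"
      proof (rule nn_integral_mono_AE)
        have "AE r in lborel. r \<noteq> t" by (rule AE_lborel_singleton)
        then show "AE r in lborel. ?k t r \<le> liminf (\<lambda>n. ?k (grid_time \<tau> n \<omega>) r)"
        proof eventually_elim
          fix r assume r: "r \<noteq> t"
          show "?k t r \<le> liminf (\<lambda>n. ?k (grid_time \<tau> n \<omega>) r)"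
          proof (cases "t < r")
            case True
            have "eventually (\<lambda>n. grid_time \<tau> n \<omega> < r) sequentially"
              using order_tendstoD(2)[OF grid_time_tendsto[of \<tau> \<omega>]] True by (simp add: t_def)
            then have "eventually (\<lambda>n. ?k t r \<le> ?k (grid_time \<tau> n \<omega>) r) sequentially"
              by eventually_elim (use True in \<open>simp add: indicator_def\<close>)
            then have "liminf (\<lambda>n. ?k t r) \<le> liminf (\<lambda>n. ?k (grid_time \<tau> n \<omega>) r)" by (rule Liminf_mono)
            then show ?thesis by (simp add: Liminf_const)
          next
            case False
            then show ?thesis using r by (simp add: indicator_def)
          qed
        qed
      qed
      also have "\<dots> \<le> liminf (\<lambda>n. \<integral>\<^sup>+r. ?k (grid_time \<tau> n \<omega>) r \<partial>lborel)"
      proof (rule nn_integral_liminf)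
        have [measurable]: "(\<lambda>r. Z r \<omega>) \<in> borel_measurable borel" by (rule borel_measurable_continuous_onI[OF Z_continuous])
        show "?k (grid_time \<tau> n \<omega>) \<in> borel_measurable lborel" for n by measurable
      qed
      finally show ?thesis using True by (simp add: future_cost_def)
    qed
  qed
  also have "\<dots> \<le> liminf (\<lambda>n. \<integral>\<^sup>+\<omega>. future_cost h (grid_time \<tau> n \<omega>) \<omega> * indicator {\<omega>. \<tau> \<omega> < \<infinity>} \<omega> \<partial>M)"
    by (rule nn_integral_liminf) measurable
  also have "\<dots> = liminf (\<lambda>n. \<integral>\<^sup>+\<omega>. ennreal (f n \<omega>) \<partial>M)"
  proof -
    have "(\<integral>\<^sup>+\<omega>. future_cost h (grid_time \<tau> n \<omega>) \<omega> * indicator {\<omega>. \<tau> \<omega> < \<infinity>} \<omega> \<partial>M) = (\<integral>\<^sup>+\<omega>. ennreal (f n \<omega>) \<partial>M)" for n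
      unfolding grid_time_future_cost[OF \<tau> \<open>h \<in> borel_measurable borel\<close>]
      by (intro nn_integral_cong) (simp add: f_def u ennreal_mult u0 indicator_def)
    then show ?thesis by simp
  qed
  also have "\<dots> \<le> (\<integral>\<^sup>+\<omega>. ennreal (g \<omega>) \<partial>M)"
    by (rule liminf_nn_integral_le_of_square_bounded[OF prob_space_axioms _ _ _ _ _ sq])
      (use lim u0 in \<open>auto simp: f_def g_def\<close>)
  also have "\<dots> = (\<integral>\<^sup>+\<omega>\<in>{\<omega>. \<tau> \<omega> < \<infinity>}. ennreal (exp (- lam * enn2real (\<tau> \<omega>))) * ennreal (u (Z (enn2real (\<tau> \<omega>)) \<omega>)) \<partial>M)"
    by (intro nn_integral_cong) (simp add: g_def ennreal_mult u0 indicator_def)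
  finally show ?thesis .
qed

section \<open>Entry times and optimality\<close>

lemma entry_time_le_iff:
  assumes g: "regular_path \<omega>" and D: "closed D" and t: "t \<ge> 0"
  shows "entry_time X D \<omega> \<le> ennreal t \<longleftrightarrow> (\<exists>s\<in>{0..t}. Z s \<omega> \<in> D)"
proof
  assume "\<exists>s\<in>{0..t}. Z s \<omega> \<in> D"
  then obtain s where "0 \<le> s" "s \<le> t" "X s \<omega> \<in> D" using Z_eq[OF g] by auto
  then show "entry_time X D \<omega> \<le> ennreal t"
    unfolding entry_time_def by (intro INF_lower2[of s] ennreal_leI) auto
next
  assume e: "entry_time X D \<omega> \<le> ennreal t"
  have cZ: "continuous_on {0..t + 1} (\<lambda>s. Z s \<omega>)" by (rule continuous_on_subset[OF Z_continuous]) simp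
  \<comment> \<open>Visits close to the infimum may happen after \<open>t\<close>, so the compact
    window reaches to \<open>t + 1\<close>; its least visit turns out to be at most
    \<open>t\<close>.\<close>
  define H where "H = {0..t + 1} \<inter> (\<lambda>s. Z s \<omega>) -` D"
  have cH: "compact H"
    unfolding H_def compact_eq_bounded_closed
    using continuous_closed_preimage[OF cZ _ D] by (auto intro: bounded_subset[of "{0..t+1}"])
  have ex: "\<exists>s\<in>H. s < t + d" if d: "0 < d" "d \<le> 1" for d
  proof -
    have "ennreal t < ennreal (t + d)" using d t by (simp add: ennreal_less_iff)
    with e have "entry_time X D \<omega> < ennreal (t + d)" by (rule le_less_trans)
    then obtain s where s: "0 \<le> s" "X s \<omega> \<in> D" "ennreal s < ennreal (t + d)"
      unfolding entry_time_def INF_less_iff by auto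
    then have "s < t + d" using d t by (simp add: ennreal_less_iff del: ennreal_plus)
    then show ?thesis using s d Z_eq[OF g s(1)] by (intro bexI[of _ s]) (auto simp: H_def)
  qed
  then have "H \<noteq> {}" using zero_less_one by blast
  then obtain s0 where s0: "s0 \<in> H" "\<And>s. s \<in> H \<Longrightarrow> s0 \<le> s"
    using compact_attains_inf[OF cH] by blast
  have "s0 \<le> t"
  proof (rule field_le_epsilon)
    fix d :: real assume d: "0 < d"
    obtain s where "s \<in> H" "s < t + min d 1" using ex[of "min d 1"] d by auto
    then show "s0 \<le> t + d" using s0(2)[of s] by linarith
  qed
  then show "\<exists>s\<in>{0..t}. Z s \<omega> \<in> D" using s0(1) by (auto simp: H_def)
qed

text \<open>A continuous path meets the closed set \<open>D\<close> by time \<open>t\<close> iff its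
  distance to \<open>D\<close> gets arbitrarily small along rational times up to \<open>t\<close>,
  an event decided at \<open>t\<close> itself. The remaining paths form a null set, which lies in
  every \<open>F T\<close>. As \<open>infdist\<close> to the empty set is 0, \<open>D\<close> has to
  be nonempty.\<close>

lemma entry_time_stopping_time:
  assumes D: "closed D" "D \<noteq> {}"
  shows "stopping_time F (entry_time X D)"
proof (rule stopping_timeI)
  fix T :: ennreal
  have "{\<omega>\<in>space M. entry_time X D \<omega> \<le> T} \<in> sets (F T)"
  proof (cases T)
    case top
    then show ?thesis using sets.top[of "F T"] by simp
  next
    case (real t)
    \<comment> \<open>Rational times clipped to \<open>[0, t]\<close>; the clipping makes
      \<open>t\<close> itself a sample time even if it is irrational.\<close>
    define q where "q = (\<lambda>r::rat. min t (max 0 (real_of_rat r)))"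
    define E where "E = {\<omega>\<in>space (F T). \<forall>n::nat. \<exists>r. infdist (Z (q r) \<omega>) D < 1 / real (Suc n)}"
    have E: "E \<in> sets (F T)"
    proof -
      have [measurable]: "Z (q r) \<in> borel_measurable (F T)" for r
        using real(1) unfolding \<open>T = ennreal t\<close> by (intro Z_adapted) (auto simp: q_def)
      have [measurable]: "(\<lambda>y. infdist y D) \<in> borel_measurable borel"
        by (intro borel_measurable_continuous_onI continuous_intros)
      show ?thesis unfolding E_def by measurable
    qed
    have dense: "infdist (Z s \<omega>) D = 0 \<Longrightarrow> \<omega> \<in> space M \<Longrightarrow> \<omega> \<in> E" if s: "s \<in> {0..t}" for s \<omega>
    proof -
      assume z: "infdist (Z s \<omega>) D = 0" and "\<omega> \<in> space M"
      have "\<exists>r. infdist (Z (q r) \<omega>) D < 1 / real (Suc n)" for n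
      proof -
        have c: "continuous_on UNIV (\<lambda>a. infdist (Z (min t (max 0 a)) \<omega>) D)"
          by (intro continuous_intros continuous_on_compose2[OF Z_continuous]) auto
        have "open ((\<lambda>a. infdist (Z (min t (max 0 a)) \<omega>) D) -` {..<1 / real (Suc n)})"
          by (rule open_vimage[OF open_lessThan c])
        moreover have "s \<in> (\<lambda>a. infdist (Z (min t (max 0 a)) \<omega>) D) -` {..<1 / real (Suc n)}"
          using s z by (simp add: min_absorb2 max_absorb2)
        ultimately obtain e where e: "e > 0" "ball s e \<subseteq> (\<lambda>a. infdist (Z (min t (max 0 a)) \<omega>) D) -` {..<1 / real (Suc n)}"
          unfolding open_contains_ball by blast
        obtain r where r: "s < real_of_rat r" "real_of_rat r < s + e"
          using of_rat_dense[of s "s + e"] e by auto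
        then have "real_of_rat r \<in> ball s e" by (simp add: dist_real_def)
        then show ?thesis using e(2) by (intro exI[of _ r]) (auto simp: q_def)
      qed
      then show "\<omega> \<in> E" using \<open>\<omega> \<in> space M\<close> by (simp add: E_def)
    qed
    have conv: "\<exists>s\<in>{0..t}. Z s \<omega> \<in> D" if w: "\<omega> \<in> E" for \<omega>
    proof -
      have c: "continuous_on {0..t} (\<lambda>a. infdist (Z a \<omega>) D)"
        by (intro continuous_intros continuous_on_subset[OF Z_continuous]) auto
      have "{0..t} \<noteq> {}" using real by simp
      then obtain s where s: "s \<in> {0..t}" "\<And>a. a \<in> {0..t} \<Longrightarrow> infdist (Z s \<omega>) D \<le> infdist (Z a \<omega>) D"
        using continuous_attains_inf[OF compact_Icc _ c] by blast
      have "infdist (Z s \<omega>) D \<le> 0"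
      proof (rule field_le_epsilon)
        fix e :: real assume "0 < e"
        then obtain n where n: "inverse (real (Suc n)) < e" using reals_Archimedean by blast
        obtain r where r: "infdist (Z (q r) \<omega>) D < 1 / real (Suc n)" using w unfolding E_def by blast
        have "q r \<in> {0..t}" using real by (auto simp: q_def)
        then show "infdist (Z s \<omega>) D \<le> 0 + e" using s(2) r n by (fastforce simp: inverse_eq_divide)
      qed
      then have "infdist (Z s \<omega>) D = 0" using infdist_nonneg[of "Z s \<omega>" D] by linarith
      then show ?thesis using s(1) in_closed_iff_infdist_zero[OF D] by blast
    qed
    let ?N = "{\<omega>\<in>space M. \<not> regular_path \<omega>}"
    let ?S = "{\<omega>\<in>space M. entry_time X D \<omega> \<le> T}"
    have iff: "\<omega> \<in> ?S \<longleftrightarrow> \<omega> \<in> E" if "regular_path \<omega>" "\<omega> \<in> space M" for \<omega>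
    proof -
      have "\<omega> \<in> ?S \<longleftrightarrow> (\<exists>s\<in>{0..t}. Z s \<omega> \<in> D)"
        using entry_time_le_iff[OF that(1) D(1)] real that(2) by simp
      also have "\<dots> \<longleftrightarrow> \<omega> \<in> E"
        using conv dense that(2) D by (metis in_closed_iff_infdist_zero)
      finally show ?thesis .
    qed
    have eq: "?S = (E - ?N) \<union> (?S \<inter> ?N)" using iff by (auto simp: E_def)
    have "?S \<inter> ?N \<in> null_sets M"
      using complete_measure.complete2[OF complete, of "?S \<inter> ?N" ?N] not_regular_path_null by blast
    then have "(E - ?N) \<union> (?S \<inter> ?N) \<in> sets (F T)"
      using E null_in_F not_regular_path_null by (intro sets.Un sets.Diff) auto
    then show ?thesis using eq by simp
  qed
  then show "Measurable.pred (F T) (\<lambda>\<omega>. entry_time X D \<omega> \<le> T)" by (simp add: pred_def)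
qed

text \<open>Every cost is at least \<open>- u x\<close>, because \<open>G \<ge> - u\<close> and the
  discounted potential decreases on average. At the entry time both estimates are sharp: no cost
  accrues before it, and the path then sits in the closed set \<open>D\<close>, where
  \<open>G = - u\<close>.\<close>

theorem verification:
  fixes G u h :: "real \<Rightarrow> real"
  assumes D: "closed D" "D \<noteq> {}" and [measurable]: "h \<in> borel_measurable borel"
    and u: "\<And>y. ou_resolvent h y = ennreal (u y)" and cu: "continuous_on UNIV u" and u0: "\<And>y. u y \<ge> 0"
    and growth: "\<And>y. (u y)\<^sup>2 \<le> C * (1 + y\<^sup>2)"
    and h: "\<And>y. y \<notin> D \<Longrightarrow> h y \<le> 0"
    and G: "\<And>y. - u y \<le> G y" and GD: "\<And>y. y \<in> D \<Longrightarrow> G y = - u y"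
  shows "stopping_value M B lam G X = - u x"
    and "optimal_stopping_time M B lam G X (entry_time X D)"
proof -
  define p where "p \<tau> \<omega> = exp (- lam * enn2real (\<tau> \<omega>)) * u (Z (enn2real (\<tau> \<omega>)) \<omega>) * indicator {\<omega>. \<tau> \<omega> < \<infinity>} \<omega>"
    for \<tau> :: "'a \<Rightarrow> ennreal" and \<omega>
  have [measurable]: "u \<in> borel_measurable borel" using cu by (rule borel_measurable_continuous_onI)
  have p0: "p \<tau> \<omega> \<ge> 0" for \<tau> \<omega> using u0 by (simp add: p_def)
  have pm: "p \<tau> \<in> borel_measurable M" if "stopping_time F \<tau>" for \<tau>
  proof -
    have [measurable]: "\<tau> \<in> borel_measurable M" by (rule stopping_time_measurable[OF that])
    show ?thesis unfolding p_def by measurable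
  qed
  have pe: "(\<integral>\<^sup>+\<omega>. ennreal (p \<tau> \<omega>) \<partial>M) = (\<integral>\<^sup>+\<omega>\<in>{\<omega>. \<tau> \<omega> < \<infinity>}. ennreal (exp (- lam * enn2real (\<tau> \<omega>))) * ennreal (u (Z (enn2real (\<tau> \<omega>)) \<omega>)) \<partial>M)" for \<tau>
    by (intro nn_integral_cong) (simp add: p_def ennreal_mult u0 indicator_def)
  have pint: "integrable M (p \<tau>)" "(LINT \<omega>|M. p \<tau> \<omega>) \<le> u x" if \<tau>: "stopping_time F \<tau>" for \<tau>
  proof -
    have le: "(\<integral>\<^sup>+\<omega>. ennreal (p \<tau> \<omega>) \<partial>M) \<le> ennreal (u x)"
      unfolding pe by (rule stopped_potential_le[OF \<tau> \<open>h \<in> borel_measurable borel\<close> u cu])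
    show i: "integrable M (p \<tau>)"
      using pm[OF \<tau>] p0 le_less_trans[OF le ennreal_less_top] by (intro integrableI_nonneg) auto
    show "(LINT \<omega>|M. p \<tau> \<omega>) \<le> u x"
      using le i p0 u0 by (subst (asm) nn_integral_eq_integral) (auto simp: ennreal_le_iff)
  qed
  let ?c = "\<lambda>\<tau> \<omega>. if \<tau> \<omega> = \<infinity> then 0 else exp (- lam * enn2real (\<tau> \<omega>)) * G (X (enn2real (\<tau> \<omega>)) \<omega>)"
  have lower: "- u x \<le> stopping_cost M lam G X \<tau>" if \<tau>: "stopping_time F \<tau>" for \<tau>
  proof (cases "integrable M (?c \<tau>)")
    case True
    have "- u x \<le> (LINT \<omega>|M. - p \<tau> \<omega>)" using pint[OF \<tau>] by simp
    also have "\<dots> \<le> (LINT \<omega>|M. ?c \<tau> \<omega>)"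
    proof (rule integral_mono_AE)
      show "AE \<omega> in M. - p \<tau> \<omega> \<le> ?c \<tau> \<omega>"
        using AE_regular_path
      proof eventually_elim
        fix \<omega> assume g: "regular_path \<omega>"
        have "exp (- lam * enn2real (\<tau> \<omega>)) * (- u (Z (enn2real (\<tau> \<omega>)) \<omega>)) \<le> exp (- lam * enn2real (\<tau> \<omega>)) * G (Z (enn2real (\<tau> \<omega>)) \<omega>)"
          by (intro mult_left_mono G) simp
        then show "- p \<tau> \<omega> \<le> ?c \<tau> \<omega>"
          using Z_eq[OF g] by (auto simp: p_def less_top)
      qed
    qed (use True pint[OF \<tau>] in auto)
    finally show ?thesis by (simp add: stopping_cost_def)
  next
    case False
    \<comment> \<open>A cost that is not integrable has Bochner integral 0, which respects the lower
      bound since \<open>u \<ge> 0\<close>.\<close>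
    then have "stopping_cost M lam G X \<tau> = 0" unfolding stopping_cost_def by (rule not_integrable_integral_eq)
    then show ?thesis using u0 by simp
  qed
  let ?\<tau> = "entry_time X D"
  have \<tau>: "stopping_time F ?\<tau>" using D by (rule entry_time_stopping_time)
  have before: "AE \<omega> in M. \<forall>r\<ge>0. ennreal r < ?\<tau> \<omega> \<longrightarrow> h (Z r \<omega>) \<le> 0"
    using AE_regular_path
  proof eventually_elim
    fix \<omega> assume g: "regular_path \<omega>"
    show "\<forall>r\<ge>0. ennreal r < ?\<tau> \<omega> \<longrightarrow> h (Z r \<omega>) \<le> 0"
    proof (intro allI impI h)
      fix r assume "0 \<le> r" "ennreal r < ?\<tau> \<omega>"
      then show "Z r \<omega> \<notin> D" using entry_time_le_iff[OF g D(1), of r] by (auto simp: not_le[symmetric])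
    qed
  qed
  have at: "AE \<omega> in M. - p ?\<tau> \<omega> = ?c ?\<tau> \<omega>"
    using AE_regular_path
  proof eventually_elim
    fix \<omega> assume g: "regular_path \<omega>"
    show "- p ?\<tau> \<omega> = ?c ?\<tau> \<omega>"
    proof (cases "?\<tau> \<omega> = \<infinity>")
      case False
      define t where "t = enn2real (?\<tau> \<omega>)"
      have t: "?\<tau> \<omega> = ennreal t" "t \<ge> 0" using False by (auto simp: t_def less_top)
      obtain s where s: "0 \<le> s" "s \<le> t" "Z s \<omega> \<in> D"
        using entry_time_le_iff[OF g D(1) t(2)] t(1) by auto
      have "?\<tau> \<omega> \<le> ennreal s" using entry_time_le_iff[OF g D(1) s(1)] s by auto
      then have "s = t" using t s by (simp add: ennreal_le_iff)
      then have "Z t \<omega> \<in> D" using s by simp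
      then show ?thesis using GD False Z_eq[OF g t(2)] by (simp add: p_def t_def less_top)
    qed (simp add: p_def)
  qed
  have "stopping_cost M lam G X ?\<tau> = (LINT \<omega>|M. - p ?\<tau> \<omega>)"
    unfolding stopping_cost_def
  proof (rule integral_cong_AE)
    show m: "(\<lambda>\<omega>. - p ?\<tau> \<omega>) \<in> borel_measurable M" using pm[OF \<tau>] by simp
    show "?c ?\<tau> \<in> borel_measurable M"
      by (rule complete_measure.borel_measurable_AE_eq[OF complete m at])
    show "AE \<omega> in M. ?c ?\<tau> \<omega> = - p ?\<tau> \<omega>" using at by eventually_elim simp
  qed
  also have "\<dots> = - u x"
  proof -
    have "ennreal (u x) \<le> ennreal (LINT \<omega>|M. p ?\<tau> \<omega>)"
      using stopped_potential_ge[OF \<tau> \<open>h \<in> borel_measurable borel\<close> u cu u0 growth before]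
      unfolding pe[symmetric] using pint(1)[OF \<tau>] p0 by (subst (asm) nn_integral_eq_integral) auto
    then have "u x \<le> (LINT \<omega>|M. p ?\<tau> \<omega>)"
      using p0 by (simp add: ennreal_le_iff integral_nonneg_AE)
    then show ?thesis using pint(2)[OF \<tau>] by simp
  qed
  finally have cost: "stopping_cost M lam G X ?\<tau> = - u x" .
  show "stopping_value M B lam G X = - u x"
    unfolding stopping_value_def
  proof (rule cInf_eq_minimum)
    show "- u x \<in> stopping_cost M lam G X ` {\<tau>. stopping_time F \<tau>}"
      using \<tau> cost by (metis image_eqI mem_Collect_eq)
  qed (use lower in auto)
  then show "optimal_stopping_time M B lam G X ?\<tau>"
    unfolding optimal_stopping_time_def using \<tau> cost by simp
qed

end

section \<open>Smooth fit\<close>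

text \<open>The functions \<open>p(x) (1 - x\<^sup>2)\<^sup>-\<^sup>k exp (-1 / (1 - x\<^sup>2))\<close> on \<open>(-1, 1)\<close>, extended by \<open>0\<close>, are closed
  under differentiation; hence they are all smooth.\<close>

definition bump :: "real poly \<Rightarrow> nat \<Rightarrow> real \<Rightarrow> real" where
  "bump p k x = (if \<bar>x\<bar> < 1 then poly p x / (1 - x\<^sup>2) ^ k * exp (- 1 / (1 - x\<^sup>2)) else 0)"

definition bump_deriv :: "real poly \<Rightarrow> nat \<Rightarrow> real poly" where
  "bump_deriv p k = pderiv p * [:1, 0, -1:]\<^sup>2 + smult (2 * real k) ([:0, 1:] * p * [:1, 0, -1:]) - [:0, 2:] * p"

text \<open>A single term of the exponential series is at most the sum; applied at 1/w it makes
  exp(-1/w) smaller than any power of w.\<close>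

lemma power_le_fact_exp:
  fixes t :: real assumes "t \<ge> 0" shows "t ^ n \<le> fact n * exp t"
proof -
  obtain s where s: "exp t = (\<Sum>m<Suc n. t ^ m / fact m) + exp s / fact (Suc n) * t ^ Suc n"
    using Maclaurin_exp_le[of t "Suc n"] by blast
  have "0 \<le> (\<Sum>m<n. t ^ m / fact m)" using assms by (intro sum_nonneg) auto
  moreover have "0 \<le> exp s / fact (Suc n) * t ^ Suc n" using assms by simp
  ultimately have "t ^ n / fact n \<le> exp t" unfolding s by simp
  then show ?thesis by (simp add: field_simps)
qed

text \<open>Inside the interval this is calculus. At the end points the exponential beats the pole:
  the function is O(|y - x|^2) there, so the derivative exists and is 0.\<close>

lemma bump_DERIV: "(bump p k has_real_derivative bump (bump_deriv p k) (k + 2) x) (at x)"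
proof -
  consider "\<bar>x\<bar> < 1" | "\<bar>x\<bar> > 1" | "\<bar>x\<bar> = 1" by linarith
  then show ?thesis
  proof cases
    case 1
    then have w: "1 - x\<^sup>2 > 0" by (simp add: abs_square_less_1)
    have "((\<lambda>x. poly p x / (1 - x\<^sup>2) ^ k * exp (- 1 / (1 - x\<^sup>2))) has_real_derivative
       ((poly (pderiv p) x * (1 - x\<^sup>2) ^ k - poly p x * (real k * (1 - x\<^sup>2) ^ (k - 1) * (- (2 * x)))) / ((1 - x\<^sup>2) ^ k * (1 - x\<^sup>2) ^ k) * exp (- 1 / (1 - x\<^sup>2))
         + exp (- 1 / (1 - x\<^sup>2)) * (- 2 * x / (1 - x\<^sup>2)\<^sup>2) * (poly p x / (1 - x\<^sup>2) ^ k))) (at x)"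
    proof (rule DERIV_mult)
      show "((\<lambda>x. poly p x / (1 - x\<^sup>2) ^ k) has_real_derivative
         (poly (pderiv p) x * (1 - x\<^sup>2) ^ k - poly p x * (real k * (1 - x\<^sup>2) ^ (k - 1) * (- (2 * x)))) / ((1 - x\<^sup>2) ^ k * (1 - x\<^sup>2) ^ k)) (at x)"
        using w by (auto intro!: derivative_eq_intros)
      show "((\<lambda>x. exp (- 1 / (1 - x\<^sup>2))) has_real_derivative exp (- 1 / (1 - x\<^sup>2)) * (- 2 * x / (1 - x\<^sup>2)\<^sup>2)) (at x)"
        using w by (auto intro!: derivative_eq_intros simp: power2_eq_square)
    qed
    also have "real k * (1 - x\<^sup>2) ^ (k - 1) = real k * (1 - x\<^sup>2) ^ k / (1 - x\<^sup>2)"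
      using w by (cases k) auto
    also have "((poly (pderiv p) x * (1 - x\<^sup>2) ^ k - poly p x * (real k * (1 - x\<^sup>2) ^ k / (1 - x\<^sup>2) * (- (2 * x)))) / ((1 - x\<^sup>2) ^ k * (1 - x\<^sup>2) ^ k) * exp (- 1 / (1 - x\<^sup>2))
         + exp (- 1 / (1 - x\<^sup>2)) * (- 2 * x / (1 - x\<^sup>2)\<^sup>2) * (poly p x / (1 - x\<^sup>2) ^ k))
       = bump (bump_deriv p k) (k + 2) x"
    proof -
      define w where "w = 1 - x\<^sup>2"
      define v where "v = w ^ k"
      have "w > 0" "v > 0" using w by (auto simp: w_def v_def)
      have *: "poly (bump_deriv p k) x = poly (pderiv p) x * w\<^sup>2 + 2 * real k * x * poly p x * w - 2 * x * poly p x"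
        unfolding bump_deriv_def w_def by (simp add: power2_eq_square algebra_simps)
      show ?thesis
        unfolding bump_def * using 1 \<open>w > 0\<close> \<open>v > 0\<close>
        unfolding w_def[symmetric] power_add v_def[symmetric]
        by (simp add: field_simps power2_eq_square)
    qed
    finally have "((\<lambda>x. poly p x / (1 - x\<^sup>2) ^ k * exp (- 1 / (1 - x\<^sup>2))) has_real_derivative bump (bump_deriv p k) (k + 2) x) (at x)" .
    moreover have "x \<in> {-1<..<1}" using 1 by auto
    ultimately show ?thesis
      by (rule has_field_derivative_transform_within_open[OF _ open_greaterThanLessThan]) (auto simp: bump_def)
  next
    case 2
    have "((\<lambda>_. 0) has_real_derivative bump (bump_deriv p k) (k + 2) x) (at x)"
      using 2 by (simp add: bump_def)
    moreover have "open {y::real. \<bar>y\<bar> > 1}" by (intro open_Collect_less continuous_intros)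
    ultimately show ?thesis
      by (rule has_field_derivative_transform_within_open) (use 2 in \<open>auto simp: bump_def\<close>)
  next
    case 3
    have "compact (poly p ` {-1..1})" by (intro compact_continuous_image continuous_intros) auto
    then obtain P where P: "\<And>y. y \<in> {-1..1} \<Longrightarrow> \<bar>poly p y\<bar> \<le> P"
      using compact_imp_bounded[of "poly p ` {-1..1}"] unfolding bounded_iff by fastforce
    have P0: "P \<ge> 0" using P[of 0] by simp
    \<comment> \<open>\<open>P\<close> bounds the polynomial, the factorial comes from the
      exponential bound with exponent \<open>k + 2\<close>, and 4 from squaring
      \<open>w \<le> 2 * \<bar>y - x\<bar>\<close>.\<close>
    define C where "C = 4 * P * fact (k + 2)"
    have b: "\<bar>bump p k y\<bar> \<le> C * \<bar>y - x\<bar>\<^sup>2" for y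
    proof (cases "\<bar>y\<bar> < 1")
      case True
      define w where "w = 1 - y\<^sup>2"
      have w: "w > 0" using True by (simp add: w_def abs_square_less_1)
      have "w = (1 - \<bar>y\<bar>) * (1 + \<bar>y\<bar>)" by (simp add: w_def algebra_simps power2_eq_square)
      also have "\<dots> \<le> \<bar>y - x\<bar> * 2" using True 3 by (intro mult_mono) auto
      finally have w2: "w\<^sup>2 \<le> (\<bar>y - x\<bar> * 2)\<^sup>2" using w by (intro power_mono) auto
      have "(1 / w) ^ (k + 2) \<le> fact (k + 2) * exp (1 / w)" using w by (intro power_le_fact_exp) simp
      then have "exp (- 1 / w) \<le> fact (k + 2) * w ^ (k + 2)"
        using w by (simp add: field_simps exp_minus power_divide)
      then have "exp (- 1 / w) / w ^ k \<le> fact (k + 2) * w\<^sup>2"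
        using w by (simp add: divide_le_eq power_add power2_eq_square mult_ac)
      then have "\<bar>poly p y\<bar> * (exp (- 1 / w) / w ^ k) \<le> P * (fact (k + 2) * w\<^sup>2)"
        using P[of y] True w P0 by (intro mult_mono) (auto simp: abs_less_iff)
      also have "\<dots> \<le> P * (fact (k + 2) * (\<bar>y - x\<bar> * 2)\<^sup>2)" using w2 P0 by (intro mult_left_mono) auto
      finally show ?thesis using True w
        unfolding bump_def C_def w_def[symmetric] by (simp add: abs_mult power_mult_distrib algebra_simps)
    next
      case False
      then show ?thesis using P0 by (simp add: bump_def C_def)
    qed
    have "(\<lambda>y. (bump p k y - bump p k x) / (y - x)) \<midarrow>x\<rightarrow> 0"
    proof (rule Lim_null_comparison)
      show "\<forall>\<^sub>F y in at x. norm ((bump p k y - bump p k x) / (y - x)) \<le> C * \<bar>y - x\<bar>"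
      proof (rule eventually_at_topological[THEN iffD2], intro exI[of _ UNIV] conjI ballI impI)
        fix y assume "y \<noteq> x"
        have "bump p k x = 0" using 3 by (simp add: bump_def)
        then show "norm ((bump p k y - bump p k x) / (y - x)) \<le> C * \<bar>y - x\<bar>"
          using b[of y] \<open>y \<noteq> x\<close> by (simp add: abs_mult divide_le_eq power2_eq_square mult_ac)
      qed auto
      show "(\<lambda>y. C * \<bar>y - x\<bar>) \<midarrow>x\<rightarrow> 0" by (auto intro!: tendsto_eq_intros)
    qed
    then show ?thesis using 3 by (simp add: has_field_derivative_iff bump_def)
  qed
qed

definition scaled_bump :: "real \<Rightarrow> real \<Rightarrow> real \<Rightarrow> real poly \<Rightarrow> nat \<Rightarrow> real \<Rightarrow> real" where
  "scaled_bump a e c p k x = c * bump p k ((x - a) / e)"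

lemma scaled_bump_DERIV:
  "(scaled_bump a e c p k has_real_derivative scaled_bump a e (c / e) (bump_deriv p k) (k + 2) x) (at x)"
proof -
  have "((\<lambda>x. (x - a) / e) has_real_derivative 1 / e) (at x)"
    unfolding divide_inverse by (auto intro!: derivative_eq_intros)
  from DERIV_cmult[OF DERIV_chain2[OF bump_DERIV this], of c]
  show ?thesis unfolding scaled_bump_def[abs_def] by simp
qed

lemma scaled_bump_derivs: "\<exists>c' p' k'. (deriv ^^ n) (scaled_bump a e c p k) = scaled_bump a e c' p' k'"
proof (induction n)
  case (Suc n)
  then obtain c' p' k' where "(deriv ^^ n) (scaled_bump a e c p k) = scaled_bump a e c' p' k'" by blast
  then have "(deriv ^^ Suc n) (scaled_bump a e c p k) = scaled_bump a e (c' / e) (bump_deriv p' k') (k' + 2)"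
    using DERIV_imp_deriv[OF scaled_bump_DERIV] by auto
  then show ?case by blast
qed auto

lemma scaled_bump_test_function:
  assumes "e > 0" shows "test_function (scaled_bump a e c p k)"
  unfolding test_function_def
proof (intro conjI allI exI[of _ "\<bar>a\<bar> + e"] impI)
  fix n x
  obtain c' p' k' where "(deriv ^^ n) (scaled_bump a e c p k) = scaled_bump a e c' p' k'"
    using scaled_bump_derivs by blast
  then show "(deriv ^^ n) (scaled_bump a e c p k) field_differentiable at x"
    using scaled_bump_DERIV unfolding field_differentiable_def by metis
next
  fix x assume "\<bar>a\<bar> + e < \<bar>x\<bar>"
  then have "\<not> \<bar>(x - a) / e\<bar> < 1" using assms by (auto simp: abs_if field_simps split: if_splits)
  then show "scaled_bump a e c p k x = 0" by (simp add: scaled_bump_def bump_def)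
qed

text \<open>Testing the second weak derivative against bumps of width \<open>e\<close> at \<open>a\<close> gives
  \<open>\<bar>fr1 a - fl1 a\<bar> = O(e)\<close>.\<close>

lemma W2inf_loc_smooth_fit:
  fixes fl fr fl1 fr1 fl2 fr2 :: "real \<Rightarrow> real"
  assumes W: "W2inf_loc (\<lambda>x. if x < a then fl x else fr x)" and eq: "fl a = fr a"
    and l: "\<And>x. (fl has_real_derivative fl1 x) (at x)" "\<And>x. (fl1 has_real_derivative fl2 x) (at x)" "continuous_on UNIV fl2"
    and r: "\<And>x. (fr has_real_derivative fr1 x) (at x)" "\<And>x. (fr1 has_real_derivative fr2 x) (at x)" "continuous_on UNIV fr2"
  shows "fl1 a = fr1 a"
proof -
  define f where "f x = (if x < a then fl x else fr x)" for x
  obtain g h where gh: "loc_bounded h" "weak_derivative f g" "weak_derivative g h"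
    using W unfolding W2inf_loc_def f_def[abs_def] by blast
  obtain C where C: "AE x in lebesgue. \<bar>x\<bar> \<le> \<bar>a\<bar> + 1 \<longrightarrow> \<bar>h x\<bar> \<le> C"
    using gh(1) unfolding loc_bounded_def by blast
  have cl: "continuous_on A fl" "continuous_on A fl1" "continuous_on A fl2" for A
    using DERIV_continuous_on[OF has_field_derivative_at_within[OF l(1)]] DERIV_continuous_on[OF has_field_derivative_at_within[OF l(2)]]
      continuous_on_subset[OF l(3)] by auto
  have cr: "continuous_on A fr" "continuous_on A fr1" "continuous_on A fr2" for A
    using DERIV_continuous_on[OF has_field_derivative_at_within[OF r(1)]] DERIV_continuous_on[OF has_field_derivative_at_within[OF r(2)]]
      continuous_on_subset[OF r(3)] by auto
  have f_alt: "f x = fl (min x a) + fr (max x a) - fl a" for x by (auto simp: f_def eq)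
  have cf: "continuous_on A f" for A
    unfolding f_alt[abs_def]
    by (intro continuous_intros continuous_on_compose2[OF cl(1)[of UNIV]] continuous_on_compose2[OF cr(1)[of UNIV]]) auto
  have bdd: "\<exists>B. \<forall>x\<in>{a-1..a+1}. \<bar>k x\<bar> \<le> B" if "continuous_on {a-1..a+1} k" for k :: "real \<Rightarrow> real"
    using compact_imp_bounded[OF compact_continuous_image[OF that compact_Icc]] unfolding bounded_iff by fastforce
  obtain B1 B2 where B12: "\<forall>x\<in>{a-1..a+1}. \<bar>fl2 x\<bar> \<le> B1" "\<forall>x\<in>{a-1..a+1}. \<bar>fr2 x\<bar> \<le> B2"
    using bdd[OF cl(3)] bdd[OF cr(3)] by blast
  define B where "B = max B1 B2"
  have B: "\<bar>fl2 x\<bar> \<le> B" "\<bar>fr2 x\<bar> \<le> B" if "x \<in> {a-1..a+1}" for x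
    using B12 that unfolding B_def by (auto intro: max.coboundedI1 max.coboundedI2)
  have B0: "B \<ge> 0" using B(1)[of a] by auto
  define C' where "C' = max C 0"
  have est: "\<bar>fr1 a - fl1 a\<bar> * exp (-1) \<le> e * (2 * C' + 2 * B)" if e: "0 < e" "e \<le> 1" for e
  proof -
    define \<phi> where "\<phi> = scaled_bump a e 1 1 0"
    define \<phi>1 where "\<phi>1 = scaled_bump a e (1 / e) (bump_deriv 1 0) 2"
    define \<phi>2 where "\<phi>2 = scaled_bump a e (1 / e / e) (bump_deriv (bump_deriv 1 0) 2) 4"
    have d1: "(\<phi> has_real_derivative \<phi>1 x) (at x)" for x
      unfolding \<phi>_def \<phi>1_def using scaled_bump_DERIV[of a e 1 1 0 x] by (simp add: numeral_eq_Suc)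
    have d2: "(\<phi>1 has_real_derivative \<phi>2 x) (at x)" for x
      unfolding \<phi>1_def \<phi>2_def using scaled_bump_DERIV[of a e "1/e" _ 2 x] by (simp add: numeral_eq_Suc)
    have d3: "(\<phi>2 has_real_derivative scaled_bump a e (1 / e / e / e) (bump_deriv (bump_deriv (bump_deriv 1 0) 2) 4) 6 x) (at x)" for x
      unfolding \<phi>2_def using scaled_bump_DERIV[of a e "1/e/e" _ 4 x] by (simp add: numeral_eq_Suc)
    have c\<phi>: "continuous_on A \<phi>" "continuous_on A \<phi>1" "continuous_on A \<phi>2" for A
      using DERIV_continuous_on[OF has_field_derivative_at_within[OF d1]] DERIV_continuous_on[OF has_field_derivative_at_within[OF d2]]
       DERIV_continuous_on[OF has_field_derivative_at_within[OF d3]] by auto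
    have supp: "scaled_bump a e c p k x = 0" if "x \<notin> {a-e<..<a+e}" for c p k x
      using that e by (auto simp: scaled_bump_def bump_def field_simps abs_if split: if_splits)
    have \<phi>0: "0 \<le> \<phi> x" "\<phi> x \<le> 1" for x
    proof -
      have "((x - a) / e)\<^sup>2 < 1" if "\<bar>(x - a) / e\<bar> < 1" using that by (simp only: abs_square_less_1)
      then show "0 \<le> \<phi> x" "\<phi> x \<le> 1" unfolding \<phi>_def scaled_bump_def bump_def by auto
    qed
    have \<phi>a: "\<phi> a = exp (-1)" unfolding \<phi>_def scaled_bump_def bump_def by simp
    have t: "test_function \<phi>" "test_function \<phi>1"
      unfolding \<phi>_def \<phi>1_def using e by (auto intro: scaled_bump_test_function)
    have D: "deriv \<phi> = \<phi>1" "deriv \<phi>1 = \<phi>2" using d1 d2 by (auto intro: DERIV_imp_deriv)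
    have "(LINT x|lebesgue. f x * \<phi>2 x) = - (LINT x|lebesgue. g x * \<phi>1 x)"
      using gh(2) t(2) D unfolding weak_derivative_def by metis
    also have "\<dots> = (LINT x|lebesgue. h x * \<phi> x)"
      using gh(3) t(1) D unfolding weak_derivative_def by (metis minus_minus)
    \<comment> \<open>The first weak derivative has been eliminated; what remains is the second one,
      which is locally bounded.\<close>
    finally have I: "(LINT x|lebesgue. f x * \<phi>2 x) = (LINT x|lebesgue. h x * \<phi> x)" .
    have hb: "\<bar>LINT x|lebesgue. h x * \<phi> x\<bar> \<le> C' * (2 * e)"
    proof (cases "integrable lebesgue (\<lambda>x. h x * \<phi> x)")
      case True
      have "\<bar>LINT x|lebesgue. h x * \<phi> x\<bar> \<le> (LINT x|lebesgue. \<bar>h x * \<phi> x\<bar>)" by (rule integral_abs_bound)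
      also have "\<dots> \<le> (LINT x|lebesgue. C' * indicator {a-e..a+e} x)"
      proof (rule integral_mono_AE)
        show "integrable lebesgue (\<lambda>x. C' * indicat_real {a-e..a+e} x)"
          by (intro integrable_mult_right integrable_real_indicator) (auto simp: emeasure_lborel_Icc_eq)
        show "AE x in lebesgue. \<bar>h x * \<phi> x\<bar> \<le> C' * indicat_real {a-e..a+e} x"
          using C
        proof eventually_elim
          fix x assume hx: "\<bar>x\<bar> \<le> \<bar>a\<bar> + 1 \<longrightarrow> \<bar>h x\<bar> \<le> C"
          show "\<bar>h x * \<phi> x\<bar> \<le> C' * indicat_real {a-e..a+e} x"
          proof (cases "x \<in> {a-e<..<a+e}")
            case True
            then have "\<bar>h x\<bar> \<le> C'" using hx e by (auto simp: C'_def)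
            then have "\<bar>h x\<bar> * \<bar>\<phi> x\<bar> \<le> C' * 1" using \<phi>0[of x] by (intro mult_mono) auto
            then show ?thesis using True by (simp add: abs_mult)
          next
            case False
            then show ?thesis by (simp add: \<phi>_def supp C'_def)
          qed
        qed
      qed (use True in auto)
      also have "\<dots> = C' * (2 * e)" using e by simp
      finally show ?thesis .
    next
      case False
      \<comment> \<open>By convention the integral is 0 here, which is within the bound.\<close>
      then show ?thesis using e by (simp add: not_integrable_integral_eq C'_def)
    qed
    have L: "(LINT x|lebesgue. f x * \<phi>2 x) = integral {a-e..a+e} (\<lambda>x. f x * \<phi>2 x)"
    proof -
      have "(\<lambda>x. f x * \<phi>2 x) absolutely_integrable_on {a-e..a+e}"
        by (intro absolutely_integrable_continuous_real continuous_intros cf c\<phi>)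
      then have "(LINT x:{a-e..a+e}|lebesgue. f x * \<phi>2 x) = integral {a-e..a+e} (\<lambda>x. f x * \<phi>2 x)"
        by (rule set_lebesgue_integral_eq_integral)
      moreover have "indicat_real {a-e..a+e} x *\<^sub>R (f x * \<phi>2 x) = f x * \<phi>2 x" for x
        using supp[of x] by (cases "x \<in> {a-e<..<a+e}") (auto simp: \<phi>2_def)
      ultimately show ?thesis unfolding set_lebesgue_integral_def by (simp only:)
    qed
    also have "\<dots> = integral {a-e..a} (\<lambda>x. f x * \<phi>2 x) + integral {a..a+e} (\<lambda>x. f x * \<phi>2 x)"
      using e by (intro Henstock_Kurzweil_Integration.integral_combine[symmetric] integrable_continuous_real continuous_intros cf c\<phi>) auto
    also have "integral {a-e..a} (\<lambda>x. f x * \<phi>2 x) = integral {a-e..a} (\<lambda>x. fl x * \<phi>2 x)"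
      by (rule integral_cong) (auto simp: f_def eq)
    also have "integral {a..a+e} (\<lambda>x. f x * \<phi>2 x) = integral {a..a+e} (\<lambda>x. fr x * \<phi>2 x)"
      by (rule integral_cong) (auto simp: f_def)
    also have "integral {a-e..a} (\<lambda>x. fl x * \<phi>2 x) = fl a * \<phi>1 a - fl1 a * \<phi> a + integral {a-e..a} (\<lambda>x. fl2 x * \<phi> x)"
    proof -
      have "((\<lambda>x. fl x * \<phi>2 x - fl2 x * \<phi> x) has_integral (fl a * \<phi>1 a - fl1 a * \<phi> a) - (fl (a-e) * \<phi>1 (a-e) - fl1 (a-e) * \<phi> (a-e))) {a-e..a}"
        using e by (intro fundamental_theorem_of_calculus)
          (auto intro!: derivative_eq_intros l(1,2)[THEN has_field_derivative_at_within] d1[THEN has_field_derivative_at_within] d2[THEN has_field_derivative_at_within] simp: has_real_derivative_iff_has_vector_derivative[symmetric] algebra_simps)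
      moreover have "\<phi> (a-e) = 0" "\<phi>1 (a-e) = 0" by (auto simp: \<phi>_def \<phi>1_def supp)
      ultimately have "integral {a-e..a} (\<lambda>x. fl x * \<phi>2 x - fl2 x * \<phi> x) = fl a * \<phi>1 a - fl1 a * \<phi> a"
        by (simp add: integral_unique)
      moreover have "integral {a-e..a} (\<lambda>x. fl x * \<phi>2 x - fl2 x * \<phi> x) = integral {a-e..a} (\<lambda>x. fl x * \<phi>2 x) - integral {a-e..a} (\<lambda>x. fl2 x * \<phi> x)"
        by (intro Henstock_Kurzweil_Integration.integral_diff integrable_continuous_real continuous_intros cl c\<phi>)
      ultimately show ?thesis by simp
    qed
    also have "integral {a..a+e} (\<lambda>x. fr x * \<phi>2 x) = - (fr a * \<phi>1 a - fr1 a * \<phi> a) + integral {a..a+e} (\<lambda>x. fr2 x * \<phi> x)"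
    proof -
      have "((\<lambda>x. fr x * \<phi>2 x - fr2 x * \<phi> x) has_integral (fr (a+e) * \<phi>1 (a+e) - fr1 (a+e) * \<phi> (a+e)) - (fr a * \<phi>1 a - fr1 a * \<phi> a)) {a..a+e}"
        using e by (intro fundamental_theorem_of_calculus)
          (auto intro!: derivative_eq_intros r(1,2)[THEN has_field_derivative_at_within] d1[THEN has_field_derivative_at_within] d2[THEN has_field_derivative_at_within] simp: has_real_derivative_iff_has_vector_derivative[symmetric] algebra_simps)
      moreover have "\<phi> (a+e) = 0" "\<phi>1 (a+e) = 0" by (auto simp: \<phi>_def \<phi>1_def supp)
      ultimately have "integral {a..a+e} (\<lambda>x. fr x * \<phi>2 x - fr2 x * \<phi> x) = - (fr a * \<phi>1 a - fr1 a * \<phi> a)"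
        by (simp add: integral_unique)
      moreover have "integral {a..a+e} (\<lambda>x. fr x * \<phi>2 x - fr2 x * \<phi> x) = integral {a..a+e} (\<lambda>x. fr x * \<phi>2 x) - integral {a..a+e} (\<lambda>x. fr2 x * \<phi> x)"
        by (intro Henstock_Kurzweil_Integration.integral_diff integrable_continuous_real continuous_intros cr c\<phi>)
      ultimately show ?thesis by simp
    qed
    \<comment> \<open>The boundary terms with \<open>\<phi>1 a\<close> cancel because
      \<open>fl a = fr a\<close>. Those with \<open>\<phi> a\<close> leave the jump of the first
      derivative, and the other terms are integrals over sets of length O(\<open>e\<close>).\<close>
    finally have J: "(fr1 a - fl1 a) * \<phi> a = (LINT x|lebesgue. h x * \<phi> x) - integral {a-e..a} (\<lambda>x. fl2 x * \<phi> x) - integral {a..a+e} (\<lambda>x. fr2 x * \<phi> x)"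
      unfolding I by (simp add: eq algebra_simps)
    have i1: "\<bar>integral {a-e..a} (\<lambda>x. fl2 x * \<phi> x)\<bar> \<le> B * e"
    proof -
      have "norm (integral (cbox (a-e) a) (\<lambda>x. fl2 x * \<phi> x)) \<le> B * measure lborel (cbox (a-e) a)"
      proof (rule integrable_bound)
        fix x assume "x \<in> cbox (a-e) a"
        then have "\<bar>fl2 x\<bar> * \<bar>\<phi> x\<bar> \<le> B * 1" using B(1)[of x] \<phi>0[of x] e B0 by (intro mult_mono) auto
        then show "norm (fl2 x * \<phi> x) \<le> B" by (simp add: abs_mult)
      next
        show "(\<lambda>x. fl2 x * \<phi> x) integrable_on cbox (a-e) a"
          unfolding cbox_interval by (intro integrable_continuous_real continuous_intros cl c\<phi>)
      qed (rule B0)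
      then show ?thesis using e by simp
    qed
    have i2: "\<bar>integral {a..a+e} (\<lambda>x. fr2 x * \<phi> x)\<bar> \<le> B * e"
    proof -
      have "norm (integral (cbox a (a+e)) (\<lambda>x. fr2 x * \<phi> x)) \<le> B * measure lborel (cbox a (a+e))"
      proof (rule integrable_bound)
        fix x assume "x \<in> cbox a (a+e)"
        then have "\<bar>fr2 x\<bar> * \<bar>\<phi> x\<bar> \<le> B * 1" using B(2)[of x] \<phi>0[of x] e B0 by (intro mult_mono) auto
        then show "norm (fr2 x * \<phi> x) \<le> B" by (simp add: abs_mult)
      next
        show "(\<lambda>x. fr2 x * \<phi> x) integrable_on cbox a (a+e)"
          unfolding cbox_interval by (intro integrable_continuous_real continuous_intros cr c\<phi>)
      qed (rule B0)
      then show ?thesis using e by simp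
    qed
    have "\<bar>(fr1 a - fl1 a) * \<phi> a\<bar> \<le> C' * (2 * e) + B * e + B * e"
      unfolding J using hb i1 i2 by linarith
    then show ?thesis unfolding abs_mult \<phi>a by (simp add: distrib_left mult_ac)
  qed
  have "\<bar>fr1 a - fl1 a\<bar> * exp (-1) \<le> 0"
  proof (rule field_le_epsilon)
    fix d :: real assume d: "0 < d"
    define e where "e = min 1 (d / (2 * C' + 2 * B + 1))"
    have n: "2 * C' + 2 * B \<ge> 0" using B0 by (simp add: C'_def)
    have e: "0 < e" "e \<le> 1" using d n by (auto simp: e_def)
    have "e * (2 * C' + 2 * B) \<le> e * (2 * C' + 2 * B + 1)" using e by simp
    also have "\<dots> \<le> d / (2 * C' + 2 * B + 1) * (2 * C' + 2 * B + 1)" using n by (intro mult_right_mono) (auto simp: e_def)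
    also have "\<dots> = d" using n by simp
    finally show "\<bar>fr1 a - fl1 a\<bar> * exp (-1) \<le> 0 + d" using est[OF e] by simp
  qed
  then have "\<bar>fr1 a - fl1 a\<bar> \<le> 0" by (simp add: mult_le_0_iff)
  then show ?thesis by simp
qed

section \<open>Minima of a convex-concave function\<close>

text \<open>\<open>q\<close> is read as a function of the scale \<open>F\<close>: \<open>H\<close> is its slope, so that \<open>q\<close> is convex in the
  scale \<open>F\<close> where \<open>H\<close> increases and concave where \<open>H\<close> decreases.\<close>

locale scale_function =
  fixes q F H F' :: "real \<Rightarrow> real"
  assumes F_DERIV: "\<And>x. (F has_real_derivative F' x) (at x)" and F'_pos: "\<And>x. F' x > 0"
    and q_DERIV: "\<And>x. (q has_real_derivative H x * F' x) (at x)"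
    and H_cont: "continuous_on UNIV H"
    and H_at_bot: "\<And>m. \<exists>A. \<forall>x\<le>A. H x < m"
begin

lemma tilt_DERIV: "((\<lambda>x. q x - m * F x) has_real_derivative (H x - m) * F' x) (at x)"
  by (auto intro!: derivative_eq_intros F_DERIV q_DERIV simp: algebra_simps)

lemma tilt_cont: "continuous_on A (\<lambda>x. q x - m * F x)"
  using DERIV_continuous_on[OF has_field_derivative_at_within[OF tilt_DERIV]] .

lemma tilt_increasing:
  assumes "a < b" and "\<And>x. a < x \<Longrightarrow> x < b \<Longrightarrow> H x > m"
  shows "q a - m * F a < q b - m * F b"
proof (rule DERIV_pos_imp_increasing_open[OF \<open>a < b\<close>])
  fix x assume "a < x" "x < b"
  then have "(H x - m) * F' x > 0" using assms(2) F'_pos by simp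
  then show "\<exists>y. ((\<lambda>x. q x - m * F x) has_real_derivative y) (at x) \<and> 0 < y" using tilt_DERIV by blast
qed (rule tilt_cont)

lemma tilt_decreasing:
  assumes "a < b" and "\<And>x. a < x \<Longrightarrow> x < b \<Longrightarrow> H x < m"
  shows "q b - m * F b < q a - m * F a"
proof (rule DERIV_neg_imp_decreasing_open[OF \<open>a < b\<close>])
  fix x assume "a < x" "x < b"
  then have "(H x - m) * F' x < 0" using assms(2) F'_pos by (simp add: mult_less_0_iff)
  then show "\<exists>y. ((\<lambda>x. q x - m * F x) has_real_derivative y) (at x) \<and> y < 0" using tilt_DERIV by blast
qed (rule tilt_cont)

lemma q_increasing: "a < b \<Longrightarrow> (\<And>x. a < x \<Longrightarrow> x < b \<Longrightarrow> H x > 0) \<Longrightarrow> q a < q b"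
  using tilt_increasing[of a b 0] by simp

lemma q_decreasing: "a < b \<Longrightarrow> (\<And>x. a < x \<Longrightarrow> x < b \<Longrightarrow> H x < 0) \<Longrightarrow> q b < q a"
  using tilt_decreasing[of a b 0] by simp

lemma F_increasing: "a < b \<Longrightarrow> F a < F b"
  using DERIV_pos_imp_increasing[of a b F] F_DERIV F'_pos by blast

lemma H_zero:
  assumes up: "strict_mono_on {..b} H" and pos: "H b > 0"
  obtains l where "l < b" "H l = 0" "\<And>x. x < l \<Longrightarrow> H x < 0" "\<And>x. l < x \<Longrightarrow> x \<le> b \<Longrightarrow> H x > 0"
proof -
  obtain A where A: "\<forall>x\<le>A. H x < 0" using H_at_bot by blast
  define A' where "A' = min A b"
  have "H A' \<le> 0" "A' \<le> b" using A by (auto simp: A'_def intro: less_imp_le)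
  then obtain l where l: "A' \<le> l" "l \<le> b" "H l = 0"
    using IVT'[of H A' 0 b] pos continuous_on_subset[OF H_cont, of "{A'..b}"] by auto
  have "l \<noteq> b" using l pos by auto
  then show ?thesis
  proof (intro that[of l])
    show "l < b" "H l = 0" using l \<open>l \<noteq> b\<close> by auto
    show "H x < 0" if "x < l" for x using strict_mono_onD[OF up, of x l] that l by simp
    show "H x > 0" if "l < x" "x \<le> b" for x using strict_mono_onD[OF up, of l x] that l by simp
  qed
qed

text \<open>The zero of \<open>H\<close> is where the horizontal line touches: \<open>q\<close> is
  convex in the scale up to \<open>b\<close> and increasing from there on.\<close>

lemma single_minimum:
  assumes up: "strict_mono_on {..b} H" and pos: "\<And>x. x \<ge> b \<Longrightarrow> H x > 0"
  obtains l where "l < b" "H l = 0" "\<And>x. x < l \<Longrightarrow> H x < 0" "\<And>x. l < x \<Longrightarrow> q l < q x"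
proof -
  obtain l where l: "l < b" "H l = 0" "\<And>x. x < l \<Longrightarrow> H x < 0" "\<And>x. l < x \<Longrightarrow> x \<le> b \<Longrightarrow> H x > 0"
    using H_zero[OF up] pos by blast
  have "q l < q x" if "l < x" for x
  proof (rule q_increasing[OF that])
    fix y assume "l < y"
    then show "H y > 0" using l(4)[of y] pos[of y] by (cases "y \<le> b") auto
  qed
  then show ?thesis using that l by blast
qed

text \<open>Far to the left \<open>H < m\<close>, so \<open>q - m F\<close> decreases there and the
  search reduces to a compact interval.\<close>

lemma tilt_inf_attained:
  obtains a where "a \<le> g" "\<And>x. x \<le> g \<Longrightarrow> q a - m * F a \<le> q x - m * F x"
proof -
  obtain A where A: "\<forall>x\<le>A. H x < m" using H_at_bot by blast
  define A' where "A' = min A g"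
  have "{A'..g} \<noteq> {}" by (simp add: A'_def)
  then obtain a where a: "a \<in> {A'..g}" "\<And>x. x \<in> {A'..g} \<Longrightarrow> q a - m * F a \<le> q x - m * F x"
    using continuous_attains_inf[OF compact_Icc _ tilt_cont] by blast
  have "q a - m * F a \<le> q x - m * F x" if x: "x \<le> g" for x
  proof (cases "x < A'")
    case True
    have "q A' - m * F A' < q x - m * F x"
      by (rule tilt_decreasing[OF True]) (use A in \<open>auto simp: A'_def\<close>)
    moreover have "q a - m * F a \<le> q A' - m * F A'" using a by auto
    ultimately show ?thesis by simp
  qed (use a x in auto)
  then show ?thesis using that a by auto
qed

lemma interior_min_slope:
  assumes d: "d > 0" and min: "\<And>x. \<bar>x - a\<bar> < d \<Longrightarrow> q a - m * F a \<le> q x - m * F x"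
  shows "H a = m"
proof -
  have "(H a - m) * F' a = 0"
    by (rule DERIV_local_min[OF tilt_DERIV d]) (use min in \<open>auto simp: abs_minus_commute\<close>)
  then show ?thesis using F'_pos[of a] by simp
qed

text \<open>A minimum has slope \<open>m\<close>, but from a point of slope \<open>m\<close> a step
  into a strictly concave piece lowers \<open>q - m F\<close>. The end points of the piece are
  included, since one direction into it is always available.\<close>

lemma interior_min_not_concave:
  assumes c: "c < g" and down: "strict_antimono_on {c..g} H"
    and a: "c \<le> a" "a \<le> g" and d: "d > 0" and min: "\<And>x. \<bar>x - a\<bar> < d \<Longrightarrow> q a - m * F a \<le> q x - m * F x"
  shows False
proof -
  have Ha: "H a = m" using interior_min_slope[OF d min] .
  have less: "H y < H x" if "c \<le> x" "x < y" "y \<le> g" for x y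
    using monotone_onD[OF down, of x y] that by simp
  show False
  proof (cases "a < g")
    case True
    define y where "y = min g (a + d / 2)"
    have y: "a < y" "y \<le> g" "\<bar>y - a\<bar> < d" using True d by (auto simp: y_def)
    have "q y - m * F y < q a - m * F a"
      by (rule tilt_decreasing[OF y(1)]) (use less[of a] Ha a y in auto)
    then show False using min[OF y(3)] by simp
  next
    case False
    then have ag: "a = g" using a by simp
    define y where "y = max c (a - d / 2)"
    have y: "y < a" "c \<le> y" "\<bar>y - a\<bar> < d" using ag c d by (auto simp: y_def)
    have "q y - m * F y < q a - m * F a"
      by (rule tilt_increasing[OF y(1)]) (use less[of _ a] Ha a y in auto)
    then show False using min[OF y(3)] by simp
  qed
qed

text \<open>Comparing the infima of \<open>q - m F\<close> over \<open>{..g}\<close> and \<open>{g..\<beta>}\<close> as \<open>m\<close> decreases from \<open>0\<close>: the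
  first is larger at \<open>m = 0\<close>, the second for \<open>m\<close> near \<open>-\<infinity>\<close>; where they agree there is a common
  tangent.\<close>

lemma common_tangent:
  assumes order: "c < g" "g < d"
    and up1: "strict_mono_on {..c} H" and down: "strict_antimono_on {c..g} H" and up2: "strict_mono_on {g..d} H"
    and \<beta>: "g < \<beta>" "\<beta> \<le> d" "H \<beta> = 0" and below: "\<And>x. x \<le> g \<Longrightarrow> q \<beta> < q x"
    and F_pos: "\<And>x. F x > 0"
  obtains m a b where "m < 0" "a < c" "g < b" "b < \<beta>" "H a = m" "H b = m"
    "q a - m * F a = q b - m * F b" "\<And>x. a < x \<Longrightarrow> x < b \<Longrightarrow> q a - m * F a < q x - m * F x"
proof -
  define f1 where "f1 m = (INF x\<in>{..g}. q x - m * F x)" for m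
  define f2 where "f2 m = (INF x\<in>{g..\<beta>}. q x - m * F x)" for m
  have at1: "\<exists>a\<in>{..g}. f1 m = q a - m * F a \<and> (\<forall>x\<in>{..g}. f1 m \<le> q x - m * F x)" for m
  proof -
    obtain a where a: "a \<le> g" "\<And>x. x \<le> g \<Longrightarrow> q a - m * F a \<le> q x - m * F x" using tilt_inf_attained by blast
    have "f1 m = q a - m * F a" unfolding f1_def using a by (intro cInf_eq_minimum) auto
    then show ?thesis using a by auto
  qed
  have at2: "\<exists>b\<in>{g..\<beta>}. f2 m = q b - m * F b \<and> (\<forall>x\<in>{g..\<beta>}. f2 m \<le> q x - m * F x)" for m
  proof -
    have "{g..\<beta>} \<noteq> {}" using \<beta> by simp
    then obtain b where b: "b \<in> {g..\<beta>}" "\<And>x. x \<in> {g..\<beta>} \<Longrightarrow> q b - m * F b \<le> q x - m * F x"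
      using continuous_attains_inf[OF compact_Icc _ tilt_cont] by blast
    have "f2 m = q b - m * F b" unfolding f2_def using b by (intro cInf_eq_minimum) auto
    then show ?thesis using b by auto
  qed
  have FB: "F x \<le> F \<beta>" if "x \<le> \<beta>" for x using F_increasing[of x \<beta>] that by (cases "x = \<beta>") auto
  \<comment> \<open>An infimum of affine functions of \<open>m\<close> with slopes
    \<open>- F x\<close>, which \<open>F \<beta>\<close> bounds in size on
    \<open>{..\<beta>}\<close>, is Lipschitz; this gives the continuity for the intermediate value
    theorem.\<close>
  have lip: "\<bar>f m - f m'\<bar> \<le> F \<beta> * \<bar>m - m'\<bar>"
    if at: "\<And>m. \<exists>a\<in>S. f m = q a - m * F a \<and> (\<forall>x\<in>S. f m \<le> q x - m * F x)" and S: "S \<subseteq> {..\<beta>}" for f :: "real \<Rightarrow> real" and S m m'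
  proof -
    have one: "f m \<le> f m' + F \<beta> * \<bar>m - m'\<bar>" for m m'
    proof -
      obtain a where a: "a \<in> S" "f m' = q a - m' * F a" using at by blast
      have "f m \<le> q a - m * F a" using at a(1) by blast
      also have "\<dots> = f m' + (m' - m) * F a" using a by (simp add: algebra_simps)
      also have "(m' - m) * F a \<le> \<bar>m - m'\<bar> * F \<beta>" using FB[of a] a S F_pos[of a] by (intro mult_mono) auto
      finally show ?thesis by (simp add: mult.commute)
    qed
    show ?thesis using one[of m m'] one[of m' m] by (simp add: abs_if split: if_splits)
  qed
  have cont: "continuous_on A (\<lambda>m. f1 m - f2 m)" for A
  proof (intro continuous_on_diff)
    have "(F \<beta>)-lipschitz_on A f1" by (rule lipschitz_onI) (use lip[OF at1] \<beta> F_pos[of \<beta>] in \<open>auto simp: dist_real_def\<close>)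
    then show "continuous_on A f1" by (rule lipschitz_on_continuous_on)
    have "(F \<beta>)-lipschitz_on A f2" by (rule lipschitz_onI) (use lip[OF at2] \<beta> F_pos[of \<beta>] in \<open>auto simp: dist_real_def\<close>)
    then show "continuous_on A f2" by (rule lipschitz_on_continuous_on)
  qed
  have pos0: "f1 0 - f2 0 > 0"
  proof -
    obtain a where "a \<le> g" "f1 0 = q a" using at1[of 0] by auto
    then have "q \<beta> < f1 0" using below by simp
    moreover have "f2 0 \<le> q \<beta>" using at2[of 0] \<beta> by auto
    ultimately show ?thesis by simp
  qed
  obtain b0 where b0: "b0 \<in> {g..\<beta>}" "\<And>x. x \<in> {g..\<beta>} \<Longrightarrow> q b0 \<le> q x"
    using at2[of 0] by auto
  define dF where "dF = F g - F (g - 1)"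
  have dF: "dF > 0" using F_increasing[of "g - 1" g] by (simp add: dF_def)
  \<comment> \<open>Steep enough for the gain \<open>- M * dF\<close> between \<open>g - 1\<close>
    and \<open>g\<close> to outweigh the difference of the \<open>q\<close>-values, so that a point
    left of \<open>g\<close> wins.\<close>
  define M where "M = - (\<bar>q (g - 1) - q b0\<bar> + 1) / dF"
  have M: "M < 0" unfolding M_def using dF by (simp add: field_simps)
  have negM: "f1 M - f2 M < 0"
  proof -
    have "f1 M \<le> q (g - 1) - M * F (g - 1)" using at1[of M] by auto
    moreover obtain b where b: "b \<in> {g..\<beta>}" "f2 M = q b - M * F b" using at2[of M] by auto
    have "F g \<le> F b" using F_increasing[of g b] b by (cases "g = b") auto
    then have "M * F b \<le> M * F g" using M by (intro mult_left_mono_neg) auto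
    then have "f2 M \<ge> q b0 - M * F g" using b b0(2)[of b] by simp
    moreover have "M * F (g - 1) = M * F g - M * dF" by (simp add: dF_def algebra_simps)
    moreover have "M * dF = - (\<bar>q (g - 1) - q b0\<bar> + 1)" unfolding M_def using dF by simp
    ultimately show ?thesis by linarith
  qed
  obtain m where m: "M \<le> m" "m \<le> 0" "f1 m - f2 m = 0"
    using IVT'[of "\<lambda>m. f1 m - f2 m" M 0 0] negM pos0 M cont by force
  have m0: "m < 0" using m pos0 by (cases "m = 0") auto
  obtain a where a: "a \<le> g" "f1 m = q a - m * F a" "\<And>x. x \<le> g \<Longrightarrow> f1 m \<le> q x - m * F x" using at1[of m] by auto
  obtain b where b: "g \<le> b" "b \<le> \<beta>" "f2 m = q b - m * F b" "\<And>x. g \<le> x \<Longrightarrow> x \<le> \<beta> \<Longrightarrow> f2 m \<le> q x - m * F x" using at2[of m] by auto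
  have all: "f1 m \<le> q x - m * F x" if "x \<le> \<beta>" for x
    using a(3)[of x] b(4)[of x] m(3) that by (cases "x \<le> g") auto
  \<comment> \<open>No common minimiser lies in the concave piece; in particular neither contact
    point can be \<open>g\<close>.\<close>
  have notdown: False if y: "c \<le> y" "y \<le> g" "q y - m * F y = f1 m" for y
  proof (rule interior_min_not_concave[OF order(1) down y(1,2), of "\<beta> - g" m])
    show "q y - m * F y \<le> q x - m * F x" if "\<bar>x - y\<bar> < \<beta> - g" for x
      using all[of x] that y by auto
  qed (use \<beta> in simp)
  have ac: "a < c" using notdown[of a] a by fastforce
  have gb: "g < b"
  proof (rule ccontr)
    assume "\<not> g < b"
    then have "b = g" using b(1) by simp
    then show False using notdown[of b] b(3) m(3) order(1) by simp
  qed
  have Ha: "H a = m"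
    by (rule interior_min_slope[where d="\<beta> - a"]) (use all a(2) ac order \<beta> in auto)
  have H2: "H x < H y" if "g \<le> x" "x < y" "y \<le> d" for x y using strict_mono_onD[OF up2] that by simp
  \<comment> \<open>The slope at \<open>\<beta>\<close> is 0, which exceeds \<open>m\<close>, so
    \<open>q - m F\<close> still increases just before \<open>\<beta>\<close> and is not minimal
    there.\<close>
  have b\<beta>: "b < \<beta>"
  proof (rule ccontr)
    assume "\<not> b < \<beta>"
    then have b: "b = \<beta>" using b by simp
    obtain y where y: "g \<le> y" "y < \<beta>" "\<And>x. y < x \<Longrightarrow> x < \<beta> \<Longrightarrow> H x > m"
    proof -
      have "isCont H \<beta>" using H_cont by (simp add: continuous_on_eq_continuous_at)
      then have "((H) \<longlongrightarrow> 0) (at \<beta>)" using \<beta>(3) by (simp add: isCont_def)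
      then have "eventually (\<lambda>x. H x > m) (at \<beta>)" using m0 by (rule order_tendstoD(1))
      then obtain e where e: "e > 0" "\<And>x. x \<noteq> \<beta> \<Longrightarrow> dist x \<beta> < e \<Longrightarrow> H x > m" unfolding eventually_at by auto
      show ?thesis
        by (rule that[of "max g (\<beta> - e)"]) (use e \<beta> in \<open>auto simp: dist_real_def\<close>)
    qed
    have "q y - m * F y < q \<beta> - m * F \<beta>" by (rule tilt_increasing[OF y(2,3)])
    moreover have "q \<beta> - m * F \<beta> = f1 m" using b m \<open>f2 m = q b - m * F b\<close> by simp
    ultimately show False using all[of y] y by simp
  qed
  have Hb: "H b = m"
    by (rule interior_min_slope[where d="min (\<beta> - b) (b - g)"]) (use all b m gb b\<beta> in auto)
  have "f1 m < q x - m * F x" if x: "a < x" "x < b" for x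
  proof -
    consider "x \<le> c" | "c \<le> x" "x \<le> g" | "g \<le> x" by linarith
    then show ?thesis
    proof cases
      case 1
      have "q a - m * F a < q x - m * F x"
        by (rule tilt_increasing[OF x(1)]) (use strict_mono_onD[OF up1, of a] Ha 1 in auto)
      then show ?thesis using a by simp
    next
      case 2
      have "f1 m \<le> q x - m * F x" using all[of x] 2 \<beta> by simp
      moreover have "q x - m * F x \<noteq> f1 m" using notdown[OF 2] by blast
      ultimately show ?thesis by simp
    next
      case 3
      have "q b - m * F b < q x - m * F x"
        by (rule tilt_decreasing[OF x(2)]) (use H2[of _ b] Hb 3 b \<beta> in auto)
      then show ?thesis using b m by simp
    qed
  qed
  then show ?thesis using that[of m a b] m0 ac gb b\<beta> Ha Hb a b m by simp
qed

text \<open>The alternatives compare the two convex pieces: the left minimum is the lower or the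
  only one; both are equally low, so the horizontal line touches twice; the right minimum
  \<open>\<beta>\<close> is lower, and a common tangent from \<open>a\<close> to \<open>b\<close>
  bridges the hump.\<close>

lemma two_minima:
  assumes order: "c < g" "g < d"
    and up1: "strict_mono_on {..c} H" and down: "strict_antimono_on {c..g} H" and up2: "strict_mono_on {g..d} H"
    and pos: "\<And>x. x \<ge> d \<Longrightarrow> H x > 0" and F_pos: "\<And>x. F x > 0"
  shows "(\<exists>l<c. H l = 0 \<and> (\<forall>x<l. H x < 0) \<and> (\<forall>x>l. q l < q x))
    \<or> (\<exists>l \<beta>. l < c \<and> H l = 0 \<and> (\<forall>x<l. H x < 0) \<and> g < \<beta> \<and> \<beta> < d \<and> H \<beta> = 0 \<and> q l = q \<beta> \<and> (\<forall>x>l. x \<noteq> \<beta> \<longrightarrow> q l < q x))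
    \<or> (\<exists>m a b \<beta>. m < 0 \<and> a < c \<and> g < b \<and> b < \<beta> \<and> \<beta> < d \<and> H a = m \<and> H b = m \<and> H \<beta> = 0 \<and> q a - m * F a = q b - m * F b \<and>
        (\<forall>x<a. H x < m) \<and> (\<forall>x. b < x \<and> x < \<beta> \<longrightarrow> H x < 0) \<and>
        (\<forall>x. a < x \<and> x < b \<longrightarrow> q a - m * F a < q x - m * F x) \<and> (\<forall>x>\<beta>. q \<beta> < q x))"
proof -
  have less1: "H x < H y" if "x < y" "y \<le> c" for x y using strict_mono_onD[OF up1] that by simp
  have less2: "H y < H x" if "c \<le> x" "x < y" "y \<le> g" for x y
    using monotone_onD[OF down, of x y] that by simp
  have less3: "H x < H y" if "g \<le> x" "x < y" "y \<le> d" for x y using strict_mono_onD[OF up2] that by simp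
  have contH: "continuous_on A H" for A using continuous_on_subset[OF H_cont] by blast
  show ?thesis
  proof (cases "H g < 0")
    case False
    then have Hg: "H g \<ge> 0" by simp
    have Hc: "H c > 0" using less2[of c g] order Hg by simp
    obtain l where l: "l < c" "H l = 0" "\<And>x. x < l \<Longrightarrow> H x < 0" "\<And>x. l < x \<Longrightarrow> x \<le> c \<Longrightarrow> H x > 0"
      using H_zero[OF up1 Hc] by blast
    \<comment> \<open>\<open>H g = 0\<close> may happen, hence the exception at this single
      point.\<close>
    have Hpos: "H x > 0" if "l < x" "x \<noteq> g" for x
    proof -
      consider "x \<le> c" | "c < x" "x < g" | "g < x" "x \<le> d" | "d \<le> x" using \<open>x \<noteq> g\<close> by linarith
      then show ?thesis
      proof cases
        case 1 then show ?thesis using l(4) that by simp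
      next
        case 2 then show ?thesis using less2[of x g] Hg by simp
      next
        case 3 then show ?thesis using less3[of g x] Hg by simp
      next
        case 4 then show ?thesis using pos by simp
      qed
    qed
    have "q l < q x" if "l < x" for x
    proof (cases "x \<le> g")
      case True
      show ?thesis by (rule q_increasing[OF that]) (use Hpos True in auto)
    next
      case False
      have "q l < q g" by (rule q_increasing) (use Hpos l order in auto)
      also have "q g < q x" by (rule q_increasing) (use Hpos l order False in auto)
      finally show ?thesis .
    qed
    then show ?thesis using l by blast
  next
    case True
    obtain \<beta> where \<beta>: "g \<le> \<beta>" "\<beta> \<le> d" "H \<beta> = 0"
      using IVT'[of H g 0 d] True pos[of d] order contH by force
    have \<beta>': "g < \<beta>" "\<beta> < d" using \<beta> True pos[of d] by (auto simp: less_le)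
    have right: "q \<beta> < q x" if "\<beta> < x" for x
    proof (rule q_increasing[OF that])
      fix y assume "\<beta> < y"
      then show "H y > 0" using less3[of \<beta> y] \<beta> pos[of y] by (cases "y \<le> d") auto
    qed
    have mid: "q \<beta> < q x" if "g \<le> x" "x < \<beta>" for x
      by (rule q_decreasing[OF that(2)]) (use less3[of _ \<beta>] \<beta> that in auto)
    \<comment> \<open>What decides is whether the local minimum at \<open>\<beta>\<close> lies below
      the minimum over \<open>{..g}\<close>.\<close>
    obtain l0 where l0: "l0 \<le> g" "\<And>x. x \<le> g \<Longrightarrow> q l0 \<le> q x" using tilt_inf_attained[of g 0] by auto
    show ?thesis
    proof (cases "q \<beta> < q l0")
      case True
      then have below: "\<And>x. x \<le> g \<Longrightarrow> q \<beta> < q x" using l0 by fastforce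
      obtain m a b where mab: "m < 0" "a < c" "g < b" "b < \<beta>" "H a = m" "H b = m"
        "q a - m * F a = q b - m * F b" "\<And>x. a < x \<Longrightarrow> x < b \<Longrightarrow> q a - m * F a < q x - m * F x"
        using common_tangent[OF order up1 down up2 \<beta>'(1) \<beta>(2,3) below F_pos] by blast
      have "H x < m" if "x < a" for x using less1[of x a] mab that by simp
      moreover have "H x < 0" if "b < x" "x < \<beta>" for x using less3[of x \<beta>] \<beta> mab that by simp
      ultimately show ?thesis using mab \<beta>' \<beta>(3) right by blast
    next
      case False
      then have le: "q l0 \<le> q \<beta>" by simp
      have gmin: "q l0 \<le> q x" for x
      proof -
        consider "x \<le> g" | "g \<le> x" "x < \<beta>" | "x = \<beta>" | "\<beta> < x" by linarith
        then show ?thesis using l0(2)[of x] le mid[of x] right[of x] by cases auto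
      qed
      have l0c: "l0 < c"
      proof (rule ccontr)
        assume "\<not> l0 < c"
        then show False
          using interior_min_not_concave[OF order(1) down, of l0 1 0] l0 gmin by simp
      qed
      have Hl0: "H l0 = 0" by (rule interior_min_slope[where d=1]) (use gmin in auto)
      have neg: "H x < 0" if "x < l0" for x using less1[of x l0] l0c Hl0 that by simp
      have strict: "q l0 < q x" if x: "l0 < x" "x \<noteq> \<beta>" for x
      proof -
        consider "x \<le> c" | "c \<le> x" "x \<le> g" | "g < x" by linarith
        then show ?thesis
        proof cases
          case 1
          show ?thesis by (rule q_increasing[OF x(1)]) (use less1[of l0] Hl0 1 in auto)
        next
          case 2
          have "q x \<noteq> q l0"
          proof
            assume "q x = q l0"
            then show False using interior_min_not_concave[OF order(1) down 2, of 1 0] gmin by simp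
          qed
          then show ?thesis using gmin[of x] by simp
        next
          case 3
          then consider "g \<le> x" "x < \<beta>" | "\<beta> < x" using x(2) by linarith
          then show ?thesis using mid[of x] right[of x] le by cases auto
        qed
      qed
      show ?thesis
      proof (cases "q l0 = q \<beta>")
        case True
        then show ?thesis using l0c Hl0 neg \<beta>' \<beta>(3) strict by blast
      next
        case False
        then have "q l0 < q x" if "l0 < x" for x using strict[of x] le that by (cases "x = \<beta>") auto
        then show ?thesis using l0c Hl0 neg by blast
      qed
    qed
  qed
qed

end

section \<open>The ordinary differential equation\<close>

locale ou_fundamental = ou_parameters \<theta> \<mu> \<sigma> lam for \<theta> \<mu> \<sigma> lam :: real +
  fixes \<psi> :: "real \<Rightarrow> real"
  assumes fund: "increasing_fundamental_solution \<theta> \<mu> \<sigma> lam \<psi>"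
begin

text \<open>That is, \<open>(\<bbbL>\<^sub>X - \<lambda>) u = h\<close> off the finite set \<open>S\<close>.\<close>

definition solves :: "(real \<Rightarrow> real) \<Rightarrow> real set \<Rightarrow> (real \<Rightarrow> real) \<Rightarrow> (real \<Rightarrow> real) \<Rightarrow> bool" where
  "solves h S u u1 \<longleftrightarrow> finite S \<and> (\<forall>x. (u has_real_derivative u1 x) (at x)) \<and> continuous_on UNIV u1 \<and>
     (\<forall>x. x \<notin> S \<longrightarrow> (u1 has_real_derivative 2 / \<sigma>\<^sup>2 * (lam * u x - \<theta> * (\<mu> - x) * u1 x + h x)) (at x))"

lemma solvesD:
  assumes "solves h S u u1"
  shows "finite S" "(u has_real_derivative u1 x) (at x)" "continuous_on A u1" "continuous_on A u"
    "x \<notin> S \<Longrightarrow> (u1 has_real_derivative 2 / \<sigma>\<^sup>2 * (lam * u x - \<theta> * (\<mu> - x) * u1 x + h x)) (at x)"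
  using assms DERIV_continuous_on[OF has_field_derivative_at_within, of A u u1] unfolding solves_def
  by (auto intro: continuous_on_subset)

definition \<psi>1 :: "real \<Rightarrow> real" where "\<psi>1 = deriv \<psi>"

definition \<phi> :: "real \<Rightarrow> real" where "\<phi> x = \<psi> (2 * \<mu> - x)"

definition \<phi>1 :: "real \<Rightarrow> real" where "\<phi>1 x = - \<psi>1 (2 * \<mu> - x)"

lemma psi_pos: "\<psi> x > 0" and psi_mono: "strict_mono \<psi>"
  using fund unfolding increasing_fundamental_solution_def by auto

lemma phi_pos: "\<phi> x > 0"
  by (simp add: \<phi>_def psi_pos)

lemma psi_DERIV: "(\<psi> has_real_derivative \<psi>1 x) (at x)"
  using fund unfolding increasing_fundamental_solution_def \<psi>1_def by (simp add: DERIV_deriv_iff_field_differentiable)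

lemma psi1_DERIV: "(\<psi>1 has_real_derivative 2 / \<sigma>\<^sup>2 * (lam * \<psi> x - \<theta> * (\<mu> - x) * \<psi>1 x)) (at x)"
proof -
  have d: "(\<psi>1 has_real_derivative deriv \<psi>1 x) (at x)"
    using fund unfolding increasing_fundamental_solution_def \<psi>1_def by (simp add: DERIV_deriv_iff_field_differentiable)
  have "1 / 2 * \<sigma>\<^sup>2 * deriv \<psi>1 x + \<theta> * (\<mu> - x) * \<psi>1 x = lam * \<psi> x"
    using fund unfolding increasing_fundamental_solution_def OU_generator_def \<psi>1_def by simp
  then have "deriv \<psi>1 x = 2 / \<sigma>\<^sup>2 * (lam * \<psi> x - \<theta> * (\<mu> - x) * \<psi>1 x)"
    using pos by (simp add: field_simps)
  then show ?thesis using d by simp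
qed

lemma solves_psi: "solves (\<lambda>_. 0) {} \<psi> \<psi>1"
  unfolding solves_def
  using psi_DERIV psi1_DERIV DERIV_continuous_on[OF has_field_derivative_at_within[OF psi1_DERIV]] by auto

lemma solves_phi: "solves (\<lambda>_. 0) {} \<phi> \<phi>1"
proof -
  have r: "((\<lambda>x. 2 * \<mu> - x) has_real_derivative - 1) (at x)" for x by (auto intro!: derivative_eq_intros)
  have 1: "(\<phi> has_real_derivative \<phi>1 x) (at x)" for x
    unfolding \<phi>_def[abs_def] \<phi>1_def using DERIV_chain2[OF psi_DERIV r, of x] by simp
  have 2: "(\<phi>1 has_real_derivative 2 / \<sigma>\<^sup>2 * (lam * \<phi> x - \<theta> * (\<mu> - x) * \<phi>1 x)) (at x)" for x
    unfolding \<phi>_def[abs_def] \<phi>1_def[abs_def] using DERIV_minus[OF DERIV_chain2[OF psi1_DERIV r, of x]]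
    by (simp add: algebra_simps)
  show ?thesis unfolding solves_def
    using 1 2 DERIV_continuous_on[OF has_field_derivative_at_within[OF 2]] by auto
qed

section \<open>Linear combinations and gluing of solutions\<close>

lemma solves_lincomb:
  assumes u: "solves h S u u1" and v: "solves g T v v1"
  shows "solves (\<lambda>x. a * h x + b * g x) (S \<union> T) (\<lambda>x. a * u x + b * v x) (\<lambda>x. a * u1 x + b * v1 x)"
  unfolding solves_def
proof (intro conjI allI impI)
  show "finite (S \<union> T)" using solvesD(1)[OF u] solvesD(1)[OF v] by simp
  show "continuous_on UNIV (\<lambda>x. a * u1 x + b * v1 x)" by (intro continuous_intros solvesD[OF u] solvesD[OF v])
  fix x
  show "((\<lambda>x. a * u x + b * v x) has_real_derivative a * u1 x + b * v1 x) (at x)"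
    by (auto intro!: derivative_eq_intros solvesD(2)[OF u] solvesD(2)[OF v])
  assume "x \<notin> S \<union> T"
  then have "((\<lambda>x. a * u1 x + b * v1 x) has_real_derivative
     a * (2 / \<sigma>\<^sup>2 * (lam * u x - \<theta> * (\<mu> - x) * u1 x + h x)) + b * (2 / \<sigma>\<^sup>2 * (lam * v x - \<theta> * (\<mu> - x) * v1 x + g x))) (at x)"
    by (intro DERIV_add DERIV_cmult solvesD(5)[OF u] solvesD(5)[OF v]) auto
  moreover have "a * (2 / \<sigma>\<^sup>2 * (lam * u x - \<theta> * (\<mu> - x) * u1 x + h x)) + b * (2 / \<sigma>\<^sup>2 * (lam * v x - \<theta> * (\<mu> - x) * v1 x + g x))
    = 2 / \<sigma>\<^sup>2 * (lam * (a * u x + b * v x) - \<theta> * (\<mu> - x) * (a * u1 x + b * v1 x) + (a * h x + b * g x))"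
    by (simp only: algebra_simps)
  ultimately show "((\<lambda>x. a * u1 x + b * v1 x) has_real_derivative
      2 / \<sigma>\<^sup>2 * (lam * (a * u x + b * v x) - \<theta> * (\<mu> - x) * (a * u1 x + b * v1 x) + (a * h x + b * g x))) (at x)"
    by (simp only:)
qed

lemma solves_affine: "solves (\<lambda>x. \<theta> * (\<mu> - x) * a - lam * (a * x + b)) {} (\<lambda>x. a * x + b) (\<lambda>_. a)"
  unfolding solves_def by (auto intro!: derivative_eq_intros continuous_intros)

lemma DERIV_glue:
  fixes f g f1 g1 :: "real \<Rightarrow> real"
  assumes f: "(f has_real_derivative f1 x) (at x)" and g: "(g has_real_derivative g1 x) (at x)"
    and eq: "x = c \<Longrightarrow> f c = g c" "x = c \<Longrightarrow> f1 c = g1 c"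
  shows "((\<lambda>x. if x \<le> c then f x else g x) has_real_derivative (if x \<le> c then f1 x else g1 x)) (at x)"
proof -
  consider "x < c" | "x > c" | "x = c" by linarith
  then show ?thesis
  proof cases
    case 1
    have "((\<lambda>x. if x \<le> c then f x else g x) has_real_derivative f1 x) (at x)"
      by (rule has_field_derivative_transform_within_open[OF f open_lessThan[of c]]) (use 1 in auto)
    then show ?thesis using 1 by simp
  next
    case 2
    have "((\<lambda>x. if x \<le> c then f x else g x) has_real_derivative g1 x) (at x)"
      by (rule has_field_derivative_transform_within_open[OF g open_greaterThan[of c]]) (use 2 in auto)
    then show ?thesis using 2 by simp
  next
    case 3
    have "((\<lambda>x. if x \<in> {..c} then f x else g x) has_vector_derivative f1 c) (at c within {..c} \<union> {c..})"
      using has_vector_derivative_If_within_closures[of c "{..c}" "{c..}" "{..c} \<union> {c..}" f "\<lambda>_. f1 c" g "\<lambda>_. g1 c"] f g eq 3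
      by (auto simp: has_real_derivative_iff_has_vector_derivative[symmetric] closure_closed intro: has_field_derivative_at_within has_vector_derivative_at_within)
    moreover have "{..c} \<union> {c..} = UNIV" by auto
    ultimately show ?thesis using 3 by (simp add: has_real_derivative_iff_has_vector_derivative)
  qed
qed

lemma solves_glue:
  assumes u: "solves h S u u1" and v: "solves g T v v1" and eq: "u c = v c" "u1 c = v1 c"
  shows "solves (\<lambda>x. if x \<le> c then h x else g x) (S \<union> T \<union> {c}) (\<lambda>x. if x \<le> c then u x else v x) (\<lambda>x. if x \<le> c then u1 x else v1 x)"
  unfolding solves_def
proof (intro conjI allI impI)
  show "finite (S \<union> T \<union> {c})" using solvesD(1)[OF u] solvesD(1)[OF v] by simp
  have glue: "(\<lambda>x. if x \<le> c then u1 x else v1 x) = (\<lambda>x. u1 (min x c) + v1 (max x c) - u1 c)"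
    using eq by (auto simp: fun_eq_iff min_def max_def)
  show "continuous_on UNIV (\<lambda>x. if x \<le> c then u1 x else v1 x)"
    unfolding glue by (auto intro!: continuous_intros continuous_on_compose2[OF solvesD(3)[OF u, of UNIV]] continuous_on_compose2[OF solvesD(3)[OF v, of UNIV]])
  fix x
  show "((\<lambda>x. if x \<le> c then u x else v x) has_real_derivative (if x \<le> c then u1 x else v1 x)) (at x)"
    by (rule DERIV_glue[where f=u and g=v and ?f1.0=u1 and ?g1.0=v1]) (use solvesD(2)[OF u] solvesD(2)[OF v] eq in auto)
  assume x: "x \<notin> S \<union> T \<union> {c}"
  have "((\<lambda>x. if x \<le> c then u1 x else v1 x) has_real_derivative
     (if x \<le> c then 2 / \<sigma>\<^sup>2 * (lam * u x - \<theta> * (\<mu> - x) * u1 x + h x) else 2 / \<sigma>\<^sup>2 * (lam * v x - \<theta> * (\<mu> - x) * v1 x + g x))) (at x)"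
    by (rule DERIV_glue) (use x solvesD(5)[OF u] solvesD(5)[OF v] in auto)
  then show "((\<lambda>x. if x \<le> c then u1 x else v1 x) has_real_derivative
      2 / \<sigma>\<^sup>2 * (lam * (if x \<le> c then u x else v x) - \<theta> * (\<mu> - x) * (if x \<le> c then u1 x else v1 x) + (if x \<le> c then h x else g x))) (at x)"
    by (cases "x \<le> c") simp_all
qed

section \<open>Growth of the fundamental solutions\<close>

lemma psi1_nonneg: "\<psi>1 x \<ge> 0"
proof (rule ccontr)
  assume "\<not> \<psi>1 x \<ge> 0"
  then obtain d where d: "d > 0" "\<And>h. 0 < h \<Longrightarrow> h < d \<Longrightarrow> \<psi> (x + h) < \<psi> x"
    using DERIV_neg_dec_right[OF psi_DERIV[of x]] by auto
  then have "\<psi> (x + d / 2) < \<psi> x" by simp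
  moreover have "\<psi> x < \<psi> (x + d / 2)" using strict_monoD[OF psi_mono, of x "x + d / 2"] d by simp
  ultimately show False by simp
qed

lemma psi_le: "x \<le> y \<Longrightarrow> \<psi> x \<le> \<psi> y"
  using psi_mono by (simp add: strict_mono_less_eq)

text \<open>Were the derivative above this threshold at some point left of \<open>\<mu> - 1\<close>,
  the equation would make it at least as large at all points further left, and the positive function
  \<open>\<psi>\<close> would have to become negative.\<close>

lemma psi1_bounded_left:
  assumes "x \<le> \<mu> - 1" shows "\<psi>1 x \<le> lam * \<psi> \<mu> / \<theta>"
proof (rule ccontr)
  assume "\<not> \<psi>1 x \<le> lam * \<psi> \<mu> / \<theta>"
  then have big: "\<psi>1 x > lam * \<psi> \<mu> / \<theta>" by simp
  \<comment> \<open>Here \<open>\<mu> - z \<ge> 1\<close>, so above the threshold the drift term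
    dominates \<open>lam * \<psi> z\<close>.\<close>
  have dec: "2 / \<sigma>\<^sup>2 * (lam * \<psi> z - \<theta> * (\<mu> - z) * \<psi>1 z) < 0" if z: "z \<le> \<mu> - 1" "\<psi>1 z > lam * \<psi> \<mu> / \<theta>" for z
  proof -
    have "lam * \<psi> z \<le> lam * \<psi> \<mu>" using psi_le[of z \<mu>] z pos by simp
    also have "\<dots> < \<theta> * \<psi>1 z" using z(2) pos by (simp add: field_simps)
    also have "\<dots> \<le> \<theta> * (\<mu> - z) * \<psi>1 z"
      using mult_right_mono[of 1 "\<mu> - z" "\<theta> * \<psi>1 z"] z pos psi1_nonneg[of z] by (simp add: mult_ac)
    finally show ?thesis using pos by (simp add: mult_pos_neg divide_less_0_iff)
  qed
  have ge: "\<psi>1 y \<ge> \<psi>1 x" if y: "y \<le> x" for y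
  proof -
    have "continuous_on {y..x} \<psi>1" by (rule solvesD(3)[OF solves_psi])
    then obtain m where m: "m \<in> {y..x}" "\<And>z. z \<in> {y..x} \<Longrightarrow> \<psi>1 z \<le> \<psi>1 m"
      using continuous_attains_sup[OF compact_Icc, of y x \<psi>1] y by auto
    have mx: "\<psi>1 m \<ge> \<psi>1 x" using m(2)[of x] y by simp
    \<comment> \<open>At any other maximiser the function is strictly decreasing, so a larger value
      would lie to its left.\<close>
    have "m = y"
    proof (rule ccontr)
      assume "m \<noteq> y"
      then have my: "m > y" using m by simp
      obtain d where d: "d > 0" "\<And>h. 0 < h \<Longrightarrow> h < d \<Longrightarrow> \<psi>1 m < \<psi>1 (m - h)"
        using DERIV_neg_dec_left[OF psi1_DERIV[of m] dec] mx big m assms by auto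
      define h where "h = min (d / 2) (m - y)"
      have "0 < h" "h < d" "m - h \<in> {y..x}" using d my m by (auto simp: h_def)
      then show False using d(2)[of h] m(2)[of "m - h"] by simp
    qed
    then show ?thesis using mx by simp
  qed
  have p: "\<psi>1 x > 0"
    using big divide_pos_pos[OF mult_pos_pos[OF pos(3) psi_pos[of \<mu>]] pos(1)] by linarith
  \<comment> \<open>At \<open>y\<close>, the tangent of \<open>\<psi>\<close> at \<open>x\<close>
    has the value \<open>- \<psi>1 x\<close>; the \<open>+ 1\<close> makes it strictly
    negative.\<close>
  define y where "y = x - (\<psi> x / \<psi>1 x + 1)"
  have yx: "y < x" using divide_pos_pos[OF psi_pos[of x] p] by (simp add: y_def)
  obtain z where z: "y < z" "z < x" "\<psi> x - \<psi> y = (x - y) * \<psi>1 z"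
    using MVT2[OF yx, of \<psi> \<psi>1] psi_DERIV by blast
  have "(x - y) * \<psi>1 x \<le> (x - y) * \<psi>1 z" using ge[of z] z yx by (intro mult_left_mono) auto
  moreover have "(x - y) * \<psi>1 x = \<psi> x + \<psi>1 x" using p by (simp add: y_def field_simps)
  ultimately have "\<psi> y \<le> - \<psi>1 x" using z by simp
  then show False using psi_pos[of y] p by simp
qed

lemma psi1_bounded: "\<exists>C. \<forall>x\<le>b. \<psi>1 x \<le> C"
proof -
  have "compact (\<psi>1 ` {\<mu> - 1..b})" by (intro compact_continuous_image solvesD(3)[OF solves_psi] compact_Icc)
  then obtain C where C: "\<And>x. x \<in> {\<mu> - 1..b} \<Longrightarrow> \<bar>\<psi>1 x\<bar> \<le> C"
    using compact_imp_bounded[of "\<psi>1 ` {\<mu> - 1..b}"] unfolding bounded_iff by fastforce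
  have "\<psi>1 x \<le> max C (lam * \<psi> \<mu> / \<theta>)" if "x \<le> b" for x
    using C[of x] psi1_bounded_left[of x] that by (cases "x \<le> \<mu> - 1") auto
  then show ?thesis by blast
qed

text \<open>To the right of \<open>\<mu>\<close> the drift term only adds to the second derivative
  and \<open>\<psi>\<close> is at least \<open>\<psi> \<mu>\<close>, so the second derivative has a
  positive lower bound, to be integrated twice.\<close>

lemma psi_quadratic_growth:
  assumes "x \<ge> \<mu>" shows "\<psi> x \<ge> lam * \<psi> \<mu> / \<sigma>\<^sup>2 * (x - \<mu>)\<^sup>2"
proof -
  define k where "k = 2 * lam * \<psi> \<mu> / \<sigma>\<^sup>2"
  have g1: "\<psi>1 y \<ge> k * (y - \<mu>)" if y: "y \<ge> \<mu>" for y
  proof -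
    have "\<psi>1 \<mu> - k * (\<mu> - \<mu>) \<le> \<psi>1 y - k * (y - \<mu>)"
    proof (rule DERIV_nonneg_imp_nondecreasing[OF y])
      fix z assume z: "\<mu> \<le> z"
      have "k \<le> 2 / \<sigma>\<^sup>2 * (lam * \<psi> z - \<theta> * (\<mu> - z) * \<psi>1 z)"
      proof -
        have "lam * \<psi> \<mu> \<le> lam * \<psi> z" using psi_le[OF z] pos by simp
        moreover have "\<theta> * (z - \<mu>) * \<psi>1 z \<ge> 0" using pos z psi1_nonneg by simp
        ultimately have "lam * \<psi> \<mu> \<le> lam * \<psi> z - \<theta> * (\<mu> - z) * \<psi>1 z" by (simp add: algebra_simps)
        then have "2 / \<sigma>\<^sup>2 * (lam * \<psi> \<mu>) \<le> 2 / \<sigma>\<^sup>2 * (lam * \<psi> z - \<theta> * (\<mu> - z) * \<psi>1 z)"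
          by (intro mult_left_mono) auto
        then show ?thesis by (simp add: k_def)
      qed
      moreover have "((\<lambda>z. \<psi>1 z - k * (z - \<mu>)) has_real_derivative 2 / \<sigma>\<^sup>2 * (lam * \<psi> z - \<theta> * (\<mu> - z) * \<psi>1 z) - k) (at z)"
        by (auto intro!: derivative_eq_intros psi1_DERIV)
      ultimately show "\<exists>d. ((\<lambda>z. \<psi>1 z - k * (z - \<mu>)) has_real_derivative d) (at z) \<and> 0 \<le> d" by (metis diff_ge_0_iff_ge)
    qed
    then show ?thesis using psi1_nonneg[of \<mu>] by simp
  qed
  have "\<psi> \<mu> - k / 2 * (\<mu> - \<mu>)\<^sup>2 \<le> \<psi> x - k / 2 * (x - \<mu>)\<^sup>2"
  proof (rule DERIV_nonneg_imp_nondecreasing[OF assms])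
    fix z assume "\<mu> \<le> z"
    moreover have "((\<lambda>z. \<psi> z - k / 2 * (z - \<mu>)\<^sup>2) has_real_derivative \<psi>1 z - k * (z - \<mu>)) (at z)"
      by (auto intro!: derivative_eq_intros psi_DERIV)
    ultimately show "\<exists>d. ((\<lambda>z. \<psi> z - k / 2 * (z - \<mu>)\<^sup>2) has_real_derivative d) (at z) \<and> 0 \<le> d"
      using g1 by (metis diff_ge_0_iff_ge)
  qed
  then show ?thesis using psi_pos[of \<mu>] by (simp add: k_def)
qed

lemma phi1_nonpos: "\<phi>1 x \<le> 0"
  by (simp add: \<phi>1_def psi1_nonneg)

lemma phi_quadratic_growth: "x \<le> \<mu> \<Longrightarrow> \<phi> x \<ge> lam * \<psi> \<mu> / \<sigma>\<^sup>2 * (\<mu> - x)\<^sup>2"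
  using psi_quadratic_growth[of "2 * \<mu> - x"] by (simp add: \<phi>_def)

lemma phi_le: "x \<le> y \<Longrightarrow> \<phi> y \<le> \<phi> x"
  by (simp add: \<phi>_def psi_le)

lemma phi1_bounded: "\<exists>C. \<forall>x\<ge>b. \<bar>\<phi>1 x\<bar> \<le> C"
proof -
  obtain C where C: "\<forall>x\<le>2 * \<mu> - b. \<psi>1 x \<le> C" using psi1_bounded by blast
  then have "\<bar>\<phi>1 x\<bar> \<le> C" if "b \<le> x" for x using that psi1_nonneg[of "2 * \<mu> - x"] by (simp add: \<phi>1_def)
  then show ?thesis by blast
qed

section \<open>Scale density, Wronskian and slope with respect to the scale\<close>

definition scale :: "real \<Rightarrow> real" where "scale x = exp (\<theta> * (x - \<mu>)\<^sup>2 / \<sigma>\<^sup>2)"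

lemma scale_pos: "scale x > 0" by (simp add: scale_def)

lemma scale_DERIV: "(scale has_real_derivative 2 * \<theta> * (x - \<mu>) / \<sigma>\<^sup>2 * scale x) (at x)"
  unfolding scale_def[abs_def] using pos by (auto intro!: derivative_eq_intros simp: field_simps)

definition wronskian :: "(real \<Rightarrow> real) \<Rightarrow> (real \<Rightarrow> real) \<Rightarrow> real \<Rightarrow> real" where
  "wronskian u u1 x = (u1 x * \<phi> x - u x * \<phi>1 x) / scale x"

text \<open>Dividing by the scale density of the diffusion cancels the first-order terms, so the
  Wronskian with \<open>\<phi>\<close> is driven by \<open>h\<close> alone and is constant for
  homogeneous solutions.\<close>

lemma wronskian_DERIV:
  assumes u: "solves h S u u1" and x: "x \<notin> S"
  shows "(wronskian u u1 has_real_derivative 2 / \<sigma>\<^sup>2 * \<phi> x * h x / scale x) (at x)"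
proof -
  let ?k = "2 / \<sigma>\<^sup>2"
  let ?u2 = "?k * (lam * u x - \<theta> * (\<mu> - x) * u1 x + h x)"
  let ?p2 = "?k * (lam * \<phi> x - \<theta> * (\<mu> - x) * \<phi>1 x)"
  have p2: "(\<phi>1 has_real_derivative ?p2) (at x)" using solvesD(5)[OF solves_phi, of x] by simp
  have "(wronskian u u1 has_real_derivative
     ((?u2 * \<phi> x + \<phi>1 x * u1 x - (u1 x * \<phi>1 x + ?p2 * u x)) * scale x - (u1 x * \<phi> x - u x * \<phi>1 x) * (2 * \<theta> * (x - \<mu>) / \<sigma>\<^sup>2 * scale x)) / (scale x * scale x)) (at x)"
    unfolding wronskian_def[abs_def]
    by (intro DERIV_divide DERIV_diff DERIV_mult solvesD(5)[OF u x] solvesD(2)[OF u] solvesD(2)[OF solves_phi] p2 scale_DERIV)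
      (use scale_pos[of x] in simp)
  moreover have "((?u2 * \<phi> x + \<phi>1 x * u1 x - (u1 x * \<phi>1 x + ?p2 * u x)) * scale x - (u1 x * \<phi> x - u x * \<phi>1 x) * (2 * \<theta> * (x - \<mu>) / \<sigma>\<^sup>2 * scale x)) / (scale x * scale x)
     = 2 / \<sigma>\<^sup>2 * \<phi> x * h x / scale x"
  proof -
    have "(k * (lam * U - M * U1 + h) * P + P1 * U1 - (U1 * P1 + k * (lam * P - M * P1) * U)) * s - (U1 * P - U * P1) * (k * (- M) * s) = k * P * h * s"
      for k U U1 P P1 M s h :: real by (simp add: algebra_simps)
    from this[of ?k "u x" "\<theta> * (\<mu> - x)" "u1 x" "h x" "\<phi> x" "\<phi>1 x" "scale x"]
    have "(?u2 * \<phi> x + \<phi>1 x * u1 x - (u1 x * \<phi>1 x + ?p2 * u x)) * scale x - (u1 x * \<phi> x - u x * \<phi>1 x) * (?k * (- (\<theta> * (\<mu> - x))) * scale x)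
      = ?k * \<phi> x * h x * scale x" .
    moreover have "?k * (- (\<theta> * (\<mu> - x))) = 2 * \<theta> * (x - \<mu>) / \<sigma>\<^sup>2" by (simp add: algebra_simps)
    ultimately have "(?u2 * \<phi> x + \<phi>1 x * u1 x - (u1 x * \<phi>1 x + ?p2 * u x)) * scale x - (u1 x * \<phi> x - u x * \<phi>1 x) * (2 * \<theta> * (x - \<mu>) / \<sigma>\<^sup>2 * scale x)
      = ?k * \<phi> x * h x * scale x" by (simp only:)
    then show ?thesis using scale_pos[of x] by simp
  qed
  ultimately show ?thesis by simp
qed

lemma wronskian_cont:
  assumes u: "solves h S u u1" shows "continuous_on A (wronskian u u1)"
proof -
  have "continuous_on A scale" using DERIV_continuous_on[OF has_field_derivative_at_within[OF scale_DERIV]] .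
  then show ?thesis unfolding wronskian_def[abs_def]
    by (intro continuous_intros solvesD[OF u] solvesD[OF solves_phi]) (use scale_pos in \<open>auto simp: less_imp_neq[symmetric]\<close>)
qed

definition w :: real where "w = wronskian \<psi> \<psi>1 0"

lemma wronskian_psi: "wronskian \<psi> \<psi>1 x = w"
proof -
  have "(wronskian \<psi> \<psi>1 has_real_derivative 0) (at x)" for x
    using wronskian_DERIV[OF solves_psi, of x] by simp
  then show ?thesis unfolding w_def using DERIV_isconst_all by blast
qed

lemma w_scale: "w * scale x = \<psi>1 x * \<phi> x - \<psi> x * \<phi>1 x"
  using wronskian_psi[of x] scale_pos[of x] unfolding wronskian_def by (simp add: field_simps)

text \<open>Both contributions to the Wronskian are nonnegative; if it vanished, the derivative of
  \<open>\<psi>\<close> would vanish everywhere, against strict monotonicity.\<close>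

lemma w_pos: "w > 0"
proof -
  have "w \<ge> 0"
  proof -
    have "\<psi> 0 * \<phi>1 0 \<le> 0" using psi_pos[of 0] phi1_nonpos[of 0] by (simp add: mult_le_0_iff)
    moreover have "\<psi>1 0 * \<phi> 0 \<ge> 0" using psi1_nonneg[of 0] phi_pos[of 0] by simp
    ultimately show ?thesis unfolding w_def wronskian_def using scale_pos[of 0] by (intro divide_nonneg_pos) auto
  qed
  moreover have "w \<noteq> 0"
  proof
    assume "w = 0"
    have "\<psi>1 x = 0" for x
    proof -
      have "\<psi>1 x * \<phi> x = \<psi> x * \<phi>1 x" using w_scale[of x] \<open>w = 0\<close> by simp
      moreover have "\<psi> x * \<phi>1 x \<le> 0" using psi_pos[of x] phi1_nonpos[of x] by (simp add: mult_le_0_iff)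
      moreover have "\<psi>1 x * \<phi> x \<ge> 0" using psi1_nonneg[of x] phi_pos[of x] by simp
      ultimately have "\<psi>1 x * \<phi> x = 0" by linarith
      then show ?thesis using phi_pos[of x] by simp
    qed
    then have "\<psi> 0 = \<psi> 1" using DERIV_isconst_all[of \<psi> 0 1] psi_DERIV by simp
    then show False using strict_monoD[OF psi_mono, of 0 1] by simp
  qed
  ultimately show ?thesis by simp
qed

definition F :: "real \<Rightarrow> real" where "F x = \<psi> x / \<phi> x"

definition F' :: "real \<Rightarrow> real" where "F' x = w * scale x / (\<phi> x)\<^sup>2"

lemma F_pos: "F x > 0" by (simp add: F_def psi_pos phi_pos)

lemma F'_pos: "F' x > 0" using w_pos scale_pos[of x] phi_pos[of x] by (simp add: F'_def)

text \<open>This makes \<open>wronskian u u1 x / w\<close> the slope of \<open>u / \<phi>\<close> as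
  a function of \<open>F\<close>; convexity in the scale is thereby read off the sign of
  \<open>h\<close>.\<close>

lemma quotient_DERIV:
  assumes u: "solves h S u u1"
  shows "((\<lambda>x. u x / \<phi> x) has_real_derivative wronskian u u1 x / w * F' x) (at x)"
proof -
  have "((\<lambda>x. u x / \<phi> x) has_real_derivative (u1 x * \<phi> x - u x * \<phi>1 x) / (\<phi> x * \<phi> x)) (at x)"
    by (intro DERIV_divide solvesD(2)[OF u] solvesD(2)[OF solves_phi]) (use phi_pos[of x] in simp)
  moreover have "(u1 x * \<phi> x - u x * \<phi>1 x) / (\<phi> x * \<phi> x) = wronskian u u1 x / w * F' x"
    unfolding wronskian_def F'_def using w_pos scale_pos[of x] phi_pos[of x] by (simp add: field_simps power2_eq_square)
  ultimately show ?thesis by simp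
qed

lemma F_DERIV: "(F has_real_derivative F' x) (at x)"
  using quotient_DERIV[OF solves_psi, of x] w_pos unfolding F_def[abs_def] by (simp add: wronskian_psi)

lemma F_at_bot: "(F \<longlongrightarrow> 0) at_bot"
proof (rule Lim_null_comparison)
  define k where "k = lam * \<psi> \<mu> / \<sigma>\<^sup>2"
  have k: "k > 0" using pos psi_pos[of \<mu>] by (simp add: k_def)
  show "\<forall>\<^sub>F x in at_bot. norm (F x) \<le> \<psi> \<mu> / (k * (\<mu> - x)\<^sup>2)"
  proof (rule eventually_mono[OF eventually_le_at_bot[of "\<mu> - 1"]])
    fix x assume x: "x \<le> \<mu> - 1"
    have pg: "k * (\<mu> - x)\<^sup>2 \<le> \<phi> x" using phi_quadratic_growth[of x] x by (simp add: k_def)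
    have pk: "k * (\<mu> - x)\<^sup>2 > 0" using k x by simp
    have "\<psi> x / \<phi> x \<le> \<psi> \<mu> / (k * (\<mu> - x)\<^sup>2)"
      using psi_le[of x \<mu>] pg pk x psi_pos[of \<mu>] by (intro frac_le) (auto simp: less_imp_le)
    then show "norm (F x) \<le> \<psi> \<mu> / (k * (\<mu> - x)\<^sup>2)" using F_pos[of x] by (simp add: F_def)
  qed
  show "((\<lambda>x. \<psi> \<mu> / (k * (\<mu> - x)\<^sup>2)) \<longlongrightarrow> 0) at_bot" using k by real_asymp
qed

text \<open>Linear growth of \<open>u\<close> loses against the at least quadratic growth of
  \<open>\<phi>\<close>.\<close>

lemma quotient_at_bot:
  assumes "\<And>x. \<bar>u x\<bar> \<le> C * (1 + \<bar>x\<bar>)"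
  shows "((\<lambda>x. u x / \<phi> x) \<longlongrightarrow> 0) at_bot"
proof (rule Lim_null_comparison)
  define k where "k = lam * \<psi> \<mu> / \<sigma>\<^sup>2"
  have k: "k > 0" using pos psi_pos[of \<mu>] by (simp add: k_def)
  have C: "C \<ge> 0" using assms[of 0] by simp
  show "\<forall>\<^sub>F x in at_bot. norm (u x / \<phi> x) \<le> C * (1 - x) / (k * (\<mu> - x)\<^sup>2)"
  proof (rule eventually_mono[OF eventually_le_at_bot[of "min 0 (\<mu> - 1)"]])
    fix x assume x: "x \<le> min 0 (\<mu> - 1)"
    have pg: "k * (\<mu> - x)\<^sup>2 \<le> \<phi> x" using phi_quadratic_growth[of x] x by (simp add: k_def)
    have pk: "k * (\<mu> - x)\<^sup>2 > 0" using k x by simp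
    have "\<bar>u x\<bar> / \<phi> x \<le> C * (1 - x) / (k * (\<mu> - x)\<^sup>2)"
      using assms[of x] pg pk x C by (intro frac_le) auto
    then show "norm (u x / \<phi> x) \<le> C * (1 - x) / (k * (\<mu> - x)\<^sup>2)" using phi_pos[of x] by (simp add: abs_of_pos)
  qed
  show "((\<lambda>x. C * (1 - x) / (k * (\<mu> - x)\<^sup>2)) \<longlongrightarrow> 0) at_bot" using k by real_asymp
qed

lemma wronskian_increasing:
  assumes u: "solves h S u u1" and ab: "a < b" and S: "\<And>x. x \<in> S \<Longrightarrow> x \<le> a \<or> b \<le> x"
    and h: "\<And>x. a < x \<Longrightarrow> x < b \<Longrightarrow> h x > 0"
  shows "wronskian u u1 a / w < wronskian u u1 b / w"
proof -
  have "wronskian u u1 a < wronskian u u1 b"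
  proof (rule DERIV_pos_imp_increasing_open[OF ab])
    fix x assume x: "a < x" "x < b"
    then have "x \<notin> S" using S by force
    moreover have "2 / \<sigma>\<^sup>2 * \<phi> x * h x / scale x > 0" using h[OF x] phi_pos[of x] scale_pos[of x] pos by simp
    ultimately show "\<exists>y. (wronskian u u1 has_real_derivative y) (at x) \<and> 0 < y" using wronskian_DERIV[OF u] by blast
  qed (rule wronskian_cont[OF u])
  then show ?thesis using w_pos by (simp add: divide_strict_right_mono)
qed

lemma wronskian_decreasing:
  assumes u: "solves h S u u1" and ab: "a < b" and S: "\<And>x. x \<in> S \<Longrightarrow> x \<le> a \<or> b \<le> x"
    and h: "\<And>x. a < x \<Longrightarrow> x < b \<Longrightarrow> h x < 0"
  shows "wronskian u u1 b / w < wronskian u u1 a / w"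
proof -
  have "wronskian u u1 b < wronskian u u1 a"
  proof (rule DERIV_neg_imp_decreasing_open[OF ab])
    fix x assume x: "a < x" "x < b"
    then have "x \<notin> S" using S by force
    moreover have "2 / \<sigma>\<^sup>2 * \<phi> x * h x / scale x < 0" using h[OF x] phi_pos[of x] scale_pos[of x] pos
      by (simp add: divide_neg_pos mult_pos_neg)
    ultimately show "\<exists>y. (wronskian u u1 has_real_derivative y) (at x) \<and> y < 0" using wronskian_DERIV[OF u] by blast
  qed (rule wronskian_cont[OF u])
  then show ?thesis using w_pos by (simp add: divide_strict_right_mono)
qed

end

section \<open>Candidate value functions\<close>

context ou_fundamental
begin

text \<open>Solves the equation for the second derivative, so that \<open>ou_resolvent_eq\<close>
  applies to \<open>- V\<close>; boundedness of \<open>V1\<close> leaves a drift term of linear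
  growth.\<close>

lemma resolvent_of_solves:
  assumes V: "solves h S V V1" and h0: "\<And>y. h y \<ge> 0" and [measurable]: "h \<in> borel_measurable borel"
    and b: "\<And>y. \<bar>V y\<bar> \<le> C * (1 + \<bar>y\<bar>)" "\<And>y. \<bar>V1 y\<bar> \<le> C" "\<And>y. \<bar>h y\<bar> \<le> C * (1 + \<bar>y\<bar>)"
  shows "ou_resolvent h x = ennreal (- V x)"
proof -
  have C: "C \<ge> 0" using b(2)[of 0] by linarith
  have [measurable]: "V \<in> borel_measurable borel" "V1 \<in> borel_measurable borel"
    by (rule borel_measurable_continuous_onI, rule solvesD[OF V])+
  define k where "k = 2 / \<sigma>\<^sup>2"
  have k: "k > 0" using pos by (simp add: k_def)
  define L where "L = lam + \<theta> * (\<bar>\<mu>\<bar> + 1) + 1"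
  have L: "L \<ge> 1" using pos by (simp add: L_def)
  define R where "R = C * (1 + k * L)"
  have kL: "k * L \<ge> 0" using k L by simp
  have CR: "C \<le> R" unfolding R_def using C kL by (simp add: algebra_simps)
  \<comment> \<open>The right-hand side of the equation, taken at every point: off \<open>S\<close>
    it is the second derivative of \<open>- V\<close>, on \<open>S\<close> just a value consistent
    with \<open>h\<close>.\<close>
  define u2 where "u2 y = - (k * (lam * V y - \<theta> * (\<mu> - y) * V1 y + h y))" for y
  have lq: "C * (1 + \<bar>y\<bar>) \<le> (2 * R) * (1 + y\<^sup>2)" "R * (1 + \<bar>y\<bar>) \<le> (2 * R) * (1 + y\<^sup>2)" "C \<le> (2 * R) * (1 + y\<^sup>2)" for y
  proof -
    have "\<bar>y\<bar> \<le> 1 + y\<^sup>2" using zero_le_power2[of "\<bar>y\<bar> - 1"] zero_le_power2[of y] by (simp add: power2_diff)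
    moreover have "1 + p \<le> 2 * (1 + r)" if "p \<le> 1 + r" "0 \<le> r" for p r :: real using that by simp
    ultimately have *: "1 + \<bar>y\<bar> \<le> 2 * (1 + y\<^sup>2)" using zero_le_power2[of y] by blast
    then show R: "R * (1 + \<bar>y\<bar>) \<le> (2 * R) * (1 + y\<^sup>2)"
      using mult_left_mono[OF *, of R] CR C by (simp add: mult_ac)
    have "C * (1 + \<bar>y\<bar>) \<le> R * (1 + \<bar>y\<bar>)" using CR by (intro mult_right_mono) auto
    then show C1: "C * (1 + \<bar>y\<bar>) \<le> (2 * R) * (1 + y\<^sup>2)" using R by linarith
    have "C * 1 \<le> C * (1 + \<bar>y\<bar>)" using C by (intro mult_left_mono) auto
    then show "C \<le> (2 * R) * (1 + y\<^sup>2)" using C1 by linarith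
  qed
  show ?thesis
  proof (rule ou_resolvent_eq[where S=S and u="\<lambda>y. - V y" and ?u1.0="\<lambda>y. - V1 y" and ?u2.0=u2 and C="2 * R"])
    show "finite S" by (rule solvesD[OF V])
    show "((\<lambda>y. - V y) has_real_derivative - V1 y) (at y)" for y by (intro DERIV_minus solvesD[OF V])
    show "continuous_on UNIV (\<lambda>y. - V1 y)" by (intro continuous_intros solvesD[OF V])
    show "((\<lambda>y. - V1 y) has_real_derivative u2 y) (at y)" if "y \<notin> S" for y
      unfolding u2_def k_def by (intro DERIV_minus solvesD(5)[OF V] that)
    show "u2 \<in> borel_measurable borel" unfolding u2_def by measurable
    show "\<bar>- V y\<bar> \<le> 2 * R * (1 + y\<^sup>2)" "\<bar>- V1 y\<bar> \<le> 2 * R * (1 + y\<^sup>2)" for y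
      using b(1)[of y] b(2)[of y] lq[of y] by simp_all
    show "\<bar>u2 y\<bar> \<le> 2 * R * (1 + y\<^sup>2)" for y
    proof -
      have 1: "\<bar>lam * V y\<bar> \<le> lam * (C * (1 + \<bar>y\<bar>))" using b(1)[of y] pos by (simp add: abs_mult)
      have "\<bar>\<mu> - y\<bar> \<le> (\<bar>\<mu>\<bar> + 1) * (1 + \<bar>y\<bar>)"
      proof -
        have "\<bar>\<mu> - y\<bar> \<le> \<bar>\<mu>\<bar> + \<bar>y\<bar>" by linarith
        also have "\<dots> \<le> (\<bar>\<mu>\<bar> + 1) * (1 + \<bar>y\<bar>)" by (simp add: algebra_simps)
        finally show ?thesis .
      qed
      then have "\<bar>\<mu> - y\<bar> * \<bar>V1 y\<bar> \<le> (\<bar>\<mu>\<bar> + 1) * (1 + \<bar>y\<bar>) * C" using b(2)[of y] by (intro mult_mono) auto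
      then have 2: "\<bar>\<theta> * (\<mu> - y) * V1 y\<bar> \<le> \<theta> * ((\<bar>\<mu>\<bar> + 1) * (1 + \<bar>y\<bar>) * C)"
        using pos by (simp add: abs_mult mult.assoc)
      have "\<bar>lam * V y - \<theta> * (\<mu> - y) * V1 y + h y\<bar> \<le> lam * (C * (1 + \<bar>y\<bar>)) + \<theta> * ((\<bar>\<mu>\<bar> + 1) * (1 + \<bar>y\<bar>) * C) + C * (1 + \<bar>y\<bar>)"
        using 1 2 b(3)[of y] by linarith
      also have "\<dots> = C * L * (1 + \<bar>y\<bar>)" unfolding L_def by (simp add: algebra_simps)
      finally have "k * \<bar>lam * V y - \<theta> * (\<mu> - y) * V1 y + h y\<bar> \<le> k * (C * L * (1 + \<bar>y\<bar>))" using k by simp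
      moreover have "\<bar>u2 y\<bar> = k * \<bar>lam * V y - \<theta> * (\<mu> - y) * V1 y + h y\<bar>" unfolding u2_def using k by (simp add: abs_mult)
      moreover have "k * (C * L * (1 + \<bar>y\<bar>)) \<le> R * (1 + \<bar>y\<bar>)" unfolding R_def using C by (simp add: algebra_simps)
      ultimately show ?thesis using lq(2)[of y] by linarith
    qed
    show "h y = lam * - V y - \<sigma>\<^sup>2 / 2 * u2 y - \<theta> * (\<mu> - y) * - V1 y" for y
    proof -
      have "\<sigma>\<^sup>2 / 2 * - (2 / \<sigma>\<^sup>2 * a) = - a" for a using pos by simp
      then have "\<sigma>\<^sup>2 / 2 * u2 y = - (lam * V y - \<theta> * (\<mu> - y) * V1 y + h y)"
        unfolding u2_def k_def .
      then show ?thesis by (simp only:)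
    qed
  qed (use h0 in auto)
qed

text \<open>Packages the data for the verification theorem. The equivalence in the last clause makes
  \<open>D\<close> the exact contact set, which identifies the stopping set and not merely an
  optimal time.\<close>

definition candidate :: "real set \<Rightarrow> (real \<Rightarrow> real) \<Rightarrow> bool" where
  "candidate D G \<longleftrightarrow> (\<exists>u h C. h \<in> borel_measurable borel \<and> (\<forall>y. ou_resolvent h y = ennreal (u y)) \<and>
     continuous_on UNIV u \<and> (\<forall>y. u y \<ge> 0) \<and> (\<forall>y. (u y)\<^sup>2 \<le> C * (1 + y\<^sup>2)) \<and> (\<forall>y. y \<notin> D \<longrightarrow> h y \<le> 0) \<and>
     (\<forall>y. - u y \<le> G y) \<and> (\<forall>y. G y = - u y \<longleftrightarrow> y \<in> D))"

text \<open>The weight \<open>g\<close> treats linear growth of \<open>V\<close> and boundedness of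
  \<open>V1\<close> at once.\<close>

lemma bounded_linear_growth:
  fixes f g :: "real \<Rightarrow> real"
  assumes f: "continuous_on UNIV f" and g0: "\<And>x. g x \<ge> 1"
    and l: "\<And>x. x \<le> a \<Longrightarrow> \<bar>f x\<bar> \<le> C * g x" and r: "\<And>x. x \<ge> b \<Longrightarrow> \<bar>f x\<bar> \<le> C'"
  shows "\<exists>K\<ge>0. \<forall>x. \<bar>f x\<bar> \<le> K * g x"
proof -
  have "compact (f ` {a..b})" by (intro compact_continuous_image continuous_on_subset[OF f]) auto
  then obtain P where P: "\<And>x. x \<in> {a..b} \<Longrightarrow> \<bar>f x\<bar> \<le> P"
    using compact_imp_bounded[of "f ` {a..b}"] unfolding bounded_iff by fastforce
  define K where "K = \<bar>C\<bar> + \<bar>C'\<bar> + \<bar>P\<bar>"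
  have Kg: "K \<le> K * g x" for x using mult_left_mono[OF g0[of x], of K] by (simp add: K_def)
  have "\<bar>f x\<bar> \<le> K * g x" for x
  proof -
    consider "x \<le> a" | "x \<in> {a..b}" | "x \<ge> b" by fastforce
    then show ?thesis
    proof cases
      case 1
      have "C * g x \<le> K * g x" using g0[of x] by (intro mult_right_mono) (auto simp: K_def)
      then show ?thesis using l[OF 1] by simp
    next
      case 2 then show ?thesis using P[OF 2] Kg[of x] by (auto simp: K_def)
    next
      case 3 then show ?thesis using r[OF 3] Kg[of x] by (auto simp: K_def)
    qed
  qed
  moreover have "K \<ge> 0" by (simp add: K_def)
  ultimately show ?thesis by blast
qed

text \<open>Growth is inherited from the two ends: \<open>V\<close> is \<open>G\<close> far to the
  left and a multiple of \<open>\<phi>\<close> far to the right, where \<open>\<phi>\<close> and its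
  derivative are bounded; the middle is compact.\<close>

lemma candidateI:
  assumes V: "solves h S V V1" and h0: "\<And>y. h y \<ge> 0" and h: "h \<in> borel_measurable borel"
    and hb: "\<And>y. \<bar>h y\<bar> \<le> C * (1 + \<bar>y\<bar>)"
    and G: "\<And>y. \<bar>G y\<bar> \<le> C * (1 + \<bar>y\<bar>)" "\<And>y. \<bar>G1 y\<bar> \<le> C"
    and left: "\<And>y. y \<le> a \<Longrightarrow> V y = G y \<and> V1 y = G1 y"
    and right: "\<And>y. y > b \<Longrightarrow> V y = k * \<phi> y \<and> V1 y = k * \<phi>1 y"
    and neg: "\<And>y. V y \<le> 0" and VG: "\<And>y. y \<in> D \<Longrightarrow> V y = G y" "\<And>y. y \<notin> D \<Longrightarrow> V y < G y"
    and hD: "\<And>y. y \<notin> D \<Longrightarrow> h y = 0"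
  shows "candidate D G"
proof -
  obtain C1 where C1: "\<forall>x\<ge>b + 1. \<bar>\<phi>1 x\<bar> \<le> C1" using phi1_bounded by blast
  have "\<bar>V x\<bar> \<le> \<bar>k\<bar> * \<phi> (b + 1)" if "b + 1 \<le> x" for x
    using right[of x] phi_le[OF that] phi_pos[of x] that by (simp add: abs_mult mult_left_mono)
  then have "\<exists>K\<ge>0. \<forall>x. \<bar>V x\<bar> \<le> K * (1 + \<bar>x\<bar>)"
    using left G(1) by (intro bounded_linear_growth[OF solvesD(4)[OF V], of "\<lambda>x. 1 + \<bar>x\<bar>" a C "b + 1" "\<bar>k\<bar> * \<phi> (b + 1)"]) auto
  then obtain K where K: "K \<ge> 0" "\<forall>x. \<bar>V x\<bar> \<le> K * (1 + \<bar>x\<bar>)" by blast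
  have "\<bar>V1 x\<bar> \<le> \<bar>k\<bar> * C1" if "b + 1 \<le> x" for x
    using right[of x] C1 that by (simp add: abs_mult mult_left_mono)
  then have "\<exists>K\<ge>0. \<forall>x. \<bar>V1 x\<bar> \<le> K * 1"
    using left G(2) by (intro bounded_linear_growth[OF solvesD(3)[OF V], of "\<lambda>x. 1" a C "b + 1" "\<bar>k\<bar> * C1"]) auto
  then obtain K' where K': "K' \<ge> 0" "\<forall>x. \<bar>V1 x\<bar> \<le> K'" by auto
  define R where "R = max C (max K K')"
  have R: "a' * (1 + \<bar>y\<bar>) \<le> R * (1 + \<bar>y\<bar>)" if "a' \<le> R" for a' y :: real using that by (intro mult_right_mono) auto
  have KR: "C \<le> R" "K \<le> R" "K' \<le> R" by (auto simp: R_def)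
  have res: "ou_resolvent h x = ennreal (- V x)" for x
  proof (rule resolvent_of_solves[OF V h0 h, of R])
    show "\<bar>V y\<bar> \<le> R * (1 + \<bar>y\<bar>)" for y by (rule order_trans[OF K(2)[rule_format] R[OF KR(2)]])
    show "\<bar>V1 y\<bar> \<le> R" for y by (rule order_trans[OF K'(2)[rule_format] KR(3)])
    show "\<bar>h y\<bar> \<le> R * (1 + \<bar>y\<bar>)" for y by (rule order_trans[OF hb R[OF KR(1)]])
  qed
  have sq: "(- V y)\<^sup>2 \<le> 2 * K\<^sup>2 * (1 + y\<^sup>2)" for y
  proof -
    have "(- V y)\<^sup>2 = \<bar>V y\<bar>\<^sup>2" by simp
    also have "\<dots> \<le> (K * (1 + \<bar>y\<bar>))\<^sup>2" using K by (intro power_mono) auto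
    also have "\<dots> = K\<^sup>2 * (1 + \<bar>y\<bar>)\<^sup>2" by (rule power_mult_distrib)
    also have "\<dots> \<le> K\<^sup>2 * (2 * (1 + y\<^sup>2))"
      using zero_le_power2[of "\<bar>y\<bar> - 1"] by (intro mult_left_mono) (auto simp: power2_sum power2_diff)
    also have "K\<^sup>2 * (2 * (1 + y\<^sup>2)) = 2 * K\<^sup>2 * (1 + y\<^sup>2)" by simp
    finally show ?thesis .
  qed
  show ?thesis
    unfolding candidate_def
  proof (rule exI[of _ "\<lambda>y. - V y"], rule exI[of _ h], rule exI[of _ "2 * K\<^sup>2"], intro conjI allI impI)
    show "continuous_on UNIV (\<lambda>y. - V y)" by (intro continuous_intros solvesD[OF V])
    show "- V y \<ge> 0" for y using neg[of y] by simp
    show "h y \<le> 0" if "y \<notin> D" for y using hD[OF that] by simp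
    show "- (- V y) \<le> G y" for y using VG[of y] by (cases "y \<in> D") auto
    show "G y = - (- V y) \<longleftrightarrow> y \<in> D" for y using VG[of y] by (cases "y \<in> D") auto
  qed (use h res sq in auto)
qed

end

text \<open>\<open>low\<close> sends the slope of \<open>G / \<phi>\<close> in the scale to minus
  infinity on the left once it is monotone there; \<open>high\<close> makes this slope positive far
  to the right.\<close>

locale ou_gain = ou_fundamental +
  fixes G G1 hG :: "real \<Rightarrow> real" and \<gamma> C :: real
  assumes G: "solves hG {\<gamma>} G G1" and hG_meas: "hG \<in> borel_measurable borel"
    and growth: "\<And>x. \<bar>G x\<bar> \<le> C * (1 + \<bar>x\<bar>)" "\<And>x. \<bar>G1 x\<bar> \<le> C" "\<And>x. \<bar>hG x\<bar> \<le> C * (1 + \<bar>x\<bar>)"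
    and low: "\<And>m. \<exists>A. \<forall>x\<le>A. G x < m" and high: "\<exists>A. \<forall>x\<ge>A. G x > 0 \<and> G1 x > 0"
begin

definition H :: "real \<Rightarrow> real" where "H x = wronskian G G1 x / w"

definition q :: "real \<Rightarrow> real" where "q x = G x / \<phi> x"

lemma G_q: "G x = q x * \<phi> x" using phi_pos[of x] by (simp add: q_def)

lemma psi_F: "\<psi> x = F x * \<phi> x" using phi_pos[of x] by (simp add: F_def)

text \<open>Smooth fit at a contact point: with \<open>k = q l - m * F l\<close>, the function
  \<open>k * \<phi> + m * \<psi>\<close> meets \<open>G\<close> at \<open>l\<close> by construction,
  and equal slopes in the scale mean equal derivatives.\<close>

lemma slope_match:
  assumes "H l = m" shows "G1 l = (q l - m * F l) * \<phi>1 l + m * \<psi>1 l"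
proof -
  have "G1 l * \<phi> l - G l * \<phi>1 l = m * (w * scale l)"
    using assms w_pos scale_pos[of l] unfolding H_def wronskian_def by (simp add: field_simps)
  then have "G1 l * \<phi> l = ((q l - m * F l) * \<phi>1 l + m * \<psi>1 l) * \<phi> l"
    unfolding w_scale G_q[of l] psi_F[of l] by (simp add: algebra_simps)
  then show ?thesis using phi_pos[of l] by simp
qed

lemma q_DERIV: "(q has_real_derivative H x * F' x) (at x)"
  unfolding q_def[abs_def] H_def by (rule quotient_DERIV[OF G])

lemma q_at_bot: "(q \<longlongrightarrow> 0) at_bot"
  unfolding q_def[abs_def] by (rule quotient_at_bot[OF growth(1)])

text \<open>If the slope stayed above \<open>m\<close> near \<open>-\<infinity>\<close>, then \<open>G \<ge> m \<psi>\<close> there, although \<open>\<psi>\<close> is bounded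
  and \<open>G\<close> tends to \<open>-\<infinity>\<close>.\<close>

lemma H_at_bot:
  assumes up: "strict_mono_on {..b} H"
  shows "\<exists>A. \<forall>x\<le>A. H x < m"
proof (rule ccontr)
  assume neg: "\<not> (\<exists>A. \<forall>x\<le>A. H x < m)"
  have H: "H x > m" if x: "x \<le> b" for x
  proof -
    obtain y where y: "y \<le> x - 1" "H y \<ge> m" using neg by (metis not_less)
    have "H y < H x" using strict_mono_onD[OF up, of y x] y x by simp
    then show ?thesis using y by simp
  qed
  have ge: "G x \<ge> m * \<psi> x" if x: "x \<le> b" for x
  proof -
    have "q y - m * F y \<le> q x - m * F x" if y: "y < x" for y
    proof -
      have "q y - m * F y < q x - m * F x"
      proof (rule DERIV_pos_imp_increasing_open[OF y])
        fix z assume z: "y < z" "z < x"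
        have "((\<lambda>x. q x - m * F x) has_real_derivative (H z - m) * F' z) (at z)"
          by (auto intro!: derivative_eq_intros F_DERIV q_DERIV simp: algebra_simps)
        moreover have "(H z - m) * F' z > 0" using H[of z] z x F'_pos[of z] by simp
        ultimately show "\<exists>d. ((\<lambda>x. q x - m * F x) has_real_derivative d) (at z) \<and> 0 < d" by blast
      next
        show "continuous_on {y..x} (\<lambda>x. q x - m * F x)"
          by (intro continuous_intros DERIV_continuous_on[OF has_field_derivative_at_within[OF q_DERIV]]
             DERIV_continuous_on[OF has_field_derivative_at_within[OF F_DERIV]])
      qed
      then show ?thesis by simp
    qed
    then have ev: "\<forall>\<^sub>F y in at_bot. q y - m * F y \<le> q x - m * F x"
      using eventually_gt_at_bot[of x] by (rule eventually_mono[rotated])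
    have "((\<lambda>y. q y - m * F y) \<longlongrightarrow> 0 - m * 0) at_bot" by (intro tendsto_intros q_at_bot F_at_bot)
    then have "0 - m * 0 \<le> q x - m * F x" by (rule tendsto_upperbound[OF _ ev]) simp
    then have "(q x - m * F x) * \<phi> x \<ge> 0" using phi_pos[of x] by simp
    then show ?thesis unfolding G_q[of x] psi_F[of x] by (simp add: algebra_simps)
  qed
  obtain A where A: "\<forall>x\<le>A. G x < - \<bar>m\<bar> * \<psi> b" using low by blast
  define x where "x = min A b"
  have "\<bar>m\<bar> * \<psi> x \<le> \<bar>m\<bar> * \<psi> b" by (intro mult_left_mono psi_le) (auto simp: x_def)
  moreover have "- (\<bar>m\<bar> * \<psi> x) \<le> m * \<psi> x" using psi_pos[of x] by (simp add: abs_if)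
  moreover have "G x \<ge> m * \<psi> x" "G x < - \<bar>m\<bar> * \<psi> b" using ge A by (auto simp: x_def)
  ultimately show False by simp
qed

lemma scale_function: "strict_mono_on {..b} H \<Longrightarrow> scale_function q F H F'"
proof
  assume up: "strict_mono_on {..b} H"
  show "continuous_on UNIV H" unfolding H_def[abs_def] using w_pos by (intro continuous_intros wronskian_cont[OF G]) auto
  show "\<exists>A. \<forall>x\<le>A. H x < m" for m by (rule H_at_bot[OF up])
qed (rule F_DERIV F'_pos q_DERIV)+

lemma H_eventually_pos: "\<exists>A. \<forall>x\<ge>A. H x > 0"
proof -
  obtain A where A: "\<forall>x\<ge>A. G x > 0 \<and> G1 x > 0" using high by blast
  have "H x > 0" if "x \<ge> A" for x
  proof -
    have "G1 x * \<phi> x > 0" "G x * \<phi>1 x \<le> 0" using A that phi_pos[of x] phi1_nonpos[of x] by (auto simp: mult_le_0_iff less_imp_le)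
    then show ?thesis unfolding H_def wronskian_def using w_pos scale_pos[of x] by (intro divide_pos_pos) auto
  qed
  then show ?thesis by blast
qed

text \<open>A decreasing slope that is eventually positive is positive all along.\<close>

lemma H_pos_right:
  assumes down: "strict_antimono_on {d..} H" and x: "x \<ge> d" shows "H x > 0"
proof -
  obtain A where A: "\<forall>x\<ge>A. H x > 0" using H_eventually_pos by blast
  have "H (max A (x + 1)) < H x" using monotone_onD[OF down, of x "max A (x + 1)"] x by simp
  moreover have "H (max A (x + 1)) > 0" using A by simp
  ultimately show ?thesis by simp
qed

text \<open>\<open>q\<close> starts from 0 at minus infinity and decreases up to \<open>l\<close>.
  This gives the nonpositivity demanded of a candidate.\<close>

lemma q_neg:
  assumes m: "m \<le> 0" and neg: "\<And>x. x < l \<Longrightarrow> H x < m" and x: "x \<le> l" shows "q x < 0"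
proof -
  have dec: "q b < q a" if ab: "a < b" "b \<le> l" for a b
  proof (rule DERIV_neg_imp_decreasing_open[OF ab(1)])
    fix z assume z: "a < z" "z < b"
    then have "H z * F' z < 0" using neg[of z] ab m F'_pos[of z] by (simp add: mult_less_0_iff)
    then show "\<exists>y. (q has_real_derivative y) (at z) \<and> y < 0" using q_DERIV by blast
  qed (rule DERIV_continuous_on[OF has_field_derivative_at_within[OF q_DERIV]])
  have ev: "\<forall>\<^sub>F y in at_bot. q (x - 1) \<le> q y"
  proof (rule eventually_mono[OF eventually_le_at_bot[of "x - 2"]])
    fix y assume "y \<le> x - 2"
    then show "q (x - 1) \<le> q y" using dec[of y "x - 1"] x by simp
  qed
  have "q (x - 1) \<le> 0" by (rule tendsto_lowerbound[OF q_at_bot ev]) simp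
  moreover have "q x < q (x - 1)" using dec[of "x - 1" x] x by simp
  ultimately show ?thesis by simp
qed

lemma solves_phi_psi: "solves (\<lambda>_. 0) {} (\<lambda>x. k * \<phi> x + m * \<psi> x) (\<lambda>x. k * \<phi>1 x + m * \<psi>1 x)"
  using solves_lincomb[OF solves_phi solves_psi, of k m] by simp

lemma solves_kphi: "solves (\<lambda>_. 0) {} (\<lambda>x. k * \<phi> x) (\<lambda>x. k * \<phi>1 x)"
  using solves_phi_psi[of k 0] by simp

text \<open>The candidate is \<open>G\<close> up to \<open>l\<close> and then
  \<open>q l * \<phi>\<close>, the horizontal line. \<open>E\<close> collects further points where
  \<open>G\<close> touches that line; it will be empty or a single point.\<close>

lemma one_sided_candidate:
  assumes l: "H l = 0" and left: "\<And>x. x < l \<Longrightarrow> H x < 0" and hG0: "\<And>x. x \<le> l \<Longrightarrow> hG x \<ge> 0"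
    and E: "\<And>x. x \<in> E \<Longrightarrow> q x = q l" and right: "\<And>x. l < x \<Longrightarrow> x \<notin> E \<Longrightarrow> q l < q x"
  shows "candidate ({..l} \<union> E) G"
proof (rule candidateI[where a=l and b=l and k="q l"])
  show "solves (\<lambda>x. if x \<le> l then hG x else 0) ({\<gamma>} \<union> {} \<union> {l}) (\<lambda>x. if x \<le> l then G x else q l * \<phi> x) (\<lambda>x. if x \<le> l then G1 x else q l * \<phi>1 x)"
    by (rule solves_glue[OF G solves_kphi]) (use slope_match[OF l] G_q[of l] in simp_all)
  show "(\<lambda>x. if x \<le> l then hG x else 0) \<in> borel_measurable borel" using hG_meas by measurable
  have C0: "C \<ge> 0" using growth(2)[of 0] by linarith
  have Cy: "0 \<le> C * (1 + \<bar>y\<bar>)" for y :: real using C0 by simp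
  show "\<bar>if y \<le> l then hG y else 0\<bar> \<le> C * (1 + \<bar>y\<bar>)" for y using growth(3)[of y] Cy[of y] by simp
  have ql: "q l < 0" using q_neg[of 0 l l] left by simp
  show "(if y \<le> l then G y else q l * \<phi> y) \<le> 0" for y
    using q_neg[of 0 l y] left ql phi_pos[of y] G_q[of y] by (auto simp: mult_le_0_iff intro: less_imp_le)
  show "(if y \<le> l then G y else q l * \<phi> y) = G y" if "y \<in> {..l} \<union> E" for y
    using that E[of y] G_q[of y] by auto
  show "(if y \<le> l then G y else q l * \<phi> y) < G y" if "y \<notin> {..l} \<union> E" for y
    using that right[of y] G_q[of y] phi_pos[of y] by auto
qed (use growth hG0 in auto)

text \<open>The candidate has four pieces: \<open>G\<close>, the tangent
  \<open>k * \<phi> + m * \<psi>\<close>, \<open>G\<close> again, and the horizontal line through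
  \<open>\<beta>\<close>. They fit smoothly because the slopes at \<open>a\<close>, \<open>b\<close>
  and \<open>\<beta>\<close> are \<open>m\<close>, \<open>m\<close> and 0.\<close>

lemma two_sided_candidate:
  assumes ord: "a < b" "b < \<beta>" and m: "m < 0" "H a = m" "H b = m" "H \<beta> = 0"
    and tan: "q a - m * F a = q b - m * F b"
    and left: "\<And>x. x < a \<Longrightarrow> H x < m" and mid: "\<And>x. b < x \<Longrightarrow> x < \<beta> \<Longrightarrow> H x < 0"
    and above: "\<And>x. a < x \<Longrightarrow> x < b \<Longrightarrow> q a - m * F a < q x - m * F x" and right: "\<And>x. \<beta> < x \<Longrightarrow> q \<beta> < q x"
    and hG0: "\<And>x. x \<le> a \<Longrightarrow> hG x \<ge> 0" "\<And>x. b < x \<Longrightarrow> x \<le> \<beta> \<Longrightarrow> hG x \<ge> 0"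
  shows "candidate ({..a} \<union> {b..\<beta>}) G"
proof -
  define k where "k = q a - m * F a"
  define V where "V x = (if x \<le> a then G x else if x \<le> b then k * \<phi> x + m * \<psi> x else if x \<le> \<beta> then G x else q \<beta> * \<phi> x)" for x
  define V1 where "V1 x = (if x \<le> a then G1 x else if x \<le> b then k * \<phi>1 x + m * \<psi>1 x else if x \<le> \<beta> then G1 x else q \<beta> * \<phi>1 x)" for x
  define h where "h x = (if x \<le> a then hG x else if x \<le> b then 0 else if x \<le> \<beta> then hG x else 0)" for x
  have Gk: "G x = k * \<phi> x + m * \<psi> x \<longleftrightarrow> q x - m * F x = k" "k * \<phi> x + m * \<psi> x < G x \<longleftrightarrow> k < q x - m * F x" for x
  proof -
    have *: "G x - (k * \<phi> x + m * \<psi> x) = (q x - m * F x - k) * \<phi> x" unfolding G_q[of x] psi_F[of x] by (simp add: algebra_simps)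
    show "G x = k * \<phi> x + m * \<psi> x \<longleftrightarrow> q x - m * F x = k" using * phi_pos[of x] by auto
    have "k * \<phi> x + m * \<psi> x < G x \<longleftrightarrow> (q x - m * F x - k) * \<phi> x > 0" using * by linarith
    then show "k * \<phi> x + m * \<psi> x < G x \<longleftrightarrow> k < q x - m * F x" using phi_pos[of x] by (simp add: zero_less_mult_iff)
  qed
  have s\<beta>: "solves (\<lambda>x. if x \<le> \<beta> then hG x else 0) ({\<gamma>} \<union> {} \<union> {\<beta>}) (\<lambda>x. if x \<le> \<beta> then G x else q \<beta> * \<phi> x) (\<lambda>x. if x \<le> \<beta> then G1 x else q \<beta> * \<phi>1 x)"
    by (rule solves_glue[OF G solves_kphi]) (use slope_match[OF m(4)] G_q[of \<beta>] in simp_all)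
  have kb: "k = q b - m * F b" using tan by (simp add: k_def)
  have sb: "solves (\<lambda>x. if x \<le> b then 0 else if x \<le> \<beta> then hG x else 0) ({} \<union> ({\<gamma>} \<union> {} \<union> {\<beta>}) \<union> {b})
     (\<lambda>x. if x \<le> b then k * \<phi> x + m * \<psi> x else if x \<le> \<beta> then G x else q \<beta> * \<phi> x)
     (\<lambda>x. if x \<le> b then k * \<phi>1 x + m * \<psi>1 x else if x \<le> \<beta> then G1 x else q \<beta> * \<phi>1 x)"
    by (rule solves_glue[OF solves_phi_psi s\<beta>]) (use slope_match[OF m(3)] kb Gk(1)[of b] ord in auto)
  have sV: "solves h ({\<gamma>} \<union> ({} \<union> ({\<gamma>} \<union> {} \<union> {\<beta>}) \<union> {b}) \<union> {a}) V V1"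
    unfolding h_def[abs_def] V_def[abs_def] V1_def[abs_def]
    by (rule solves_glue[OF G sb]) (use slope_match[OF m(2)] k_def Gk(1)[of a] ord in auto)
  have qneg: "q x < 0" if "x \<le> a" for x using q_neg[of m a x] m left that by simp
  \<comment> \<open>The tangent is below 0 at \<open>a\<close> and descends from there, since
    \<open>m < 0\<close> and \<open>F\<close> increases.\<close>
  have line: "q a - m * F a + m * F x < 0" if "a \<le> x" for x
  proof -
    have "F a \<le> F x"
      using DERIV_nonneg_imp_nondecreasing[OF that, of F] F_DERIV F'_pos by (metis less_imp_le)
    then have "m * F x \<le> m * F a" using m by (intro mult_left_mono_neg) auto
    then show ?thesis using qneg[of a] by simp
  qed
  have qb: "q b < 0" using line[of b] tan ord by simp
  have qdec: "q x \<le> q b" if x: "b \<le> x" "x \<le> \<beta>" for x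
  proof (cases "x = b")
    case False
    then have bx: "b < x" using x by simp
    have "q x < q b"
    proof (rule DERIV_neg_imp_decreasing_open[OF bx])
      fix z assume z: "b < z" "z < x"
      then have "H z * F' z < 0" using mid[of z] x F'_pos[of z] by (simp add: mult_less_0_iff)
      then show "\<exists>y. (q has_real_derivative y) (at z) \<and> y < 0" using q_DERIV by blast
    qed (rule DERIV_continuous_on[OF has_field_derivative_at_within[OF q_DERIV]])
    then show ?thesis by simp
  qed simp
  show ?thesis
  proof (rule candidateI[OF sV])
    show "h y \<ge> 0" for y unfolding h_def using hG0 by auto
    show "h \<in> borel_measurable borel" unfolding h_def[abs_def] using hG_meas by measurable
    have C0: "C \<ge> 0" using growth(2)[of 0] by linarith
    have Cy: "0 \<le> C * (1 + \<bar>y\<bar>)" for y :: real using C0 by simp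
    show "\<bar>h y\<bar> \<le> C * (1 + \<bar>y\<bar>)" for y unfolding h_def using growth(3)[of y] Cy[of y] by simp
    show "\<bar>G y\<bar> \<le> C * (1 + \<bar>y\<bar>)" "\<bar>G1 y\<bar> \<le> C" for y by (rule growth)+
    show "V y = G y \<and> V1 y = G1 y" if "y \<le> a" for y using that by (simp add: V_def V1_def)
    show "V y = q \<beta> * \<phi> y \<and> V1 y = q \<beta> * \<phi>1 y" if "\<beta> < y" for y using that ord by (simp add: V_def V1_def)
    show "V y \<le> 0" for y
    proof -
      consider "y \<le> a" | "a < y" "y \<le> b" | "b < y" "y \<le> \<beta>" | "\<beta> < y" by linarith
      then show ?thesis
      proof cases
        case 1
        then show ?thesis using qneg[OF 1] phi_pos[of y] G_q[of y] by (simp add: V_def mult_le_0_iff)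
      next
        case 2
        have "k * \<phi> y + m * \<psi> y = (q a - m * F a + m * F y) * \<phi> y" unfolding k_def psi_F[of y] by (simp add: algebra_simps)
        also have "\<dots> \<le> 0" using line[of y] 2 phi_pos[of y] by (simp add: mult_le_0_iff)
        finally show ?thesis using 2 by (simp add: V_def)
      next
        case 3
        then show ?thesis using qdec[of y] qb phi_pos[of y] G_q[of y] ord by (simp add: V_def mult_le_0_iff)
      next
        case 4
        then show ?thesis using qdec[of \<beta>] qb phi_pos[of y] ord by (simp add: V_def mult_le_0_iff)
      qed
    qed
    show "V y = G y" if "y \<in> {..a} \<union> {b..\<beta>}" for y
      using that Gk(1)[of b] kb ord by (auto simp: V_def)
    show "V y < G y" if "y \<notin> {..a} \<union> {b..\<beta>}" for y
    proof -
      have "a < y" "y < b \<or> \<beta> < y" using that by auto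
      then consider "a < y" "y < b" | "\<beta> < y" by blast
      then show ?thesis
      proof cases
        case 1
        then show ?thesis using above[of y] Gk(2)[of y] by (simp add: V_def k_def)
      next
        case 2
        then show ?thesis using right[of y] G_q[of y] phi_pos[of y] ord by (simp add: V_def)
      qed
    qed
    show "h y = 0" if "y \<notin> {..a} \<union> {b..\<beta>}" for y using that by (auto simp: h_def)
  qed
qed

lemma H_less:
  "a < b \<Longrightarrow> \<gamma> \<le> a \<or> b \<le> \<gamma> \<Longrightarrow> (\<And>x. a < x \<Longrightarrow> x < b \<Longrightarrow> hG x > 0) \<Longrightarrow> H a < H b"
  unfolding H_def by (rule wronskian_increasing[OF G]) auto

lemma H_greater:
  "a < b \<Longrightarrow> \<gamma> \<le> a \<or> b \<le> \<gamma> \<Longrightarrow> (\<And>x. a < x \<Longrightarrow> x < b \<Longrightarrow> hG x < 0) \<Longrightarrow> H b < H a"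
  unfolding H_def by (rule wronskian_decreasing[OF G]) auto

text \<open>The sign change at \<open>d\<close> may lie on either side of \<open>\<gamma>\<close>;
  monotonicity of \<open>H\<close> across \<open>\<gamma>\<close> follows by chaining the two sides.
  The assumption \<open>at\<close> fixes the sign of \<open>hG\<close> at the junction, where the
  equation says nothing.\<close>

theorem one_sided_stopping_set:
  assumes inc: "\<And>x. x < d \<Longrightarrow> x \<noteq> \<gamma> \<Longrightarrow> hG x > 0" and dec: "\<And>x. x > d \<Longrightarrow> x \<noteq> \<gamma> \<Longrightarrow> hG x < 0"
    and at: "\<gamma> < d \<Longrightarrow> hG \<gamma> \<ge> 0"
  shows "\<exists>l<d. candidate {..l} G"
proof -
  have up: "strict_mono_on {..d} H"
  proof (rule strict_mono_onI)
    fix r s assume rs: "r \<in> {..d}" "s \<in> {..d}" "r < s"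
    show "H r < H s"
    proof (cases "\<gamma> \<le> r \<or> s \<le> \<gamma>")
      case True
      then show ?thesis using rs inc by (intro H_less) auto
    next
      case False
      then have "H r < H \<gamma>" "H \<gamma> < H s" using rs by (auto intro!: H_less inc)
      then show ?thesis by simp
    qed
  qed
  have down: "strict_antimono_on {d..} H"
  proof (rule monotone_onI)
    fix r s assume rs: "r \<in> {d..}" "s \<in> {d..}" "r < s"
    show "H s < H r"
    proof (cases "\<gamma> \<le> r \<or> s \<le> \<gamma>")
      case True
      then show ?thesis using rs dec by (intro H_greater) auto
    next
      case False
      then have "H \<gamma> < H r" "H s < H \<gamma>" using rs by (auto intro!: H_greater dec)
      then show ?thesis by simp
    qed
  qed
  interpret scale_function q F H F' by (rule scale_function[OF up])
  obtain l where l: "l < d" "H l = 0" "\<And>x. x < l \<Longrightarrow> H x < 0" "\<And>x. l < x \<Longrightarrow> q l < q x"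
    using single_minimum[OF up H_pos_right[OF down]] by blast
  have "hG x \<ge> 0" if "x \<le> l" for x using inc[of x] at l(1) that by (cases "x = \<gamma>") auto
  then have "candidate ({..l} \<union> {}) G" using l by (intro one_sided_candidate) auto
  then show ?thesis using l(1) by auto
qed

text \<open>The alternatives for the two convex pieces become stopping sets; when both minima are
  equally low, the second interval shrinks to the point \<open>\<beta>\<close>.\<close>

theorem two_sided_stopping_set:
  assumes ord: "c < \<gamma>" "\<gamma> < d"
    and h1: "\<And>x. x < c \<Longrightarrow> hG x > 0" and h2: "\<And>x. c < x \<Longrightarrow> x < \<gamma> \<Longrightarrow> hG x < 0"
    and h3: "\<And>x. \<gamma> < x \<Longrightarrow> x < d \<Longrightarrow> hG x > 0" and h4: "\<And>x. d < x \<Longrightarrow> hG x < 0"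
  shows "\<exists>l<c. candidate {..l} G \<or> (\<exists>b \<beta>. \<gamma> < b \<and> b \<le> \<beta> \<and> \<beta> < d \<and> candidate ({..l} \<union> {b..\<beta>}) G)"
proof -
  have up1: "strict_mono_on {..c} H" using ord by (intro strict_mono_onI H_less h1) auto
  have down1: "strict_antimono_on {c..\<gamma>} H" by (intro monotone_onI H_greater h2) auto
  have up2: "strict_mono_on {\<gamma>..d} H" by (intro strict_mono_onI H_less h3) auto
  have down2: "strict_antimono_on {d..} H" using ord by (intro monotone_onI H_greater h4) auto
  interpret scale_function q F H F' by (rule scale_function[OF up1])
  have hl: "hG x \<ge> 0" if "x \<le> l" "l < c" for x l using h1[of x] that by simp
  consider (1) l where "l < c" "H l = 0" "\<forall>x<l. H x < 0" "\<forall>x>l. q l < q x"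
    | (2) l \<beta> where "l < c" "H l = 0" "\<forall>x<l. H x < 0" "\<gamma> < \<beta>" "\<beta> < d" "q l = q \<beta>" "\<forall>x>l. x \<noteq> \<beta> \<longrightarrow> q l < q x"
    | (3) m a b \<beta> where "m < 0" "a < c" "\<gamma> < b" "b < \<beta>" "\<beta> < d" "H a = m" "H b = m" "H \<beta> = 0" "q a - m * F a = q b - m * F b"
        "\<forall>x<a. H x < m" "\<forall>x. b < x \<and> x < \<beta> \<longrightarrow> H x < 0"
        "\<forall>x. a < x \<and> x < b \<longrightarrow> q a - m * F a < q x - m * F x" "\<forall>x>\<beta>. q \<beta> < q x"
    using two_minima[OF ord up1 down1 up2 H_pos_right[OF down2] F_pos] by blast
  then show ?thesis
  proof cases
    case 1
    then have "candidate ({..l} \<union> {}) G" using hl by (intro one_sided_candidate) auto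
    then show ?thesis using 1(1) by auto
  next
    case 2
    then have "candidate ({..l} \<union> {\<beta>..\<beta>}) G" using hl by (intro one_sided_candidate) auto
    then have "\<gamma> < \<beta> \<and> \<beta> \<le> \<beta> \<and> \<beta> < d \<and> candidate ({..l} \<union> {\<beta>..\<beta>}) G" using 2 by simp
    then show ?thesis using 2(1) by blast
  next
    case 3
    have "candidate ({..a} \<union> {b..\<beta>}) G"
      by (rule two_sided_candidate[of a b \<beta> m]) (use 3 ord hl less_imp_le[OF h3] in auto)
    then have "\<gamma> < b \<and> b \<le> \<beta> \<and> \<beta> < d \<and> candidate ({..a} \<union> {b..\<beta>}) G" using 3 by simp
    then show ?thesis using 3(2) by blast
  qed
qed

end

section \<open>The stopping problem\<close>

lemma (in ou_fundamental) ou_gain_piecewise: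
  fixes f c P0 g N :: real and u :: "real \<Rightarrow> real"
  assumes par: "f > 0" "c < 1" "P0 > 0"
    and N: "N = g * (1 - c) - lam * f * ((g - \<mu>) / (lam + \<theta>) + \<mu> / lam)"
    and u: "\<And>x. u x = (if x < g then \<psi> x / \<psi> g * N + lam * f * ((x - \<mu>) / (lam + \<theta>) + \<mu> / lam) else x * (1 - c))"
    and W: "W2inf_loc u"
  shows "\<exists>G1 C. ou_gain \<theta> \<mu> \<sigma> lam \<psi> (\<lambda>x. u x - P0) G1
      (\<lambda>x. if x \<le> g then lam * (P0 - f * x) else \<theta> * \<mu> * (1 - c) + lam * P0 - (lam + \<theta>) * (1 - c) * x) g C"
proof -
  \<comment> \<open>With these constants the left branch is \<open>M * \<psi> x + a * x + b\<close>,
    where \<open>P0\<close> is absorbed into \<open>b\<close>; the operator annihilates the first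
    term and leaves an affine function.\<close>
  define a where "a = lam * f / (lam + \<theta>)"
  define b where "b = lam * f * (\<mu> / lam - \<mu> / (lam + \<theta>)) - P0"
  define M where "M = N / \<psi> g"
  have a0: "a > 0" using par pos by (simp add: a_def)
  define Gl where "Gl x = M * \<psi> x + 1 * (a * x + b)" for x
  define Gl1 where "Gl1 x = M * \<psi>1 x + 1 * a" for x
  define Gr where "Gr x = (1 - c) * x + - P0" for x
  define hl where "hl x = lam * (P0 - f * x)" for x
  define hr where "hr x = \<theta> * \<mu> * (1 - c) + lam * P0 - (lam + \<theta>) * (1 - c) * x" for x
  have al: "a * (lam + \<theta>) = lam * f" using pos by (simp add: a_def)
  have bl: "lam * b = lam * f * \<mu> - lam * a * \<mu> - lam * P0"
  proof -
    have "lam * f * (\<mu> / (lam + \<theta>)) = a * \<mu>" by (simp add: a_def)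
    then have "b = f * \<mu> - a * \<mu> - P0" using pos unfolding b_def by (simp add: right_diff_distrib)
    then have "lam * b = lam * (f * \<mu> - a * \<mu> - P0)" by simp
    then show ?thesis by (simp add: right_diff_distrib)
  qed
  have Ul: "lam * f * ((x - \<mu>) / (lam + \<theta>) + \<mu> / lam) = a * x + b + P0" for x
    by (simp add: a_def b_def diff_divide_distrib algebra_simps)
  have Mg: "M * \<psi> g = N" using psi_pos[of g] by (simp add: M_def)
  have eq: "Gl g = Gr g" unfolding Gl_def Gr_def Mg unfolding N Ul by (simp add: algebra_simps)
  have uG: "u x - P0 = (if x \<le> g then Gl x else Gr x)" for x
  proof (cases "x = g")
    case True
    have "u g - P0 = Gr g" by (simp add: u Gr_def algebra_simps)
    then show ?thesis using True eq by simp
  next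
    case False
    then show ?thesis unfolding u Ul by (simp add: Gl_def Gr_def M_def algebra_simps)
  qed
  have sl: "solves hl {} Gl Gl1"
  proof -
    have "(\<lambda>x. M * 0 + 1 * (\<theta> * (\<mu> - x) * a - lam * (a * x + b))) = hl"
    proof
      fix x
      have "\<theta> * (\<mu> - x) * a - lam * (a * x + b) = a * \<theta> * \<mu> - a * (lam + \<theta>) * x - lam * b" by (simp add: algebra_simps)
      also have "\<dots> = a * (lam + \<theta>) * \<mu> - a * (lam + \<theta>) * x - lam * f * \<mu> + lam * P0" unfolding bl by (simp add: algebra_simps)
      also have "\<dots> = hl x" unfolding al hl_def by (simp add: algebra_simps)
      finally show "M * 0 + 1 * (\<theta> * (\<mu> - x) * a - lam * (a * x + b)) = hl x" by simp
    qed
    then show ?thesis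
      using solves_lincomb[OF solves_psi solves_affine[of a b], of M 1] unfolding Gl_def[abs_def] Gl1_def[abs_def] by simp
  qed
  have sr: "solves hr {} Gr (\<lambda>_. 1 - c)"
  proof -
    have "(\<lambda>x. \<theta> * (\<mu> - x) * (1 - c) - lam * ((1 - c) * x + - P0)) = hr"
      by (simp add: hr_def fun_eq_iff algebra_simps)
    then show ?thesis using solves_affine[of "1 - c" "- P0"] unfolding Gr_def[abs_def] by (simp only:)
  qed
  \<comment> \<open>Sobolev regularity enters here: it rules out a kink at \<open>g\<close>, so that
    the two branches form one solution of class C1.\<close>
  have fit: "Gl1 g = 1 - c"
  proof (rule W2inf_loc_smooth_fit[where fl="\<lambda>x. Gl x + P0" and fr="\<lambda>x. Gr x + P0" and ?fl1.0=Gl1 and ?fr1.0="\<lambda>_. 1 - c"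
        and ?fl2.0="\<lambda>x. M * (2 / \<sigma>\<^sup>2 * (lam * \<psi> x - \<theta> * (\<mu> - x) * \<psi>1 x))" and ?fr2.0="\<lambda>_. 0"])
    have "u = (\<lambda>x. if x < g then Gl x + P0 else Gr x + P0)"
    proof
      fix x show "u x = (if x < g then Gl x + P0 else Gr x + P0)" using uG[of x] eq by (cases "x = g") (auto split: if_splits)
    qed
    then show "W2inf_loc (\<lambda>x. if x < g then Gl x + P0 else Gr x + P0)" using W by simp
    show "((\<lambda>x. Gl x + P0) has_real_derivative Gl1 x) (at x)" for x using solvesD(2)[OF sl, of x] by (auto intro!: derivative_eq_intros)
    show "((\<lambda>x. Gr x + P0) has_real_derivative 1 - c) (at x)" for x using solvesD(2)[OF sr, of x] by (auto intro!: derivative_eq_intros)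
    show "(Gl1 has_real_derivative M * (2 / \<sigma>\<^sup>2 * (lam * \<psi> x - \<theta> * (\<mu> - x) * \<psi>1 x))) (at x)" for x
      unfolding Gl1_def[abs_def] by (rule derivative_eq_intros DERIV_cmult psi1_DERIV refl | simp)+
    show "continuous_on UNIV (\<lambda>x. M * (2 / \<sigma>\<^sup>2 * (lam * \<psi> x - \<theta> * (\<mu> - x) * \<psi>1 x)))"
      by (intro continuous_intros solvesD(3)[OF solves_psi] solvesD(4)[OF solves_psi])
  qed (use eq in auto)
  define G1 where "G1 x = (if x \<le> g then Gl1 x else 1 - c)" for x
  obtain C1 where C1: "\<forall>x\<le>g. \<psi>1 x \<le> C1" using psi1_bounded by blast
  have psig: "\<bar>M * \<psi> x\<bar> \<le> \<bar>N\<bar>" if "x \<le> g" for x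
  proof -
    have "\<bar>M\<bar> * \<psi> x \<le> \<bar>M\<bar> * \<psi> g" using psi_le[OF that] by (intro mult_left_mono) auto
    then show ?thesis using psi_pos[of g] psi_pos[of x] by (simp add: M_def abs_mult)
  qed
  define n0 n1 n2 n3 where n: "n0 = \<bar>N\<bar>" "n1 = \<bar>b\<bar>" "n2 = \<bar>M\<bar> * \<bar>C1\<bar>" "n3 = \<bar>\<theta> * \<mu> * (1 - c)\<bar>"
  \<comment> \<open>The sum of all coefficients dominates each partial sum by nonnegativity
    alone.\<close>
  define K where "K = n0 + n1 + n2 + n3 + a + (1 - c) + P0 + lam * P0 + lam * f + (lam + \<theta>) * (1 - c)"
  have nn: "0 \<le> n0" "0 \<le> n1" "0 \<le> n2" "0 \<le> n3" "0 \<le> a" "0 \<le> 1 - c" "0 \<le> P0" "0 \<le> lam * P0" "0 \<le> lam * f"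
      "0 \<le> (lam + \<theta>) * (1 - c)" unfolding n using a0 par pos by auto
  have lin: "p + r * \<bar>x\<bar> \<le> K * (1 + \<bar>x\<bar>)" if "p \<le> K" "r \<le> K" for p r x :: real
    using mult_right_mono[OF that(2), of "\<bar>x\<bar>"] that(1) by (simp add: distrib_left)
  have "ou_gain \<theta> \<mu> \<sigma> lam \<psi> (\<lambda>x. u x - P0) G1 (\<lambda>x. if x \<le> g then hl x else hr x) g K"
  proof
    show "solves (\<lambda>x. if x \<le> g then hl x else hr x) {g} (\<lambda>x. u x - P0) G1"
      unfolding uG G1_def[abs_def] using solves_glue[OF sl sr eq fit] by simp
    show "(\<lambda>x. if x \<le> g then hl x else hr x) \<in> borel_measurable borel" unfolding hl_def hr_def by measurable
    show "\<bar>u x - P0\<bar> \<le> K * (1 + \<bar>x\<bar>)" for x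
    proof (cases "x \<le> g")
      case True
      have "\<bar>Gl x\<bar> \<le> (\<bar>N\<bar> + \<bar>b\<bar>) + a * \<bar>x\<bar>"
      proof -
        have "\<bar>a * x\<bar> = a * \<bar>x\<bar>" using a0 by (simp add: abs_mult)
        then show ?thesis using psig[OF True] unfolding Gl_def mult_1 by linarith
      qed
      also have "\<dots> \<le> K * (1 + \<bar>x\<bar>)" by (rule lin) (use nn K_def n in linarith)+
      finally show ?thesis using True uG[of x] by simp
    next
      case False
      have "\<bar>Gr x\<bar> \<le> P0 + (1 - c) * \<bar>x\<bar>"
      proof -
        have "\<bar>(1 - c) * x\<bar> = (1 - c) * \<bar>x\<bar>" using par by (simp add: abs_mult)
        then show ?thesis using par unfolding Gr_def by linarith
      qed
      also have "\<dots> \<le> K * (1 + \<bar>x\<bar>)" by (rule lin) (use nn K_def n in linarith)+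
      finally show ?thesis using False uG[of x] by simp
    qed
    show "\<bar>G1 x\<bar> \<le> K" for x
    proof (cases "x \<le> g")
      case True
      have "\<bar>M\<bar> * \<psi>1 x \<le> \<bar>M\<bar> * \<bar>C1\<bar>" using C1 True by (intro mult_left_mono) (auto intro: order_trans[OF _ abs_ge_self])
      then have "\<bar>M * \<psi>1 x\<bar> \<le> \<bar>M\<bar> * \<bar>C1\<bar>" using psi1_nonneg[of x] by (simp add: abs_mult)
      then have "\<bar>Gl1 x\<bar> \<le> \<bar>M\<bar> * \<bar>C1\<bar> + a" using a0 unfolding Gl1_def mult_1 by linarith
      also have "\<dots> \<le> K" using nn n K_def by linarith
      finally show ?thesis using True by (simp add: G1_def)
    next
      case False
      moreover have "1 - c \<le> K" using nn K_def by linarith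
      ultimately show ?thesis using nn by (simp add: G1_def)
    qed
    show "\<bar>if x \<le> g then hl x else hr x\<bar> \<le> K * (1 + \<bar>x\<bar>)" for x
    proof -
      have "\<bar>hl x\<bar> \<le> lam * P0 + lam * f * \<bar>x\<bar>"
      proof -
        have "\<bar>lam * f * x\<bar> = lam * f * \<bar>x\<bar>" using par pos by (simp add: abs_mult)
        moreover have "hl x = lam * P0 - lam * f * x" by (simp add: hl_def algebra_simps)
        ultimately show ?thesis using nn by linarith
      qed
      also have "\<dots> \<le> K * (1 + \<bar>x\<bar>)" by (rule lin) (use nn K_def n in linarith)+
      finally have l: "\<bar>hl x\<bar> \<le> K * (1 + \<bar>x\<bar>)" .
      have "\<bar>hr x\<bar> \<le> (\<bar>\<theta> * \<mu> * (1 - c)\<bar> + lam * P0) + (lam + \<theta>) * (1 - c) * \<bar>x\<bar>"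
      proof -
        have "\<bar>(lam + \<theta>) * (1 - c) * x\<bar> = (lam + \<theta>) * (1 - c) * \<bar>x\<bar>" using par pos by (simp add: abs_mult)
        then show ?thesis using nn unfolding hr_def by linarith
      qed
      also have "\<dots> \<le> K * (1 + \<bar>x\<bar>)" by (rule lin) (use nn K_def n in linarith)+
      finally show ?thesis using l by simp
    qed
    show "\<exists>A. \<forall>x\<le>A. u x - P0 < m" for m
    proof (intro exI allI impI)
      \<comment> \<open>\<open>\<bar>N\<bar>\<close> bounds the term with \<open>\<psi>\<close> to
        the left of \<open>g\<close>, and the extra 1 gives a strict inequality.\<close>
      fix x assume x: "x \<le> min g ((m - \<bar>N\<bar> - b - 1) / a)"
      then have xg: "x \<le> g" and "x \<le> (m - \<bar>N\<bar> - b - 1) / a" by auto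
      then have "a * x \<le> m - \<bar>N\<bar> - b - 1" using a0 by (simp add: pos_le_divide_eq mult.commute)
      then have "Gl x < m" using psig[OF xg] unfolding Gl_def mult_1 by linarith
      then show "u x - P0 < m" using uG[of x] xg by simp
    qed
    show "\<exists>A. \<forall>x\<ge>A. u x - P0 > 0 \<and> G1 x > 0"
    proof (intro exI allI impI)
      fix x assume x: "max (g + 1) ((P0 + 1) / (1 - c)) \<le> x"
      then have xg: "x > g" and "(P0 + 1) / (1 - c) \<le> x" by auto
      then have "P0 + 1 \<le> (1 - c) * x" using par by (simp add: pos_divide_le_eq mult.commute)
      then show "u x - P0 > 0 \<and> G1 x > 0" using uG[of x] xg par by (simp add: Gr_def G1_def)
    qed
  qed
  then show ?thesis unfolding hl_def hr_def by blast
qed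

text \<open>One candidate serves all starting points, so its contact set is the stopping set of the
  whole family of problems.\<close>

lemma candidate_optimal:
  fixes X :: "real \<Rightarrow> real \<Rightarrow> 'a \<Rightarrow> real"
  assumes "prob_space M" "complete_measure M" "standard_brownian_motion M B"
    and fund: "ou_fundamental \<theta> \<mu> \<sigma> lam \<psi>" and X: "\<And>x. OU_strong_solution M B \<theta> \<mu> \<sigma> x (X x)"
    and cand: "ou_fundamental.candidate \<theta> \<mu> \<sigma> lam D G" and D: "closed D" "D \<noteq> {}"
  shows "{x. stopping_value M B lam G (X x) = G x} = D"
    and "optimal_stopping_time M B lam G (X x) (entry_time (X x) D)"
proof -
  interpret ou_fundamental \<theta> \<mu> \<sigma> lam \<psi> by (rule fund)
  have P: "ou_process \<theta> \<mu> \<sigma> lam M B x (X x)" for x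
    by (intro ou_process.intro ou_process_axioms.intro brownian_space.intro brownian_space_axioms.intro
        ou_parameters_axioms assms(1-3) X)
  obtain u h C where c: "h \<in> borel_measurable borel" "\<And>y. ou_resolvent h y = ennreal (u y)" "continuous_on UNIV u"
    "\<And>y. u y \<ge> 0" "\<And>y. (u y)\<^sup>2 \<le> C * (1 + y\<^sup>2)" "\<And>y. y \<notin> D \<Longrightarrow> h y \<le> 0" "\<And>y. - u y \<le> G y"
    "\<And>y. G y = - u y \<longleftrightarrow> y \<in> D"
    using cand unfolding candidate_def by blast
  have v: "stopping_value M B lam G (X x) = - u x" "optimal_stopping_time M B lam G (X x) (entry_time (X x) D)" for x
    using ou_process.verification[OF P D c(1-7)] c(8) by blast+
  have "- u y = G y \<longleftrightarrow> y \<in> D" for y using c(8)[of y] by metis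
  then show "{x. stopping_value M B lam G (X x) = G x} = D" using v(1) by simp
  show "optimal_stopping_time M B lam G (X x) (entry_time (X x) D)" by (rule v(2))
qed

text \<open>The mean value theorem on [c, 1]: k < 0 puts \<Phi>' below - (\<lambda> + \<theta>) /
  \<lambda>, and \<Phi>(1) = 0. Both \<Phi>(c) > 0 and the order of the two thresholds
  follow.\<close>

lemma penalty_lower_bound:
  fixes \<Phi> :: "real \<Rightarrow> real"
  assumes \<Phi>: "C2_function \<Phi>" "\<Phi> 1 = 0" and k: "\<forall>c\<in>{0..1}. lam + \<theta> + lam * deriv \<Phi> c < 0" and c: "0 \<le> c" "c < 1"
  shows "(lam + \<theta>) * (1 - c) < lam * \<Phi> c"
proof -
  have "(\<Phi> has_real_derivative deriv \<Phi> x) (at x)" for x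
    using \<Phi>(1) unfolding C2_function_def by (simp add: DERIV_deriv_iff_field_differentiable)
  then obtain z where z: "c < z" "z < 1" "\<Phi> 1 - \<Phi> c = (1 - c) * deriv \<Phi> z"
    using MVT2[OF c(2), of \<Phi> "deriv \<Phi>"] by blast
  have "z \<in> {0..1}" using z c by simp
  then have "lam + \<theta> + lam * deriv \<Phi> z < 0" using k by blast
  then have "lam + \<theta> < lam * - deriv \<Phi> z" by simp
  then have "(lam + \<theta>) * (1 - c) < lam * - deriv \<Phi> z * (1 - c)" using c by (intro mult_strict_right_mono) auto
  also have "\<dots> = lam * (- ((1 - c) * deriv \<Phi> z))" by simp
  also have "(1 - c) * deriv \<Phi> z = - \<Phi> c" using z(3) \<Phi>(2) by simp
  also have "lam * - (- \<Phi> c) = lam * \<Phi> c" by simp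
  finally show ?thesis .
qed

theorem proposition5p2:
  fixes M :: "'a measure"
    and B :: "real \<Rightarrow> 'a \<Rightarrow> real"
    and X :: "real \<Rightarrow> real \<Rightarrow> 'a \<Rightarrow> real"
    and \<theta> \<mu> \<sigma> lam P0 c :: real
    and \<Phi> \<psi> \<gamma> :: "real \<Rightarrow> real"
    and U V :: "real \<Rightarrow> real \<Rightarrow> real"
    and D :: "real set"
  assumes "prob_space M" and "complete_measure M"
    and "standard_brownian_motion M B"
    and "\<theta> > 0" and "\<mu> > 0" and "\<sigma> > 0" and "lam > 0" and "P0 > 0"
    and "\<And>x. OU_strong_solution M B \<theta> \<mu> \<sigma> x (X x)"
    and "C2_function \<Phi>" and "antimono_on {0..1} \<Phi>" and "strictly_convex_on {0..1} \<Phi>" and "\<Phi> 1 = 0"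
    and U_def: "U = (\<lambda>x c. control_value M B lam \<Phi> (X x) c)"
    and k_neg: "\<forall>c\<in>{0..1}. lam + \<theta> + lam * deriv \<Phi> c < 0"
    and "increasing_fundamental_solution \<theta> \<mu> \<sigma> lam \<psi>"
    and "control_boundary \<theta> \<mu> lam \<Phi> \<psi> U \<gamma>"
    and "0 \<le> c" and "c < 1"
    and V_def: "V = (\<lambda>x c. stopping_value M B lam (\<lambda>y. U y c - P0) (X x))"
    and D_def: "D = {x. V x c = U x c - P0}"
  shows "(\<gamma> c \<ge> x2_0 \<theta> \<mu> lam P0 c \<longrightarrow>
            (\<exists>l. l < x1_0 P0 \<Phi> c \<and> D = {..l} \<and>
              (\<forall>x. optimal_stopping_time M B lam (\<lambda>y. U y c - P0) (X x) (entry_time (X x) {..l}))))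
       \<and> (\<gamma> c \<le> x1_0 P0 \<Phi> c \<longrightarrow>
            (\<exists>l. l < x2_0 \<theta> \<mu> lam P0 c \<and> D = {..l} \<and>
              (\<forall>x. optimal_stopping_time M B lam (\<lambda>y. U y c - P0) (X x) (entry_time (X x) {..l}))))
       \<and> (x1_0 P0 \<Phi> c < \<gamma> c \<and> \<gamma> c < x2_0 \<theta> \<mu> lam P0 c \<longrightarrow>
            (\<exists>l1. l1 < x1_0 P0 \<Phi> c \<and> D \<inter> {..\<gamma> c} = {..l1} \<and>
              (D \<inter> {\<gamma> c..} = {} \<and>
               (\<forall>x. optimal_stopping_time M B lam (\<lambda>y. U y c - P0) (X x) (entry_time (X x) {..l1}))
             \<or> (\<exists>l2 l3. l2 \<le> l3 \<and> l3 \<le> x2_0 \<theta> \<mu> lam P0 c \<and> D \<inter> {\<gamma> c..} = {l2..l3} \<and>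
                 (\<forall>x. optimal_stopping_time M B lam (\<lambda>y. U y c - P0) (X x)
                        (entry_time (X x) ({..l1} \<union> {l2..l3})))))))"
proof -
  note prob = assms(1) and compl = assms(2) and bm = assms(3)
  note pos = assms(4-8) and sol = assms(9) and fundsol = assms(16) and bdry = assms(17) and c0 = assms(18) and c1 = assms(19)
  define f where "f = \<Phi> c"
  define g where "g = \<gamma> c"
  define x1 where "x1 = x1_0 P0 \<Phi> c"
  define x2 where "x2 = x2_0 \<theta> \<mu> lam P0 c"
  have c01: "c \<in> {0..1}" using c0 c1 by simp
  have fl: "(lam + \<theta>) * (1 - c) < lam * f"
    unfolding f_def by (rule penalty_lower_bound[OF assms(10) assms(13) k_neg c0 c1])
  have lt: "(lam + \<theta>) * (1 - c) > 0" using pos c1 by simp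
  have "lam * f > 0" using fl lt by linarith
  then have f0: "f > 0" using pos by (simp add: zero_less_mult_iff)
  have x1: "x1 = P0 / f" by (simp add: x1_def x1_0_def f_def)
  have x2: "x2 = (\<theta> * \<mu> * (1 - c) + lam * P0) / ((lam + \<theta>) * (1 - c))" by (simp add: x2_def x2_0_def)
  \<comment> \<open>Same numerator \<open>lam * P0\<close> over a smaller denominator; the term
    \<open>\<theta> * \<mu> * (1 - c)\<close> only enlarges \<open>x2\<close>.\<close>
  have x12: "x1 < x2"
  proof -
    have "x1 = (lam * P0) / (lam * f)" using pos by (simp add: x1)
    also have "\<dots> < (lam * P0) / ((lam + \<theta>) * (1 - c))" using fl lt pos by (intro divide_strict_left_mono) (auto intro: mult_pos_pos)
    also have "\<dots> \<le> x2" unfolding x2 using lt pos c1 by (intro divide_right_mono) auto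
    finally show ?thesis .
  qed
  have ouf: "ou_fundamental \<theta> \<mu> \<sigma> lam \<psi>"
    by (intro ou_fundamental.intro ou_parameters.intro ou_fundamental_axioms.intro) (use pos fundsol in auto)
  let ?G = "\<lambda>y. U y c - P0"
  let ?hG = "\<lambda>x. if x \<le> g then lam * (P0 - f * x) else \<theta> * \<mu> * (1 - c) + lam * P0 - (lam + \<theta>) * (1 - c) * x"
  have "\<exists>G1 C. ou_gain \<theta> \<mu> \<sigma> lam \<psi> ?G G1 ?hG g C"
  proof (rule ou_fundamental.ou_gain_piecewise[OF ouf f0 c1 pos(5) refl])
    show "U x c = (if x < g then \<psi> x / \<psi> g * (g * (1 - c) - lam * f * ((g - \<mu>) / (lam + \<theta>) + \<mu> / lam))
        + lam * f * ((x - \<mu>) / (lam + \<theta>) + \<mu> / lam) else x * (1 - c))" for x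
      using bdry c01 unfolding control_boundary_def f_def g_def by blast
    show "W2inf_loc (\<lambda>x. U x c)" using bdry c01 unfolding control_boundary_def by blast
  qed
  then obtain G1 C where gain: "ou_gain \<theta> \<mu> \<sigma> lam \<psi> ?G G1 ?hG g C" by blast
  have hl: "lam * (P0 - f * x) > 0 \<longleftrightarrow> x < x1" "lam * (P0 - f * x) < 0 \<longleftrightarrow> x > x1" for x
    using pos f0 by (auto simp: x1 zero_less_mult_iff mult_less_0_iff pos_less_divide_eq pos_divide_less_eq mult.commute)
  have hr: "\<theta> * \<mu> * (1 - c) + lam * P0 - (lam + \<theta>) * (1 - c) * x > 0 \<longleftrightarrow> x < x2"
    "\<theta> * \<mu> * (1 - c) + lam * P0 - (lam + \<theta>) * (1 - c) * x < 0 \<longleftrightarrow> x > x2" for x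
    unfolding x2 using lt by (auto simp: pos_less_divide_eq pos_divide_less_eq mult.commute)
  let ?cand = "ou_fundamental.candidate \<theta> \<mu> \<sigma> lam"
  let ?opt = "\<lambda>S. \<forall>x. optimal_stopping_time M B lam ?G (X x) (entry_time (X x) S)"
  have result: "D = S \<and> ?opt S" if "?cand S ?G" "closed S" "S \<noteq> {}" for S
    using candidate_optimal[OF prob compl bm ouf sol that] unfolding D_def V_def by blast
  \<comment> \<open>With \<open>g \<ge> x2\<close> the right branch occurs only where its affine
    function is already negative, so the single sign change is at \<open>x1\<close>.\<close>
  have i: "\<exists>l<x1. D = {..l} \<and> ?opt {..l}" if ge: "g \<ge> x2"
  proof -
    have "\<exists>l<x1. ?cand {..l} ?G"
    proof (rule ou_gain.one_sided_stopping_set[OF gain])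
      show "?hG x > 0" if "x < x1" "x \<noteq> g" for x using that hl(1)[of x] ge x12 by auto
      show "?hG x < 0" if "x1 < x" "x \<noteq> g" for x using that hl(2)[of x] hr(2)[of x] ge by auto
      show "?hG g \<ge> 0" if "g < x1" using that ge x12 by simp
    qed
    then obtain l where l: "l < x1" "?cand {..l} ?G" by blast
    have "D = {..l} \<and> ?opt {..l}" by (rule result[OF l(2)]) auto
    then show ?thesis using l(1) by blast
  qed
  \<comment> \<open>With \<open>g \<le> x1\<close> the left branch occurs only where its affine
    function is nonnegative, so the single sign change is at \<open>x2\<close>. If
    \<open>g = x1\<close> the value at \<open>g\<close> is 0, which the condition at the junction
    permits.\<close>
  have ii: "\<exists>l<x2. D = {..l} \<and> ?opt {..l}" if le: "g \<le> x1"
  proof -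
    have "\<exists>l<x2. ?cand {..l} ?G"
    proof (rule ou_gain.one_sided_stopping_set[OF gain])
      show "?hG x > 0" if "x < x2" "x \<noteq> g" for x using that hl(1)[of x] hr(1)[of x] le by auto
      show "?hG x < 0" if "x2 < x" "x \<noteq> g" for x using that hr(2)[of x] le x12 by auto
      show "?hG g \<ge> 0" using hl(2)[of g] le by auto
    qed
    then obtain l where l: "l < x2" "?cand {..l} ?G" by blast
    have "D = {..l} \<and> ?opt {..l}" by (rule result[OF l(2)]) auto
    then show ?thesis using l(1) by blast
  qed
  \<comment> \<open>The signs are plus, minus, plus, minus, changing at \<open>x1\<close>,
    \<open>g\<close> and \<open>x2\<close>: two convex pieces in the scale, each followed by a
    concave one.\<close>
  have iii: "\<exists>l1<x1. D \<inter> {..g} = {..l1} \<and> (D \<inter> {g..} = {} \<and> ?opt {..l1} \<or>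
      (\<exists>l2 l3. l2 \<le> l3 \<and> l3 \<le> x2 \<and> D \<inter> {g..} = {l2..l3} \<and> ?opt ({..l1} \<union> {l2..l3})))" if lt: "x1 < g" "g < x2"
  proof -
    have "\<exists>l<x1. ?cand {..l} ?G \<or> (\<exists>b \<beta>. g < b \<and> b \<le> \<beta> \<and> \<beta> < x2 \<and> ?cand ({..l} \<union> {b..\<beta>}) ?G)"
    proof (rule ou_gain.two_sided_stopping_set[OF gain lt])
      show "?hG x > 0" if "x < x1" for x using that hl(1)[of x] lt by auto
      show "?hG x < 0" if "x1 < x" "x < g" for x using that hl(2)[of x] by auto
      show "?hG x > 0" if "g < x" "x < x2" for x using that hr(1)[of x] by auto
      show "?hG x < 0" if "x2 < x" for x using that hr(2)[of x] lt by auto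
    qed
    then obtain l where l: "l < x1" and "?cand {..l} ?G \<or> (\<exists>b \<beta>. g < b \<and> b \<le> \<beta> \<and> \<beta> < x2 \<and> ?cand ({..l} \<union> {b..\<beta>}) ?G)" by blast
    then consider "?cand {..l} ?G" | b \<beta> where "g < b" "b \<le> \<beta>" "\<beta> < x2" "?cand ({..l} \<union> {b..\<beta>}) ?G" by blast
    then show ?thesis
    proof cases
      case 1
      have "D = {..l} \<and> ?opt {..l}" by (rule result[OF 1]) auto
      then have r: "D = {..l}" "?opt {..l}" by blast+
      have "D \<inter> {..g} = {..l}" "D \<inter> {g..} = {}" using r(1) l lt by auto
      then show ?thesis using l r(2) by blast
    next
      case 2
      have "closed ({..l} \<union> {b..\<beta>})" by (intro closed_Un) auto
      then have "D = {..l} \<union> {b..\<beta>} \<and> ?opt ({..l} \<union> {b..\<beta>})" by (rule result[OF 2(4)]) auto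
      then have r: "D = {..l} \<union> {b..\<beta>}" "?opt ({..l} \<union> {b..\<beta>})" by blast+
      have "D \<inter> {..g} = {..l}" "D \<inter> {g..} = {b..\<beta>}" using r(1) l lt 2 by auto
      moreover have "\<beta> \<le> x2" using 2(3) by simp
      ultimately show ?thesis using l r(2) 2(2) by blast
    qed
  qed
  show ?thesis
    using i ii iii unfolding g_def x1_def x2_def by blast
qed

end
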